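(* Let $n\geq 1$ and $\frac{n}{n+1}<p\leq 1$, and assume that $\Omega\subset\mathbf{R}^n$ is a uniform domain. Then $M^{1,p}_{ball}(\Omega)=M^{1,p}(\Omega)$ and, especially, $$H^{1,p}(\Omega)=M^{1,p}(\Omega),$$ with equivalent (quasi)norms.
   Context: Uniform domain: a domain $\Omega\subset\mathbf{R}^n$ is uniform if there is a constant $c>0$ such that for all $x,y\in\Omega$ there is a rectifiable path $\gamma:[0,T]\to\Omega$, parametrized by arclength, with $\gamma(0)=x$, $\gamma(T)=y$, $T\leq c|x-y|$, and $B(\gamma(t),\frac1c\min(t,T-t))\subset\Omega$ for $t\in(0,T)$. Write $d(x,\partial\Omega)$ for the distance from $x$ to $\partial\Omega$ (with $d(x,\partial\Omega)=\infty$ if $\Omega=\mathbf{R}^n$). Grand maximal function: for a ball $B=B(x,r)$ and an integer $N\geq1$ let $C^\infty_{0,N}(B)=\{\varphi\in C_0^\infty(B(x,r)): |\partial^\alpha\varphi|\leq r^{-n-|\alpha|}\text{ for }|\alpha|\leq N\}$. For a distribution $f$ defined on $B(x,r)$ put $$\mathcal{M}_{r,N}f(x)=\sup\{|\langle f,\varphi\rangle| : \varphi\in C^\infty_{0,N}(B(x,r')),\ 0<r'\leq r\}$$ (all $0<r'<\infty$ if $r=\infty$). Hardy space on $\Omega$: let $p\in(0,1]$ and fix an integer $N>\max(0,n(\frac1p-1))$. A distribution $f\in\mathcal{D}'(\Omega)$ belongs to $H^p(\Omega)$ iff $\|f\|_{H^p(\Omega)}:=\big\|\mathcal{M}_{d(x,\partial\Omega)/2,\,N}f(x)\big\|_{L^p(\Omega)}<\infty$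 (the $L^p$-norm being taken in the variable $x\in\Omega$). Hardy-Sobolev space on $\Omega$ (for $p>n/(n+1)$): a locally integrable function $u:\Omega\to\mathbf{R}$ belongs to $H^{1,p}(\Omega)$ iff $u\in L^p(\Omega)$ and its distributional derivatives satisfy $D_ju\in H^p(\Omega)$ for all $j=1,\dots,n$; $\|u\|_{H^{1,p}(\Omega)}:=\sum_{j=1}^n\|D_ju\|_{H^p(\Omega)}+\|u\|_{L^p(\Omega)}$. The space $M^{1,p}(\Omega)$ consists of the measurable functions $u\in L^p(\Omega)$ for which there are $g\in L^p(\Omega)$ and a set $E\subset\Omega$ of measure zero such that $$|u(x)-u(y)|\leq|x-y|(g(x)+g(y))\quad( * )$$ for all $x,y\in\Omega\setminus E$; $\|u\|_{M^{1,p}(\Omega)}:=\|u\|_{L^p(\Omega)}+\inf\|g\|_{L^p(\Omega)}$ over all such $g$. The space $M^{1,p}_{ball}(\Omega)$ and its (quasi)norm are defined in exactly the same manner, except that $( * )$ is required only for those $x,y\in\Omega\setminus E$ that satisfy $|x-y|\leq\frac14\min(d(x,\partial\Omega),d(y,\partial\Omega))$. *)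

theory Defs
  imports "HOL-Analysis.Analysis"
begin

definition arc_variation :: "(real \<Rightarrow> 'a::metric_space) \<Rightarrow> real \<Rightarrow> real \<Rightarrow> ennreal" where
  "arc_variation \<gamma> a b =
     (SUP ts \<in> {ts. sorted ts \<and> set ts \<subseteq> {a..b}}.
        ennreal (\<Sum>i<length ts - 1. dist (\<gamma> (ts ! i)) (\<gamma> (ts ! Suc i))))"

text \<open>Rectifiability is implied: the total length is the finite number \<open>T\<close>.\<close>

definition arclength_path :: "real \<Rightarrow> (real \<Rightarrow> 'a::metric_space) \<Rightarrow> bool" where
  "arclength_path T \<gamma> \<longleftrightarrow> 0 \<le> T \<and> continuous_on {0..T} \<gamma> \<and>
     (\<forall>s t. 0 \<le> s \<longrightarrow> s \<le> t \<longrightarrow> t \<le> T \<longrightarrow> arc_variation \<gamma> s t = ennreal (t - s))"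

definition domain :: "'a::topological_space set \<Rightarrow> bool" where
  "domain \<Omega> \<longleftrightarrow> open \<Omega> \<and> connected \<Omega> \<and> \<Omega> \<noteq> {}"

definition uniform_domain :: "(real^'n) set \<Rightarrow> bool" where
  "uniform_domain \<Omega> \<longleftrightarrow> domain \<Omega> \<and>
     (\<exists>c>0. \<forall>x\<in>\<Omega>. \<forall>y\<in>\<Omega>. \<exists>T \<gamma>.
        arclength_path T \<gamma> \<and> \<gamma> ` {0..T} \<subseteq> \<Omega> \<and> \<gamma> 0 = x \<and> \<gamma> T = y \<and>
        T \<le> c * dist x y \<and>
        (\<forall>t\<in>{0<..<T}. ball (\<gamma> t) (1 / c * min t (T - t)) \<subseteq> \<Omega>))"

text \<open>The infimum over the empty set in \<^typ>\<open>ennreal\<close> is \<open>\<infinity>\<close>, which is the intended value when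
  \<open>\<Omega>\<close> is the whole space (unlike \<^const>\<open>infdist\<close>, which returns \<open>0\<close> there).\<close>

definition bdist :: "'a::metric_space set \<Rightarrow> 'a \<Rightarrow> ennreal" where
  "bdist \<Omega> x = (INF y\<in>frontier \<Omega>. ennreal (dist x y))"

definition pderiv_at :: "'n \<Rightarrow> (real^'n \<Rightarrow> real) \<Rightarrow> real^'n \<Rightarrow> real" where
  "pderiv_at j \<phi> = (\<lambda>x. frechet_derivative \<phi> (at x) (axis j 1))"

text \<open>A list \<open>js\<close> of coordinates stands for the multi-index \<open>\<alpha>\<close> counting the occurrences of each
  coordinate, with \<open>\<bar>\<alpha>\<bar> = length js\<close>. Several lists give the same \<open>\<alpha>\<close>, but mixed partial
  derivatives of smooth functions commute, so the families
  \<open>{\<partial>\<^sup>\<alpha> \<phi>. \<bar>\<alpha>\<bar> \<le> m}\<close> and \<open>{pderivs js \<phi>. length js \<le> m}\<close> coincide.\<close>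

definition pderivs :: "'n list \<Rightarrow> (real^'n \<Rightarrow> real) \<Rightarrow> real^'n \<Rightarrow> real" where
  "pderivs js \<phi> = foldr pderiv_at js \<phi>"

definition smooth :: "(real^'n \<Rightarrow> real) \<Rightarrow> bool" where
  "smooth \<phi> \<longleftrightarrow> (\<forall>js x. pderivs js \<phi> differentiable (at x))"

definition test_funs :: "(real^'n) set \<Rightarrow> (real^'n \<Rightarrow> real) set" where
  "test_funs U = {\<phi>. smooth \<phi> \<and> compact (closure (support_on UNIV \<phi>)) \<and>
                      closure (support_on UNIV \<phi>) \<subseteq> U}"

definition distribution_on :: "(real^'n) set \<Rightarrow> ((real^'n \<Rightarrow> real) \<Rightarrow> real) \<Rightarrow> bool" where
  "distribution_on \<Omega> f \<longleftrightarrow>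
     (\<forall>\<phi>\<in>test_funs \<Omega>. \<forall>\<psi>\<in>test_funs \<Omega>. \<forall>a b.
        f (\<lambda>x. a * \<phi> x + b * \<psi> x) = a * f \<phi> + b * f \<psi>) \<and>
     (\<forall>K. compact K \<longrightarrow> K \<subseteq> \<Omega> \<longrightarrow>
        (\<exists>C m. \<forall>\<phi>\<in>test_funs \<Omega>. closure (support_on UNIV \<phi>) \<subseteq> K \<longrightarrow>
           \<bar>f \<phi>\<bar> \<le> C * (\<Sum>js | length js \<le> m. SUP x. \<bar>pderivs js \<phi> x\<bar>)))"

definition regular_distr :: "(real^'n) set \<Rightarrow> (real^'n \<Rightarrow> real) \<Rightarrow> (real^'n \<Rightarrow> real) \<Rightarrow> real" where
  "regular_distr \<Omega> u = (\<lambda>\<phi>. LINT x:\<Omega>|lebesgue. u x * \<phi> x)"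

definition distr_deriv ::
    "'n \<Rightarrow> ((real^'n \<Rightarrow> real) \<Rightarrow> real) \<Rightarrow> (real^'n \<Rightarrow> real) \<Rightarrow> real" where
  "distr_deriv j f = (\<lambda>\<phi>. - f (pderiv_at j \<phi>))"

text \<open>Only used with exponent \<open>a > 0\<close>.\<close>

definition epowr :: "ennreal \<Rightarrow> real \<Rightarrow> ennreal" where
  "epowr x a = (if x = \<infinity> then \<infinity> else ennreal (enn2real x powr a))"

definition eLp_norm :: "real \<Rightarrow> (real^'n) set \<Rightarrow> (real^'n \<Rightarrow> ennreal) \<Rightarrow> ennreal" where
  "eLp_norm p \<Omega> F = epowr (\<integral>\<^sup>+ x. epowr (F x) p \<partial>lebesgue_on \<Omega>) (1 / p)"

definition Lp_norm :: "real \<Rightarrow> (real^'n) set \<Rightarrow> (real^'n \<Rightarrow> real) \<Rightarrow> ennreal" where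
  "Lp_norm p \<Omega> u = eLp_norm p \<Omega> (\<lambda>x. ennreal \<bar>u x\<bar>)"

text \<open>Functions on \<open>\<Omega>\<close> are represented by total functions; here and below, membership and norms
  depend only on the values on \<open>\<Omega>\<close>.\<close>

definition Lp :: "real \<Rightarrow> (real^'n) set \<Rightarrow> (real^'n \<Rightarrow> real) set" where
  "Lp p \<Omega> = {u. u \<in> borel_measurable (lebesgue_on \<Omega>) \<and> Lp_norm p \<Omega> u < \<infinity>}"

definition locally_integrable :: "(real^'n) set \<Rightarrow> (real^'n \<Rightarrow> real) \<Rightarrow> bool" where
  "locally_integrable \<Omega> u \<longleftrightarrow> (\<forall>K. compact K \<longrightarrow> K \<subseteq> \<Omega> \<longrightarrow> u absolutely_integrable_on K)"

definition test_funs_N :: "nat \<Rightarrow> real^'n \<Rightarrow> real \<Rightarrow> (real^'n \<Rightarrow> real) set" where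
  "test_funs_N N x r =
     {\<phi> \<in> test_funs (ball x r).
        \<forall>js y. length js \<le> N \<longrightarrow> \<bar>pderivs js \<phi> y\<bar> \<le> 1 / r ^ (CARD('n) + length js)}"

definition grand_max ::
    "ennreal \<Rightarrow> nat \<Rightarrow> ((real^'n \<Rightarrow> real) \<Rightarrow> real) \<Rightarrow> real^'n \<Rightarrow> ennreal" where
  "grand_max r N f x =
     (SUP \<phi> \<in> {\<phi>. \<exists>s::real. 0 < s \<and> ennreal s \<le> r \<and> \<phi> \<in> test_funs_N N x s}. ennreal \<bar>f \<phi>\<bar>)"

definition Hp_norm ::
    "real \<Rightarrow> nat \<Rightarrow> (real^'n) set \<Rightarrow> ((real^'n \<Rightarrow> real) \<Rightarrow> real) \<Rightarrow> ennreal" where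
  "Hp_norm p N \<Omega> f = eLp_norm p \<Omega> (\<lambda>x. grand_max (bdist \<Omega> x / 2) N f x)"

definition Hp :: "real \<Rightarrow> nat \<Rightarrow> (real^'n) set \<Rightarrow> ((real^'n \<Rightarrow> real) \<Rightarrow> real) set" where
  "Hp p N \<Omega> = {f. distribution_on \<Omega> f \<and> Hp_norm p N \<Omega> f < \<infinity>}"

definition H1p :: "real \<Rightarrow> nat \<Rightarrow> (real^'n) set \<Rightarrow> (real^'n \<Rightarrow> real) set" where
  "H1p p N \<Omega> =
     {u. locally_integrable \<Omega> u \<and> u \<in> Lp p \<Omega> \<and>
         (\<forall>j. distr_deriv j (regular_distr \<Omega> u) \<in> Hp p N \<Omega>)}"

definition H1p_norm :: "real \<Rightarrow> nat \<Rightarrow> (real^'n) set \<Rightarrow> (real^'n \<Rightarrow> real) \<Rightarrow> ennreal" where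
  "H1p_norm p N \<Omega> u =
     (\<Sum>j\<in>UNIV. Hp_norm p N \<Omega> (distr_deriv j (regular_distr \<Omega> u))) + Lp_norm p \<Omega> u"

text \<open>\<open>P\<close> is the relation selecting the pairs for which the pointwise inequality is required.\<close>

definition gradients ::
    "(real^'n \<Rightarrow> real^'n \<Rightarrow> bool) \<Rightarrow> real \<Rightarrow> (real^'n) set \<Rightarrow> (real^'n \<Rightarrow> real) \<Rightarrow> (real^'n \<Rightarrow> real) set"
  where
  "gradients P p \<Omega> u =
     {g \<in> Lp p \<Omega>. \<exists>E\<subseteq>\<Omega>. negligible E \<and>
        (\<forall>x\<in>\<Omega> - E. \<forall>y\<in>\<Omega> - E. P x y \<longrightarrow> \<bar>u x - u y\<bar> \<le> dist x y * (g x + g y))}"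

definition ball_pairs :: "(real^'n) set \<Rightarrow> real^'n \<Rightarrow> real^'n \<Rightarrow> bool" where
  "ball_pairs \<Omega> x y \<longleftrightarrow> ennreal (dist x y) \<le> min (bdist \<Omega> x) (bdist \<Omega> y) / 4"

definition M1p :: "real \<Rightarrow> (real^'n) set \<Rightarrow> (real^'n \<Rightarrow> real) set" where
  "M1p p \<Omega> = {u \<in> Lp p \<Omega>. gradients (\<lambda>_ _. True) p \<Omega> u \<noteq> {}}"

definition M1p_norm :: "real \<Rightarrow> (real^'n) set \<Rightarrow> (real^'n \<Rightarrow> real) \<Rightarrow> ennreal" where
  "M1p_norm p \<Omega> u = Lp_norm p \<Omega> u + (INF g\<in>gradients (\<lambda>_ _. True) p \<Omega> u. Lp_norm p \<Omega> g)"

definition M1p_ball :: "real \<Rightarrow> (real^'n) set \<Rightarrow> (real^'n \<Rightarrow> real) set" where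
  "M1p_ball p \<Omega> = {u \<in> Lp p \<Omega>. gradients (ball_pairs \<Omega>) p \<Omega> u \<noteq> {}}"

definition M1p_ball_norm :: "real \<Rightarrow> (real^'n) set \<Rightarrow> (real^'n \<Rightarrow> real) \<Rightarrow> ennreal" where
  "M1p_ball_norm p \<Omega> u =
     Lp_norm p \<Omega> u + (INF g\<in>gradients (ball_pairs \<Omega>) p \<Omega> u. Lp_norm p \<Omega> g)"

definition equivalent_norms :: "'b set \<Rightarrow> ('b \<Rightarrow> ennreal) \<Rightarrow> ('b \<Rightarrow> ennreal) \<Rightarrow> bool" where
  "equivalent_norms X nrm nrm' \<longleftrightarrow>
     (\<exists>C::real. C > 0 \<and> (\<forall>u\<in>X. nrm u \<le> ennreal C * nrm' u \<and> nrm' u \<le> ennreal C * nrm u))"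

end

theory Submission
  imports Defs
begin

text \<open>
  Write \<open>n\<close> for the dimension and \<open>q = n / (n + 1) < p\<close>.

  \<open>M \<subseteq> H\<close>: testing a derivative of \<open>u\<close> against an admissible bump at scale \<open>s\<close> costs at most the mean
  oscillation of \<open>u\<close> over the ball divided by \<open>s\<close>. The Sobolev--Poincare inequality bounds this by
  the mean of \<open>g\<^sup>q\<close> to the power \<open>1 / q\<close>, hence by the Hardy--Littlewood maximal function of \<open>g\<^sup>q\<close>, which
  is bounded on \<open>L\<^sup>p\<^sup>/\<^sup>q\<close> since \<open>p / q > 1\<close>.

  \<open>H \<subseteq> M_ball\<close>: shrink a bump at scale \<open>dist x y\<close> around \<open>y\<close> to the point \<open>y\<close>, and also to \<open>x\<close> while moving
  its centre. Differentiating the mean of \<open>u\<close> against the moving bump produces only distributional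
  derivatives of \<open>u\<close> tested against admissible functions, so the means change by at most a multiple of
  \<open>dist x y\<close> times the grand maximal functions at \<open>x\<close> and \<open>y\<close>; at Lebesgue points they tend to \<open>u\<close>.

  \<open>M_ball \<subseteq> M\<close>: along the curve given by uniformity, choose in each ball \<open>B(\<gamma>(t), t / 16c)\<close> a point where \<open>g\<close>
  is at most its average; the average is controlled by the maximal function at the end point of the
  curve. Neighbouring points of a geometric sequence of parameters satisfy the local inequality, and the
  steps sum to at most a multiple of the length of the curve.
\<close>

section \<open>The Hardy--Littlewood maximal function\<close>

text \<open>The exponent \<open>q\<close> is the one whose Sobolev conjugate is 1, so the
  \<open>q\<close>-mean of a gradient already controls the oscillation of \<open>u\<close> in L^1.
  This also gives local integrability of \<open>u\<close>, which membership in L^p does not give for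
  p < 1. The bound on \<open>p\<close> is exactly what leaves room for the maximal theorem with
  exponent \<open>p / q\<close>. The cycle of inclusions is closed through the global space for a
  reason: a test function admissible at \<open>x\<close> may live on a ball whose radius is half the
  distance to the boundary, and pairs of points in that ball need not satisfy the local condition
  with its factor 1/4. From the Hardy side the local condition fits: \<open>4 * dist x y\<close>
  being at most the distance to the boundary makes all scales up to \<open>2 * dist x y\<close>
  admissible at both points. In the main estimates the constants are quantified before the
  functions, since the equality of the spaces has to come with equivalent norms. L^p bounds are
  proved for integrals of p-th powers and raised to the power 1/p afterwards, because for p < 1 the
  quasinorm has no triangle inequality.\<close>

lemma sigma_finite_lebesgue: "sigma_finite_measure (lebesgue :: 'a::euclidean_space measure)"
proof
  obtain A :: "'a set set" where A: "countable A" "A \<subseteq> sets lborel" "\<Union>A = space lborel" "\<forall>a\<in>A. emeasure lborel a \<noteq> \<infinity>"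
    using lborel.sigma_finite_countable by blast
  show "\<exists>A::'a set set. countable A \<and> A \<subseteq> sets lebesgue \<and> \<Union>A = space lebesgue \<and> (\<forall>a\<in>A. emeasure lebesgue a \<noteq> \<infinity>)"
    by (rule exI[of _ A]) (use A in auto)
qed

lemma emeasure_lebesgue_ball:
  fixes a :: "'a::euclidean_space"
  assumes "0 \<le> r"
  shows "emeasure lebesgue (ball a r) = ennreal (unit_ball_vol (real DIM('a)) * r ^ DIM('a))"
  using emeasure_ball[OF assms, of a] by simp

text \<open>Uncentred: every point of a ball sees that ball, so superlevel sets are open and
  \<open>maxf f\<close> is Borel for arbitrary \<open>f\<close>. Dividing by a power of the radius
  instead of the volume changes the function only by the constant factor
  \<open>unit_ball_vol\<close>.\<close>

definition maxf :: "('a::euclidean_space \<Rightarrow> ennreal) \<Rightarrow> 'a \<Rightarrow> ennreal" where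
  "maxf f x = (SUP b\<in>{b. x \<in> ball (fst b) (snd b)}.
     (\<integral>\<^sup>+y\<in>ball (fst b) (snd b). f y \<partial>lebesgue) / ennreal (snd b ^ DIM('a)))"

lemma nn_integral_ball_le_maxf:
  fixes f :: "'a::euclidean_space \<Rightarrow> ennreal"
  assumes "x \<in> ball a r"
  shows "(\<integral>\<^sup>+y\<in>ball a r. f y \<partial>lebesgue) \<le> ennreal (r ^ DIM('a)) * maxf f x"
proof -
  have r: "r > 0" using assms by (metis ball_empty empty_iff not_le)
  let ?I = "\<integral>\<^sup>+y. f y * indicator (ball a r) y \<partial>lebesgue"
  have "?I / ennreal (r ^ DIM('a)) \<le> maxf f x"
    unfolding maxf_def by (rule SUP_upper2[of "(a, r)"]) (use assms in auto)
  then have "ennreal (r ^ DIM('a)) * (?I / ennreal (r ^ DIM('a))) \<le> ennreal (r ^ DIM('a)) * maxf f x"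
    by (intro mult_left_mono) auto
  moreover have "ennreal (r ^ DIM('a)) * (?I / ennreal (r ^ DIM('a))) = ?I"
    using r by (simp add: ennreal_times_divide mult.commute[of "ennreal _"] ennreal_mult_divide_eq)
  ultimately show ?thesis by simp
qed

lemma less_maxfD:
  fixes f :: "'a::euclidean_space \<Rightarrow> ennreal"
  assumes "t < maxf f x"
  obtains a r where "x \<in> ball a r" "0 < r"
    "t * ennreal (r ^ DIM('a)) < (\<integral>\<^sup>+y\<in>ball a r. f y \<partial>lebesgue)"
    "\<And>z. z \<in> ball a r \<Longrightarrow> t < maxf f z"
proof -
  from assms obtain b where b: "x \<in> ball (fst b) (snd b)"
    "t < (\<integral>\<^sup>+y\<in>ball (fst b) (snd b). f y \<partial>lebesgue) / ennreal (snd b ^ DIM('a))"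
    unfolding maxf_def less_SUP_iff by auto
  define a r where "a = fst b" and "r = snd b"
  have r: "r > 0" using b(1) by (metis ball_empty empty_iff not_le r_def)
  let ?I = "\<integral>\<^sup>+y. f y * indicator (ball a r) y \<partial>lebesgue"
  have *: "t < ?I / ennreal (r ^ DIM('a))" using b(2) by (simp add: a_def r_def)
  have "t * ennreal (r ^ DIM('a)) < ?I"
  proof (rule ccontr)
    assume "\<not> ?thesis"
    then have "?I / ennreal (r ^ DIM('a)) \<le> t"
      using r by (intro divide_le_posI_ennreal) (auto simp: mult.commute)
    then show False using * by simp
  qed
  moreover have "t < maxf f z" if "z \<in> ball a r" for z
    using * unfolding maxf_def by (rule less_le_trans) (rule SUP_upper2[of "(a, r)"], use that in auto)
  ultimately show thesis using that b(1) r by (auto simp: a_def r_def)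
qed

lemma open_maxf: "open {x. t < maxf f x}"
proof (rule openI)
  fix x assume "x \<in> {x. t < maxf f x}"
  then obtain a r where ar: "x \<in> ball a r" "\<And>z. z \<in> ball a r \<Longrightarrow> t < maxf f z"
    by (auto elim: less_maxfD)
  then show "\<exists>e>0. ball x e \<subseteq> {x. t < maxf f x}"
    using open_contains_ball[of "ball a r"] by blast
qed

lemma borel_measurable_maxf [measurable]: "maxf f \<in> borel_measurable borel"
  by (rule borel_measurableI_greater) (simp add: open_maxf)

lemma measurable_lebesgueI: "f \<in> borel_measurable borel \<Longrightarrow> f \<in> borel_measurable lebesgue"
  by (rule measurable_completion) simp

text \<open>Vitali covering: each point of the superlevel set lies in a ball of radius r carrying
  mass more than t r^n. A countable disjoint subfamily has five-fold enlargements that still cover,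
  and the masses of disjoint balls add up to at most the integral of \<open>f\<close>. Infinite
  integrals are split off because the covering lemma needs bounded radii.\<close>

lemma maxf_weak_type:
  fixes f :: "'a::euclidean_space \<Rightarrow> ennreal"
  assumes f [measurable]: "f \<in> borel_measurable lebesgue" and t: "0 < t"
  shows "emeasure lebesgue {x. ennreal t < maxf f x}
    \<le> ennreal (5 ^ DIM('a) * unit_ball_vol (real DIM('a)) / t) * (\<integral>\<^sup>+y. f y \<partial>lebesgue)"
proof (cases "(\<integral>\<^sup>+y. f y \<partial>lebesgue) = \<infinity>")
  case True
  define c where "c = 5 ^ DIM('a) * unit_ball_vol (real DIM('a)) / t"
  have "c > 0" using t by (simp add: c_def)
  then show ?thesis unfolding c_def[symmetric] True by (simp add: ennreal_mult_top)
next
  case False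
  define n where "n = DIM('a)"
  have n: "n \<ge> 1" unfolding n_def using DIM_positive[where 'a='a] by linarith
  define I where "I = enn2real (\<integral>\<^sup>+y. f y \<partial>lebesgue)"
  have I: "(\<integral>\<^sup>+y. f y \<partial>lebesgue) = ennreal I" "I \<ge> 0"
    using False by (auto simp: I_def less_top)
  define J where "J b = (\<integral>\<^sup>+y\<in>ball (fst b) (snd b). f y \<partial>lebesgue)" for b :: "'a \<times> real"
  define K where "K = {b :: 'a \<times> real. snd b > 0 \<and> ennreal t * ennreal (snd b ^ n) < J b}"
  define A where "A = {x. ennreal t < maxf f x}"
  have cov: "A \<subseteq> (\<Union>b\<in>K. ball (fst b) (snd b))"
  proof
    fix x assume "x \<in> A"
    then obtain a r where "x \<in> ball a r" "0 < r" "ennreal t * ennreal (r ^ n) < J (a, r)"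
      unfolding A_def J_def n_def by (auto elim: less_maxfD)
    then show "x \<in> (\<Union>b\<in>K. ball (fst b) (snd b))" by (auto simp: K_def intro!: bexI[of _ "(a, r)"])
  qed
  \<comment> \<open>The mass condition gives r^n \<le> I / t. The maximum with 1 avoids taking an
    n-th root: for r \<ge> 1 one has r \<le> r^n.\<close>
  have rad: "0 < snd b \<and> snd b \<le> max 1 (I / t)" if "b \<in> K" for b
  proof -
    have "J b \<le> ennreal I" unfolding J_def I(1)[symmetric]
      by (rule nn_integral_mono) (auto split: split_indicator)
    then have "ennreal (t * snd b ^ n) < ennreal I"
      using that t by (auto simp: K_def ennreal_mult')
    then have "t * snd b ^ n < I" using t that by (auto simp: K_def ennreal_less_iff)
    then have 1: "snd b ^ n \<le> I / t" using t by (simp add: field_simps)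
    have "snd b \<le> snd b ^ n" if "snd b \<ge> 1" using self_le_power[OF that, of n] n by simp
    then show ?thesis using 1 that by (fastforce simp: K_def)
  qed
  obtain C where C: "countable C" "C \<subseteq> K"
     "pairwise (\<lambda>i j. disjnt (ball (fst i) (snd i)) (ball (fst j) (snd j))) C"
     "A \<subseteq> (\<Union>i\<in>C. ball (fst i) (5 * snd i))"
    by (rule Vitali_covering_lemma_balls[OF cov rad]) blast+
  define e where "e = to_nat_on C"
  have inj: "inj_on e C" unfolding e_def using C(1) by (rule inj_on_to_nat_on)
  define i where "i = the_inv_into C e"
  have ie: "i (e b) = b" if "b \<in> C" for b unfolding i_def using inj that by (rule the_inv_into_f_f)
  define B where "B k = (if k \<in> e ` C then ball (fst (i k)) (5 * snd (i k)) else {})" for k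
  define D where "D k = (if k \<in> e ` C then ball (fst (i k)) (snd (i k)) else {})" for k
  have AB: "A \<subseteq> (\<Union>k. B k)"
  proof
    fix x assume "x \<in> A"
    then obtain b where "b \<in> C" "x \<in> ball (fst b) (5 * snd b)" using C(4) by auto
    then have "x \<in> B (e b)" by (simp add: B_def ie)
    then show "x \<in> (\<Union>k. B k)" by blast
  qed
  have mB: "B k \<in> sets lebesgue" "D k \<in> sets lebesgue" for k by (auto simp: B_def D_def)
  have disj: "disjoint_family D"
    unfolding disjoint_family_on_def
  proof (intro ballI impI)
    fix k l :: nat assume "k \<noteq> l"
    show "D k \<inter> D l = {}"
    proof (cases "k \<in> e ` C \<and> l \<in> e ` C")
      case True
      then obtain b d where bd: "b \<in> C" "k = e b" "d \<in> C" "l = e d" by auto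
      then have "b \<noteq> d" using \<open>k \<noteq> l\<close> by auto
      then show ?thesis using pairwiseD[OF C(3) bd(1,3)] bd by (simp add: D_def ie disjnt_def)
    qed (auto simp: D_def)
  qed
  define c where "c = 5 ^ n * unit_ball_vol (real n) / t"
  have c: "c > 0" using t by (simp add: c_def)
  \<comment> \<open>Writing the mass of a ball as its measure under
    \<open>density lebesgue f\<close> turns the sum over the disjoint balls into the measure of
    their union.\<close>
  have BD: "emeasure lebesgue (B k) \<le> ennreal c * emeasure (density lebesgue f) (D k)" for k
  proof (cases "k \<in> e ` C")
    case True
    then obtain b where b: "b \<in> C" "k = e b" by auto
    then have bK: "b \<in> K" using C(2) by auto
    then have r: "snd b > 0" by (simp add: K_def)
    have "emeasure lebesgue (B k) = ennreal (unit_ball_vol (real n) * (5 * snd b) ^ n)"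
      using b r emeasure_lebesgue_ball[of "5 * snd b" "fst b"] by (simp add: B_def ie n_def)
    also have "\<dots> = ennreal c * ennreal (t * snd b ^ n)"
      using r t c by (subst ennreal_mult[symmetric]) (auto simp: c_def power_mult_distrib field_simps)
    also have "\<dots> \<le> ennreal c * J b"
      using bK t by (intro mult_left_mono) (auto simp: K_def ennreal_mult' less_imp_le)
    also have "J b = emeasure (density lebesgue f) (D k)"
      using b by (subst emeasure_density) (auto simp: J_def D_def ie)
    finally show ?thesis .
  qed (auto simp: B_def)
  have "emeasure lebesgue A \<le> emeasure lebesgue (\<Union>k. B k)"
    using AB mB by (intro emeasure_mono) auto
  also have "\<dots> \<le> (\<Sum>k. emeasure lebesgue (B k))"
    using mB by (intro emeasure_subadditive_countably) auto
  also have "\<dots> \<le> (\<Sum>k. ennreal c * emeasure (density lebesgue f) (D k))"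
    by (intro suminf_le BD) auto
  also have "\<dots> = ennreal c * (\<Sum>k. emeasure (density lebesgue f) (D k))"
    by (rule ennreal_suminf_cmult)
  also have "(\<Sum>k. emeasure (density lebesgue f) (D k)) = emeasure (density lebesgue f) (\<Union>k. D k)"
    using mB disj by (intro suminf_emeasure) auto
  also have "\<dots> \<le> (\<integral>\<^sup>+y. f y \<partial>lebesgue)"
    using mB by (subst emeasure_density) (auto intro!: nn_integral_mono split: split_indicator)
  finally show ?thesis by (simp add: A_def c_def n_def mult_left_mono)
qed

lemma nn_integral_ball_const:
  fixes a :: "'a::euclidean_space"
  assumes "0 \<le> r"
  shows "(\<integral>\<^sup>+y\<in>ball a r. c \<partial>lebesgue) = c * ennreal (unit_ball_vol (real DIM('a)) * r ^ DIM('a))"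
  using emeasure_lebesgue_ball[OF assms, of a] by (subst nn_integral_cmult_indicator) auto

lemma maxf_add_const:
  fixes f :: "'a::euclidean_space \<Rightarrow> ennreal"
  assumes h [measurable]: "h \<in> borel_measurable lebesgue" and le: "\<And>y. f y \<le> h y + c"
  shows "maxf f x \<le> maxf h x + c * ennreal (unit_ball_vol (real DIM('a)))"
  unfolding maxf_def[of f]
proof (rule SUP_least)
  fix b assume b: "b \<in> {b. x \<in> ball (fst b) (snd b)}"
  then have r: "snd b > 0" by (metis ball_empty empty_iff mem_Collect_eq not_le)
  let ?B = "ball (fst b) (snd b)"
  have "(\<integral>\<^sup>+y. f y * indicator ?B y \<partial>lebesgue) \<le> (\<integral>\<^sup>+y. h y * indicator ?B y + c * indicator ?B y \<partial>lebesgue)"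
    by (rule nn_integral_mono) (use le in \<open>auto split: split_indicator\<close>)
  also have "\<dots> = (\<integral>\<^sup>+y. h y * indicator ?B y \<partial>lebesgue) + (\<integral>\<^sup>+y. c * indicator ?B y \<partial>lebesgue)"
  proof (rule nn_integral_add)
    have [measurable]: "?B \<in> sets lebesgue" by simp
    show "(\<lambda>y. h y * indicator ?B y) \<in> borel_measurable lebesgue" "(\<lambda>y. c * indicator ?B y) \<in> borel_measurable lebesgue"
      by measurable
  qed
  also have "\<dots> \<le> ennreal (snd b ^ DIM('a)) * maxf h x + c * ennreal (unit_ball_vol (real DIM('a)) * snd b ^ DIM('a))"
    using b r by (intro add_mono nn_integral_ball_le_maxf) (auto simp: nn_integral_ball_const less_imp_le)
  also have "\<dots> = (maxf h x + c * ennreal (unit_ball_vol (real DIM('a)))) * ennreal (snd b ^ DIM('a))"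
    using r by (simp add: ennreal_mult algebra_simps)
  finally show "(\<integral>\<^sup>+y. f y * indicator ?B y \<partial>lebesgue) / ennreal (snd b ^ DIM('a)) 
     \<le> maxf h x + c * ennreal (unit_ball_vol (real DIM('a)))"
    using r by (intro divide_le_posI_ennreal) (auto simp: mult.commute)
qed

text \<open>The part of \<open>f\<close> below t / (2 v) adds at most t / 2 to the maximal function,
  because balls have measure v r^n. Hence only the part above this level matters, at the price of a
  factor 2. Without the truncation the integration over \<open>t\<close> in the strong type estimate
  would diverge.\<close>

lemma maxf_weak_type_truncated:
  fixes f :: "'a::euclidean_space \<Rightarrow> ennreal"
  defines "v \<equiv> unit_ball_vol (real DIM('a))"
  assumes f [measurable]: "f \<in> borel_measurable lebesgue" and t: "0 < t"
  shows "emeasure lebesgue {x. ennreal t < maxf f x}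
    \<le> ennreal (2 * 5 ^ DIM('a) * v / t) *
        (\<integral>\<^sup>+y. f y * indicator {y. ennreal (t / (2 * v)) < f y} y \<partial>lebesgue)"
proof -
  have v: "v > 0" by (simp add: v_def)
  define h where "h y = f y * indicator {y. ennreal (t / (2 * v)) < f y} y" for y
  have h [measurable]: "h \<in> borel_measurable lebesgue" unfolding h_def by measurable
  have sub: "{x. ennreal t < maxf f x} \<subseteq> {x. ennreal (t / 2) < maxf h x}"
  proof (rule subsetI, rule ccontr)
    fix x assume "x \<in> {x. ennreal t < maxf f x}" "x \<notin> {x. ennreal (t / 2) < maxf h x}"
    then have x: "ennreal t < maxf f x" "maxf h x \<le> ennreal (t / 2)" by auto
    have "maxf f x \<le> maxf h x + ennreal (t / (2 * v)) * ennreal v" unfolding v_def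
      by (rule maxf_add_const[OF h]) (auto simp: h_def v_def split: split_indicator)
    also have "\<dots> \<le> ennreal (t / 2) + ennreal (t / 2)"
      using x(2) v t by (intro add_mono) (auto simp: ennreal_mult[symmetric])
    also have "\<dots> = ennreal t" using t by (simp add: ennreal_plus[symmetric] del: ennreal_plus)
    finally show False using x(1) by simp
  qed
  have "emeasure lebesgue {x. ennreal t < maxf f x} \<le> emeasure lebesgue {x. ennreal (t / 2) < maxf h x}"
    by (rule emeasure_mono[OF sub]) (use open_maxf[of "ennreal (t/2)" h] in auto)
  also have "\<dots> \<le> ennreal (5 ^ DIM('a) * v / (t / 2)) * (\<integral>\<^sup>+y. h y \<partial>lebesgue)"
    unfolding v_def by (rule maxf_weak_type[OF h]) (use t in auto)
  finally show ?thesis by (simp add: h_def mult_ac)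
qed

lemma nn_integral_powr_from_0:
  assumes "a > -1" "c \<ge> 0"
  shows "(\<integral>\<^sup>+t. ennreal (t powr a) * indicator {0<..<c} t \<partial>lborel) = ennreal (c powr (a + 1) / (a + 1))"
proof -
  have "(\<integral>\<^sup>+t. ennreal (t powr a) * indicator {0<..<c} t \<partial>lborel)
     = (\<integral>\<^sup>+t. ennreal (indicator {0..c} t * t powr a) \<partial>lborel)"
    by (rule nn_integral_cong_AE)
       (use AE_lborel_singleton[of 0] AE_lborel_singleton[of c] in eventually_elim, auto split: split_indicator)
  also have "\<dots> = ennreal (c powr (a + 1) / (a + 1))"
    by (rule nn_integral_has_integral_lebesgue[OF _ has_integral_powr_from_0[OF assms]]) auto
  finally show ?thesis .
qed

text \<open>Only the upper bound of the layer cake formula is used, so it is enough to integrate up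
  to an arbitrary finite c \<le> a. For infinite \<open>a\<close> the choices c = k powr (1/s) show
  that the right-hand side exceeds every natural number \<open>k\<close>.\<close>

lemma epowr_layer_cake_le:
  assumes s: "s > 0"
  shows "epowr a s \<le> ennreal s * (\<integral>\<^sup>+t. ennreal (t powr (s - 1)) * indicator {t. 0 < t \<and> ennreal t < a} t \<partial>lborel)"
proof -
  have *: "ennreal (c powr s) \<le> ennreal s * (\<integral>\<^sup>+t. ennreal (t powr (s - 1)) * indicator {t. 0 < t \<and> ennreal t < a} t \<partial>lborel)"
    if "c \<ge> 0" "ennreal c \<le> a" for c
  proof -
    have "ennreal (c powr s) = ennreal s * (\<integral>\<^sup>+t. ennreal (t powr (s - 1)) * indicator {0<..<c} t \<partial>lborel)"
      using nn_integral_powr_from_0[of "s - 1" c] s that by (simp add: ennreal_mult[symmetric])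
    also have "\<dots> \<le> ennreal s * (\<integral>\<^sup>+t. ennreal (t powr (s - 1)) * indicator {t. 0 < t \<and> ennreal t < a} t \<partial>lborel)"
      using that by (intro mult_left_mono nn_integral_mono) (auto split: split_indicator intro: less_le_trans simp: ennreal_less_iff intro!: less_le_trans[OF _ that(2)])
    finally show ?thesis .
  qed
  show ?thesis
  proof (cases "a = \<infinity>")
    case True
    have "ennreal (real k) \<le> ennreal s * (\<integral>\<^sup>+t. ennreal (t powr (s - 1)) * indicator {t. 0 < t \<and> ennreal t < a} t \<partial>lborel)" for k
      using *[of "real k powr (1 / s)"] True s by (simp add: powr_powr)
    moreover have "b = \<infinity>" if b: "\<And>k::nat. ennreal (real k) \<le> b" for b
    proof (rule ccontr)
      assume "b \<noteq> \<infinity>"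
      then obtain c where c: "b = ennreal c" "c \<ge> 0" by (cases b) auto
      obtain k :: nat where "c < real k" using reals_Archimedean2 by blast
      then show False using b[of k] c by simp
    qed
    ultimately have "ennreal s * (\<integral>\<^sup>+t. ennreal (t powr (s - 1)) * indicator {t. 0 < t \<and> ennreal t < a} t \<partial>lborel) = \<infinity>"
      by blast
    then show ?thesis by simp
  next
    case False
    then have "a = ennreal (enn2real a)" by (simp add: less_top)
    then show ?thesis using False *[of "enn2real a"] by (simp add: epowr_def)
  qed
qed

text \<open>Marcinkiewicz interpolation between the weak type bound and the trivial bound at
  infinity: layer cake, exchange of integrals, the truncated weak type bound for fixed
  \<open>t\<close>, and exchange back. The remaining integral of t^(s-2) over 0 < t < 2 v f(x)
  converges because s > 1 and produces the denominator s - 1.\<close>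

theorem maxf_strong_type:
  fixes f :: "'a::euclidean_space \<Rightarrow> real"
  assumes f [measurable]: "f \<in> borel_measurable lebesgue" and nn: "\<And>x. 0 \<le> f x" and s: "1 < s"
  shows "(\<integral>\<^sup>+x. epowr (maxf (\<lambda>x. ennreal (f x)) x) s \<partial>lebesgue)
    \<le> ennreal (s * (2 * 5 ^ DIM('a) * unit_ball_vol (real DIM('a))) *
         (2 * unit_ball_vol (real DIM('a))) powr (s - 1) / (s - 1)) * (\<integral>\<^sup>+x. ennreal (f x powr s) \<partial>lebesgue)"
proof -
  define F where "F x = ennreal (f x)" for x
  define v where "v = unit_ball_vol (real DIM('a))"
  have v: "v > 0" by (simp add: v_def)
  define C where "C = 2 * 5 ^ DIM('a) * v"
  have C: "C > 0" using v by (simp add: C_def)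
  have F [measurable]: "F \<in> borel_measurable lebesgue" unfolding F_def by measurable
  interpret L: sigma_finite_measure "lebesgue :: 'a measure" by (rule sigma_finite_lebesgue)
  interpret P: pair_sigma_finite "lebesgue :: 'a measure" "lborel :: real measure" ..
  have [measurable]: "maxf F \<in> borel_measurable lebesgue" by (rule measurable_lebesgueI) simp
  have "(\<integral>\<^sup>+x. epowr (maxf F x) s \<partial>lebesgue) \<le>
     (\<integral>\<^sup>+x. ennreal s * (\<integral>\<^sup>+t. ennreal (t powr (s - 1)) * indicator {t. 0 < t \<and> ennreal t < maxf F x} t \<partial>lborel) \<partial>lebesgue)"
    using s by (intro nn_integral_mono epowr_layer_cake_le) auto
  also have "\<dots> = ennreal s * (\<integral>\<^sup>+x. (\<integral>\<^sup>+t. ennreal (t powr (s - 1)) * indicator {t. 0 < t \<and> ennreal t < maxf F x} t \<partial>lborel) \<partial>lebesgue)"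
    by (rule nn_integral_cmult) measurable
  also have "(\<integral>\<^sup>+x. (\<integral>\<^sup>+t. ennreal (t powr (s - 1)) * indicator {t. 0 < t \<and> ennreal t < maxf F x} t \<partial>lborel) \<partial>lebesgue)
     = (\<integral>\<^sup>+t. (\<integral>\<^sup>+x. ennreal (t powr (s - 1)) * indicator {t. 0 < t \<and> ennreal t < maxf F x} t \<partial>lebesgue) \<partial>lborel)"
    by (rule P.Fubini'[symmetric]) measurable
  also have "\<dots> \<le> (\<integral>\<^sup>+t. (\<integral>\<^sup>+x. ennreal C * (ennreal (t powr (s - 2)) * (F x * indicator {t. 0 < t \<and> ennreal (t / (2 * v)) < F x} t)) \<partial>lebesgue) \<partial>lborel)"
  proof (rule nn_integral_mono)
    fix t :: real
    show "(\<integral>\<^sup>+x. ennreal (t powr (s - 1)) * indicator {t. 0 < t \<and> ennreal t < maxf F x} t \<partial>lebesgue)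
       \<le> (\<integral>\<^sup>+x. ennreal C * (ennreal (t powr (s - 2)) * (F x * indicator {t. 0 < t \<and> ennreal (t / (2 * v)) < F x} t)) \<partial>lebesgue)"
    proof (cases "t > 0")
      case True
      have "(\<integral>\<^sup>+x. ennreal (t powr (s - 1)) * indicator {t. 0 < t \<and> ennreal t < maxf F x} t \<partial>lebesgue)
         = (\<integral>\<^sup>+x. ennreal (t powr (s - 1)) * indicator {x. ennreal t < maxf F x} x \<partial>lebesgue)"
        using True by (intro nn_integral_cong) (auto split: split_indicator)
      also have "\<dots> = ennreal (t powr (s - 1)) * emeasure lebesgue {x. ennreal t < maxf F x}"
        using open_maxf[of "ennreal t" F] by (intro nn_integral_cmult_indicator) auto
      also have "\<dots> \<le> ennreal (t powr (s - 1)) * (ennreal (C / t) * (\<integral>\<^sup>+x. F x * indicator {x. ennreal (t / (2 * v)) < F x} x \<partial>lebesgue))"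
        unfolding C_def v_def by (intro mult_left_mono maxf_weak_type_truncated[OF F True]) auto
      also have "\<dots> = ennreal C * ennreal (t powr (s - 2)) * (\<integral>\<^sup>+x. F x * indicator {x. ennreal (t / (2 * v)) < F x} x \<partial>lebesgue)"
        using True C by (simp add: mult.assoc[symmetric] ennreal_mult[symmetric] powr_diff power2_eq_square mult_ac)
      also have "\<dots> = (\<integral>\<^sup>+x. ennreal C * ennreal (t powr (s - 2)) * (F x * indicator {x. ennreal (t / (2 * v)) < F x} x) \<partial>lebesgue)"
        by (rule nn_integral_cmult[symmetric]) measurable
      also have "\<dots> = (\<integral>\<^sup>+x. ennreal C * (ennreal (t powr (s - 2)) * (F x * indicator {t. 0 < t \<and> ennreal (t / (2 * v)) < F x} t)) \<partial>lebesgue)"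
        using True by (intro nn_integral_cong) (auto split: split_indicator simp: mult_ac)
      finally show ?thesis .
    qed (simp)
  qed
  also have "\<dots> = (\<integral>\<^sup>+x. (\<integral>\<^sup>+t. ennreal C * (ennreal (t powr (s - 2)) * (F x * indicator {t. 0 < t \<and> ennreal (t / (2 * v)) < F x} t)) \<partial>lborel) \<partial>lebesgue)"
    by (rule P.Fubini') measurable
  also have "\<dots> = (\<integral>\<^sup>+x. ennreal (C * (2 * v) powr (s - 1) / (s - 1)) * ennreal (f x powr s) \<partial>lebesgue)"
  proof (rule nn_integral_cong)
    fix x
    have "(\<integral>\<^sup>+t. ennreal C * (ennreal (t powr (s - 2)) * (F x * indicator {t. 0 < t \<and> ennreal (t / (2 * v)) < F x} t)) \<partial>lborel)
       = (\<integral>\<^sup>+t. (ennreal C * F x) * (ennreal (t powr (s - 2)) * indicator {0<..<2 * v * f x} t) \<partial>lborel)"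
      using v by (intro nn_integral_cong) (auto split: split_indicator simp: F_def ennreal_less_iff field_simps)
    also have "\<dots> = (ennreal C * F x) * (\<integral>\<^sup>+t. ennreal (t powr (s - 2)) * indicator {0<..<2 * v * f x} t \<partial>lborel)"
      by (rule nn_integral_cmult) measurable
    also have "(\<integral>\<^sup>+t. ennreal (t powr (s - 2)) * indicator {0<..<2 * v * f x} t \<partial>lborel) = ennreal ((2 * v * f x) powr (s - 1) / (s - 1))"
      using nn_integral_powr_from_0[of "s - 2" "2 * v * f x"] s v nn[of x] by simp
    also have "(ennreal C * F x) * \<dots> = ennreal (C * f x * ((2 * v * f x) powr (s - 1) / (s - 1)))"
      using C s nn[of x] unfolding F_def by (simp add: ennreal_mult[symmetric])
    also have "C * f x * ((2 * v * f x) powr (s - 1) / (s - 1)) = C * (2 * v) powr (s - 1) / (s - 1) * f x powr s"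
    proof -
      have "f x * f x powr (s - 1) = f x powr s"
        using powr_mult_base[OF nn[of x], of "s - 1"] by simp
      then show ?thesis using v nn[of x] by (simp add: powr_mult mult_ac)
    qed
    also have "ennreal \<dots> = ennreal (C * (2 * v) powr (s - 1) / (s - 1)) * ennreal (f x powr s)"
      using C s by (intro ennreal_mult) auto
    finally show "(\<integral>\<^sup>+t. ennreal C * (ennreal (t powr (s - 2)) * (F x * indicator {t. 0 < t \<and> ennreal (t / (2 * v)) < F x} t)) \<partial>lborel)
       = ennreal (C * (2 * v) powr (s - 1) / (s - 1)) * ennreal (f x powr s)" .
  qed
  also have "\<dots> = ennreal (C * (2 * v) powr (s - 1) / (s - 1)) * (\<integral>\<^sup>+x. ennreal (f x powr s) \<partial>lebesgue)"
    by (rule nn_integral_cmult) measurable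
  finally have "(\<integral>\<^sup>+x. epowr (maxf F x) s \<partial>lebesgue) \<le> 
     ennreal s * (ennreal (C * (2 * v) powr (s - 1) / (s - 1)) * (\<integral>\<^sup>+x. ennreal (f x powr s) \<partial>lebesgue))"
    by (simp add: mult_left_mono)
  also have "\<dots> = ennreal (s * C * (2 * v) powr (s - 1) / (s - 1)) * (\<integral>\<^sup>+x. ennreal (f x powr s) \<partial>lebesgue)"
    using s C by (simp add: mult.assoc[symmetric] ennreal_mult[symmetric])
  finally show ?thesis unfolding F_def C_def v_def .
qed

section \<open>Lebesgue points\<close>

lemma continuous_imp_lebesgue_measurable:
  fixes g :: "'a::euclidean_space \<Rightarrow> real"
  shows "continuous_on UNIV g \<Longrightarrow> g \<in> borel_measurable lebesgue"
  by (rule measurable_lebesgueI) (rule borel_measurable_continuous_onI)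

text \<open>Both \<open>f\<close> and the almost everywhere approximating continuous functions are
  cut off at height \<open>k\<close>. The truncated approximants are dominated by a constant, which
  is integrable over the finite measure set \<open>S\<close>, so dominated convergence upgrades
  pointwise to L^1 convergence.\<close>

lemma integrable_approximate_continuous:
  fixes f :: "'a::euclidean_space \<Rightarrow> real"
  assumes f: "integrable lebesgue f" and S: "S \<in> lmeasurable" and e: "0 < e"
  obtains g where "continuous_on UNIV g" "(\<integral>\<^sup>+x\<in>S. ennreal \<bar>f x - g x\<bar> \<partial>lebesgue) \<le> ennreal e"
proof -
  have fm [measurable]: "f \<in> borel_measurable lebesgue" using f by auto
  have Sm [measurable]: "S \<in> sets lebesgue" using S by auto
  define F where "F k x = max (- real k) (min (real k) (f x))" for k :: nat and x
  have Fm [measurable]: "F k \<in> borel_measurable lebesgue" for k unfolding F_def by measurable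
  have "(\<lambda>k. \<integral>x. \<bar>f x - F k x\<bar> \<partial>lebesgue) \<longlonglongrightarrow> (\<integral>x. (0::real) \<partial>(lebesgue :: 'a measure))"
  proof (rule integral_dominated_convergence[where w = "\<lambda>x. \<bar>f x\<bar>"])
    show "AE x in lebesgue. (\<lambda>k. \<bar>f x - F k x\<bar>) \<longlonglongrightarrow> 0"
    proof (rule AE_I2)
      fix x
      obtain k0 :: nat where "\<bar>f x\<bar> \<le> real k0" using real_arch_simple by blast
      then have "eventually (\<lambda>k. \<bar>f x - F k x\<bar> = 0) sequentially"
        by (intro eventually_sequentiallyI[of k0]) (auto simp: F_def)
      then show "(\<lambda>k. \<bar>f x - F k x\<bar>) \<longlonglongrightarrow> 0" by (rule tendsto_eventually)
    qed
    show "AE x in lebesgue. norm \<bar>f x - F k x\<bar> \<le> \<bar>f x\<bar>" for k by (auto simp: F_def)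
    show "integrable lebesgue (\<lambda>x. \<bar>f x\<bar>)" using f by (rule integrable_abs)
  qed measurable
  then have "eventually (\<lambda>k. (\<integral>x. \<bar>f x - F k x\<bar> \<partial>lebesgue) < e / 2) sequentially"
    using e by (intro order_tendstoD(2)) auto
  then obtain k where k: "(\<integral>x. \<bar>f x - F k x\<bar> \<partial>lebesgue) < e / 2"
    by (meson eventually_sequentially le_refl)
  have int1: "integrable lebesgue (\<lambda>x. \<bar>f x - F k x\<bar>)"
    by (rule Bochner_Integration.integrable_bound[OF f]) (auto simp: F_def)
  have "f measurable_on UNIV" using lebesgue_measurable_imp_measurable_on[OF fm, of UNIV] by simp
  then obtain N g where N: "negligible N" and g: "\<And>n. continuous_on UNIV (g n)"
    and lim: "\<And>x. x \<notin> N \<Longrightarrow> (\<lambda>n. g n x) \<longlonglongrightarrow> f x"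
    unfolding measurable_on_def by auto
  define h where "h n x = max (- real k) (min (real k) (g n x))" for n x
  have hc: "continuous_on UNIV (h n)" for n
    unfolding h_def by (intro continuous_intros g)
  have hm [measurable]: "h n \<in> borel_measurable lebesgue" for n
    by (rule continuous_imp_lebesgue_measurable[OF hc])
  have "(\<lambda>n. \<integral>x. \<bar>F k x - h n x\<bar> * indicator S x \<partial>lebesgue) \<longlonglongrightarrow> (\<integral>x. (0::real) \<partial>(lebesgue :: 'a measure))"
  proof (rule integral_dominated_convergence[where w = "\<lambda>x. 2 * real k * indicator S x"])
    have "AE x in lebesgue. x \<notin> N"
      using N by (simp add: AE_iff_null_sets[symmetric] negligible_iff_null_sets AE_not_in)
    then show "AE x in lebesgue. (\<lambda>n. \<bar>F k x - h n x\<bar> * indicator S x) \<longlonglongrightarrow> 0"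
    proof eventually_elim
      case (elim x)
      have "(\<lambda>n. \<bar>F k x - h n x\<bar> * indicator S x) \<longlonglongrightarrow> \<bar>F k x - F k x\<bar> * indicator S x"
        unfolding F_def h_def by (intro tendsto_intros lim elim)
      then show ?case by simp
    qed
    show "AE x in lebesgue. norm (\<bar>F k x - h n x\<bar> * indicator S x) \<le> 2 * real k * indicator S x" for n
      by (rule AE_I2) (auto simp: F_def h_def split: split_indicator)
    show "integrable lebesgue (\<lambda>x. 2 * real k * indicator S x)"
      using S by (intro integrable_mult_right integrable_real_indicator) (auto simp: fmeasurable_def)
  qed measurable
  then have "eventually (\<lambda>n. (\<integral>x. \<bar>F k x - h n x\<bar> * indicator S x \<partial>lebesgue) < e / 2) sequentially"
    using e by (intro order_tendstoD(2)) auto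
  then obtain n where n: "(\<integral>x. \<bar>F k x - h n x\<bar> * indicator S x \<partial>lebesgue) < e / 2"
    by (meson eventually_sequentially le_refl)
  have int2: "integrable lebesgue (\<lambda>x. \<bar>F k x - h n x\<bar> * indicator S x)"
  proof (rule Bochner_Integration.integrable_bound)
    show "integrable lebesgue (\<lambda>x. 2 * real k * indicator S x)"
      using S by (intro integrable_mult_right integrable_real_indicator) (auto simp: fmeasurable_def)
    show "AE x in lebesgue. norm (\<bar>F k x - h n x\<bar> * indicator S x) \<le> norm (2 * real k * indicator S x)"
      by (rule AE_I2) (auto simp: F_def h_def split: split_indicator)
  qed measurable
  have "(\<integral>\<^sup>+x\<in>S. ennreal \<bar>f x - h n x\<bar> \<partial>lebesgue)
     \<le> (\<integral>\<^sup>+x. ennreal \<bar>f x - F k x\<bar> + ennreal (\<bar>F k x - h n x\<bar> * indicator S x) \<partial>lebesgue)"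
    by (rule nn_integral_mono) (auto split: split_indicator simp: ennreal_plus[symmetric] simp del: ennreal_plus)
  also have "\<dots> = (\<integral>\<^sup>+x. ennreal \<bar>f x - F k x\<bar> \<partial>lebesgue) + (\<integral>\<^sup>+x. ennreal (\<bar>F k x - h n x\<bar> * indicator S x) \<partial>lebesgue)"
    by (rule nn_integral_add) measurable
  also have "\<dots> = ennreal (\<integral>x. \<bar>f x - F k x\<bar> \<partial>lebesgue) + ennreal (\<integral>x. \<bar>F k x - h n x\<bar> * indicator S x \<partial>lebesgue)"
    using int1 int2 by (subst (1 2) nn_integral_eq_integral) auto
  also have "\<dots> \<le> ennreal (e / 2) + ennreal (e / 2)"
    using k n by (intro add_mono ennreal_leI) auto
  also have "\<dots> = ennreal e" using e by (simp add: ennreal_plus[symmetric] del: ennreal_plus)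
  finally show thesis using that hc by blast
qed

text \<open>Stated with the nonnegative integral, so that it makes sense without measurability of
  \<open>f\<close>, and with the power of the radius in place of the volume, as in
  \<open>maxf\<close>.\<close>

definition lebesgue_point :: "('a::euclidean_space \<Rightarrow> real) \<Rightarrow> 'a \<Rightarrow> bool" where
  "lebesgue_point f x \<longleftrightarrow> (\<forall>e>0. \<exists>d>0. \<forall>r. 0 < r \<longrightarrow> r < d \<longrightarrow>
     (\<integral>\<^sup>+y\<in>ball x r. ennreal \<bar>f y - f x\<bar> \<partial>lebesgue) \<le> ennreal (e * r ^ DIM('a)))"

text \<open>Approximate \<open>f\<close> in L^1 by a continuous \<open>g\<close>. The oscillation of
  \<open>f\<close> at \<open>x\<close> is bounded by the maximal function of |f - g|, by |f(x) -
  g(x)| and by the oscillation of \<open>g\<close>. The last is small on small balls, and the first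
  two are large only on sets of small measure, by the weak type bound and Markov's
  inequality.\<close>

lemma negligible_not_lebesgue_point:
  fixes f :: "'a::euclidean_space \<Rightarrow> real"
  assumes f: "integrable lebesgue f"
  shows "negligible {x. \<not> lebesgue_point f x}"
proof -
  define D where "D = DIM('a)"
  define v where "v = unit_ball_vol (real D)"
  have v: "v > 0" by (simp add: v_def)
  have fm [measurable]: "f \<in> borel_measurable lebesgue" using f by auto
  define bad where "bad e k = {x \<in> ball (0::'a) (real k). \<forall>d>0. \<exists>r. 0 < r \<and> r < d \<and>
     \<not> (\<integral>\<^sup>+y\<in>ball x r. ennreal \<bar>f y - f x\<bar> \<partial>lebesgue) \<le> ennreal (e * r ^ D)}" for e :: real and k :: nat
  have main: "negligible (bad e k)" if e: "e > 0" for e k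
    unfolding negligible_outer_le
  proof (intro allI impI)
    fix \<eta> :: real assume \<eta>: "\<eta> > 0"
    define S where "S = ball (0::'a) (real k)"
    have S: "S \<in> lmeasurable" and Sm [measurable]: "S \<in> sets lebesgue" by (auto simp: S_def)
    \<comment> \<open>Sum of the weak type and Markov constants at level e / 3; \<open>g\<close> is
      then taken within \<eta> / C so that the exceptional sets have total measure at most
      \<eta>.\<close>
    define C where "C = 5 ^ D * v / (e / 3) + v / (e / 3)"
    have C: "C > 0" using v e by (simp add: C_def add_pos_pos)
    obtain g where g: "continuous_on UNIV g" "(\<integral>\<^sup>+x\<in>S. ennreal \<bar>f x - g x\<bar> \<partial>lebesgue) \<le> ennreal (\<eta> / C)"
      using integrable_approximate_continuous[OF f S] \<eta> C by (metis divide_pos_pos)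
    have gm [measurable]: "g \<in> borel_measurable lebesgue" by (rule continuous_imp_lebesgue_measurable[OF g(1)])
    define h where "h x = ennreal \<bar>f x - g x\<bar> * indicator S x" for x
    have h [measurable]: "h \<in> borel_measurable lebesgue" unfolding h_def by measurable
    define T1 where "T1 = {x. ennreal (e / 3) < maxf h x}"
    \<comment> \<open>On \<open>S\<close> this says |f - g| \<ge> e / (3 v), written in the form in
      which Markov's inequality is stated.\<close>
    define T2 where "T2 = {x. ennreal 1 \<le> ennreal (v / (e / 3)) * h x}"
    have T1: "T1 \<in> sets lebesgue" unfolding T1_def using open_maxf[of "ennreal (e/3)" h] by simp
    have "{x \<in> space lebesgue. ennreal 1 \<le> ennreal (v / (e / 3)) * h x} \<in> sets lebesgue" by measurable
    then have T2: "T2 \<in> sets lebesgue" by (simp add: T2_def)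
    have hint: "(\<integral>\<^sup>+x. h x \<partial>lebesgue) \<le> ennreal (\<eta> / C)" using g(2) by (simp add: h_def)
    have "emeasure lebesgue (T1 \<union> T2) \<le> emeasure lebesgue T1 + emeasure lebesgue T2"
      using T1 T2 by (rule emeasure_subadditive)
    also have "\<dots> \<le> ennreal (5 ^ D * v / (e / 3)) * (\<integral>\<^sup>+x. h x \<partial>lebesgue) + ennreal (v / (e / 3)) * (\<integral>\<^sup>+x. h x \<partial>lebesgue)"
    proof (rule add_mono)
      show "emeasure lebesgue T1 \<le> ennreal (5 ^ D * v / (e / 3)) * (\<integral>\<^sup>+x. h x \<partial>lebesgue)"
        unfolding T1_def D_def v_def by (rule maxf_weak_type[OF h]) (use e in auto)
      have "emeasure lebesgue ({x\<in>UNIV. 1 \<le> ennreal (v / (e / 3)) * h x} \<inter> UNIV) \<le> ennreal (v / (e / 3)) * (\<integral>\<^sup>+x. h x * indicator UNIV x \<partial>lebesgue)"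
        using nn_integral_Markov_inequality[of h UNIV lebesgue "ennreal (v / (e / 3))"] by simp
      then show "emeasure lebesgue T2 \<le> ennreal (v / (e / 3)) * (\<integral>\<^sup>+x. h x \<partial>lebesgue)"
        by (simp add: T2_def)
    qed
    also have "\<dots> = ennreal C * (\<integral>\<^sup>+x. h x \<partial>lebesgue)"
      using v e unfolding C_def by (subst ennreal_plus) (auto simp: distrib_right)
    also have "\<dots> \<le> ennreal C * ennreal (\<eta> / C)" by (rule mult_left_mono[OF hint]) simp
    also have "\<dots> = ennreal \<eta>" using C \<eta> by (simp add: ennreal_mult[symmetric])
    finally have em: "emeasure lebesgue (T1 \<union> T2) \<le> ennreal \<eta>" .
    have "bad e k \<subseteq> T1 \<union> T2"
    proof (rule subsetI, rule ccontr)
      fix x assume x: "x \<in> bad e k" and nx: "x \<notin> T1 \<union> T2"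
      have xS: "x \<in> S" using x by (simp add: bad_def S_def)
      have "\<bar>f x - g x\<bar> * v < e / 3"
      proof -
        have "ennreal (v / (e / 3)) * h x < 1" using nx by (auto simp: T2_def)
        then have "ennreal (v / (e / 3) * \<bar>f x - g x\<bar>) < ennreal 1"
          using xS v e by (subst ennreal_mult) (auto simp: h_def)
        then have "v / (e / 3) * \<bar>f x - g x\<bar> < 1" by (simp add: ennreal_less_iff)
        then show ?thesis using e by (simp add: field_simps)
      qed
      have m: "maxf h x \<le> ennreal (e / 3)" using nx by (auto simp: T1_def)
      have "isCont g x" using g(1) by (simp add: continuous_on_eq_continuous_at)
      then obtain d1 where d1: "d1 > 0" "\<And>y. dist y x < d1 \<Longrightarrow> dist (g y) (g x) < e / (3 * v)"
        using e v by (metis continuous_at_eps_delta divide_pos_pos mult_pos_pos zero_less_numeral)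
      obtain d2 where d2: "d2 > 0" "ball x d2 \<subseteq> S"
        using openE[OF open_ball] xS unfolding S_def by blast
      have "(\<integral>\<^sup>+y\<in>ball x r. ennreal \<bar>f y - f x\<bar> \<partial>lebesgue) \<le> ennreal (e * r ^ D)"
        if r: "0 < r" "r < min d1 d2" for r
      proof -
        have "(\<integral>\<^sup>+y\<in>ball x r. ennreal \<bar>f y - f x\<bar> \<partial>lebesgue)
          \<le> (\<integral>\<^sup>+y. h y * indicator (ball x r) y + ennreal (e / (3 * v) + \<bar>f x - g x\<bar>) * indicator (ball x r) y \<partial>lebesgue)"
        proof (rule nn_integral_mono)
          fix y
          show "ennreal \<bar>f y - f x\<bar> * indicator (ball x r) y \<le> h y * indicator (ball x r) y + ennreal (e / (3 * v) + \<bar>f x - g x\<bar>) * indicator (ball x r) y"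
          proof (cases "y \<in> ball x r")
            case True
            then have "y \<in> S" using d2 r by auto
            have "\<bar>g y - g x\<bar> < e / (3 * v)" using d1(2)[of y] True r by (simp add: dist_real_def dist_commute)
            then have "\<bar>f y - f x\<bar> \<le> \<bar>f y - g y\<bar> + (e / (3 * v) + \<bar>f x - g x\<bar>)" by linarith
            then have "ennreal \<bar>f y - f x\<bar> \<le> ennreal (\<bar>f y - g y\<bar> + (e / (3 * v) + \<bar>f x - g x\<bar>))" by (rule ennreal_leI)
            also have "\<dots> = ennreal \<bar>f y - g y\<bar> + ennreal (e / (3 * v) + \<bar>f x - g x\<bar>)"
              using e v by (intro ennreal_plus) auto
            finally show ?thesis using True \<open>y \<in> S\<close> by (simp add: h_def)
          qed simp
        qed
        also have "\<dots> = (\<integral>\<^sup>+y\<in>ball x r. h y \<partial>lebesgue) + (\<integral>\<^sup>+y\<in>ball x r. ennreal (e / (3 * v) + \<bar>f x - g x\<bar>) \<partial>lebesgue)"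
        proof (rule nn_integral_add)
          have [measurable]: "ball x r \<in> sets lebesgue" by simp
          show "(\<lambda>y. h y * indicator (ball x r) y) \<in> borel_measurable lebesgue" 
            "(\<lambda>y. ennreal (e / (3 * v) + \<bar>f x - g x\<bar>) * indicator (ball x r) y) \<in> borel_measurable lebesgue" by measurable
        qed
        also have "\<dots> \<le> ennreal (r ^ D) * ennreal (e / 3) + ennreal (e / (3 * v) + \<bar>f x - g x\<bar>) * ennreal (v * r ^ D)"
        proof (rule add_mono)
          show "(\<integral>\<^sup>+y\<in>ball x r. h y \<partial>lebesgue) \<le> ennreal (r ^ D) * ennreal (e / 3)"
            using nn_integral_ball_le_maxf[of x x r h] r m unfolding D_def
            by (meson centre_in_ball mult_left_mono order_trans zero_le)
          show "(\<integral>\<^sup>+y\<in>ball x r. ennreal (e / (3 * v) + \<bar>f x - g x\<bar>) \<partial>lebesgue) \<le> ennreal (e / (3 * v) + \<bar>f x - g x\<bar>) * ennreal (v * r ^ D)"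
            using r by (subst nn_integral_ball_const) (auto simp: v_def D_def)
        qed
        also have "\<dots> = ennreal (r ^ D * (e / 3) + (e / (3 * v) + \<bar>f x - g x\<bar>) * (v * r ^ D))"
          using r e v by (simp add: ennreal_mult[symmetric] ennreal_plus[symmetric] del: ennreal_plus)
        also have "\<dots> \<le> ennreal (e * r ^ D)"
        proof (rule ennreal_leI)
          have "(e / (3 * v) + \<bar>f x - g x\<bar>) * v = e / 3 + \<bar>f x - g x\<bar> * v"
            using v by (simp add: field_simps)
          then have "e / 3 + (e / (3 * v) + \<bar>f x - g x\<bar>) * v \<le> e"
            using \<open>\<bar>f x - g x\<bar> * v < e / 3\<close> by linarith
          then have "(e / 3 + (e / (3 * v) + \<bar>f x - g x\<bar>) * v) * r ^ D \<le> e * r ^ D"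
            using r by (intro mult_right_mono) auto
          then show "r ^ D * (e / 3) + (e / (3 * v) + \<bar>f x - g x\<bar>) * (v * r ^ D) \<le> e * r ^ D"
            by (simp only: algebra_simps)
        qed
        finally show ?thesis .
      qed
      moreover have "min d1 d2 > 0" using d1 d2 by simp
      ultimately show False using x unfolding bad_def by blast
    qed
    moreover have "T1 \<union> T2 \<in> lmeasurable"
      using em T1 T2 by (intro fmeasurableI) (auto simp: less_top[symmetric] top_unique dest: le_less_trans)
    moreover have "measure lebesgue (T1 \<union> T2) \<le> \<eta>"
      using em \<eta> by (simp add: measure_def enn2real_leI)
    ultimately show "\<exists>T. bad e k \<subseteq> T \<and> T \<in> lmeasurable \<and> measure lebesgue T \<le> \<eta>" by blast
  qed
  have "{x. \<not> lebesgue_point f x} \<subseteq> (\<Union>j. \<Union>k. bad (1 / real (Suc j)) k)"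
  proof
    fix x assume "x \<in> {x. \<not> lebesgue_point f x}"
    then obtain e where e: "e > 0" and ne: "\<And>d. d > 0 \<Longrightarrow> \<exists>r. 0 < r \<and> r < d \<and>
     \<not> (\<integral>\<^sup>+y\<in>ball x r. ennreal \<bar>f y - f x\<bar> \<partial>lebesgue) \<le> ennreal (e * r ^ D)"
      unfolding lebesgue_point_def D_def by auto
    obtain j where j: "1 / real (Suc j) < e" using e nat_approx_posE by blast
    obtain k :: nat where k: "norm x < real k" using reals_Archimedean2 by blast
    have "x \<in> bad (1 / real (Suc j)) k"
      unfolding bad_def
    proof (intro CollectI conjI allI impI)
      show "x \<in> ball 0 (real k)" using k by simp
      fix d :: real assume "d > 0"
      then obtain r where r: "0 < r" "r < d" "\<not> (\<integral>\<^sup>+y\<in>ball x r. ennreal \<bar>f y - f x\<bar> \<partial>lebesgue) \<le> ennreal (e * r ^ D)"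
        using ne by blast
      have "ennreal (1 / real (Suc j) * r ^ D) \<le> ennreal (e * r ^ D)"
        using j r by (intro ennreal_leI mult_right_mono) auto
      then show "\<exists>r>0. r < d \<and> \<not> (\<integral>\<^sup>+y\<in>ball x r. ennreal \<bar>f y - f x\<bar> \<partial>lebesgue) \<le> ennreal (1 / real (Suc j) * r ^ D)"
        using r by (meson order_trans)
    qed
    then show "x \<in> (\<Union>j. \<Union>k. bad (1 / real (Suc j)) k)" by blast
  qed
  moreover have "negligible (\<Union>j. \<Union>k. bad (1 / real (Suc j)) k)"
    by (intro negligible_Union_nat main) simp
  ultimately show ?thesis by (rule negligible_subset[rotated])
qed

lemma lebesgue_point_cong:
  fixes f g :: "'a::euclidean_space \<Rightarrow> real"
  assumes "0 < e" "\<And>y. y \<in> ball x e \<Longrightarrow> f y = g y"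
  shows "lebesgue_point f x \<Longrightarrow> lebesgue_point g x"
  unfolding lebesgue_point_def
proof (intro allI impI)
  fix \<epsilon> :: real assume *: "\<forall>e>0. \<exists>d>0. \<forall>r. 0 < r \<longrightarrow> r < d \<longrightarrow>
     (\<integral>\<^sup>+y\<in>ball x r. ennreal \<bar>f y - f x\<bar> \<partial>lebesgue) \<le> ennreal (e * r ^ DIM('a))" and "\<epsilon> > 0"
  then obtain d where d: "d > 0" "\<And>r. 0 < r \<Longrightarrow> r < d \<Longrightarrow>
     (\<integral>\<^sup>+y\<in>ball x r. ennreal \<bar>f y - f x\<bar> \<partial>lebesgue) \<le> ennreal (\<epsilon> * r ^ DIM('a))" by blast
  show "\<exists>d>0. \<forall>r. 0 < r \<longrightarrow> r < d \<longrightarrow>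
     (\<integral>\<^sup>+y\<in>ball x r. ennreal \<bar>g y - g x\<bar> \<partial>lebesgue) \<le> ennreal (\<epsilon> * r ^ DIM('a))"
  proof (intro exI[of _ "min d e"] conjI allI impI)
    fix r assume r: "0 < r" "r < min d e"
    have "(\<integral>\<^sup>+y\<in>ball x r. ennreal \<bar>g y - g x\<bar> \<partial>lebesgue) = (\<integral>\<^sup>+y\<in>ball x r. ennreal \<bar>f y - f x\<bar> \<partial>lebesgue)"
      using r assms by (intro nn_integral_cong) (auto split: split_indicator)
    then show "(\<integral>\<^sup>+y\<in>ball x r. ennreal \<bar>g y - g x\<bar> \<partial>lebesgue) \<le> ennreal (\<epsilon> * r ^ DIM('a))"
      using d(2)[of r] r by simp
  qed (use d assms in auto)
qed

text \<open>Being a Lebesgue point is a local property and negligibility may be checked locally.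
  Near each point \<open>u\<close> is replaced by its cut-off to a compact ball inside \<Omega>,
  which is integrable on the whole space.\<close>

lemma negligible_not_lebesgue_point_on:
  fixes u :: "'a::euclidean_space \<Rightarrow> real"
  assumes O: "open \<Omega>" and u: "\<And>K. compact K \<Longrightarrow> K \<subseteq> \<Omega> \<Longrightarrow> u absolutely_integrable_on K"
  shows "negligible {x \<in> \<Omega>. \<not> lebesgue_point u x}"
proof (rule locally_negligible_alt[THEN iffD2], rule ballI)
  fix x assume x: "x \<in> {x \<in> \<Omega>. \<not> lebesgue_point u x}"
  then obtain e where e: "e > 0" "cball x e \<subseteq> \<Omega>" using O open_contains_cball by blast
  define f where "f y = indicator (cball x e) y * u y" for y
  have "integrable lebesgue f"
    using u[OF _ e(2)] unfolding f_def set_integrable_def by simp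
  then have N: "negligible {x. \<not> lebesgue_point f x}" by (rule negligible_not_lebesgue_point)
  let ?U = "{x \<in> \<Omega>. \<not> lebesgue_point u x} \<inter> ball x e"
  have "?U \<subseteq> {x. \<not> lebesgue_point f x}"
  proof
    fix z assume z: "z \<in> ?U"
    obtain d where d: "d > 0" "ball z d \<subseteq> ball x e" using openE[OF open_ball, of z x e] z by blast
    have "f y = u y" if "y \<in> ball z d" for y
      using subsetD[OF d(2) that] by (simp add: f_def)
    then have "lebesgue_point f z \<Longrightarrow> lebesgue_point u z"
      using lebesgue_point_cong[OF d(1)] by blast
    then show "z \<in> {x. \<not> lebesgue_point f x}" using z by blast
  qed
  then have "negligible ?U" using N negligible_subset by blast
  then show "\<exists>U. openin (top_of_set {x \<in> \<Omega>. \<not> lebesgue_point u x}) U \<and> x \<in> U \<and> negligible U"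
    using x e by (intro exI[of _ ?U]) (auto intro: openin_open_Int)
qed

section \<open>A Sobolev--Poincare inequality\<close>

lemma AE_notin_negligible: "negligible E \<Longrightarrow> AE x in lebesgue. x \<notin> E"
  by (simp add: negligible_iff_null_sets AE_not_in)

text \<open>A ball has no thin corners: moving \<open>x\<close> towards the centre \<open>a\<close>
  by the fraction R / (2 r) makes room for a ball of half the radius. Thus the intersection has
  measure comparable to R^n even for \<open>x\<close> near the boundary sphere.\<close>

lemma ball_subset_Int_balls:
  fixes x a :: "'a::euclidean_space"
  assumes x: "x \<in> ball a r" and R: "0 < R" "R \<le> r"
  obtains z where "ball z (R / 2) \<subseteq> ball a r \<inter> ball x R"
proof -
  define z where "z = x + (R / (2 * r)) *\<^sub>R (a - x)"
  have r: "r > 0" using R by simp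
  have n: "norm (a - x) < r" using x by (simp add: dist_norm)
  have "norm (z - x) = R / (2 * r) * norm (a - x)" using R r by (simp add: z_def)
  also have "\<dots> \<le> R / (2 * r) * r" using n R r by (intro mult_left_mono) auto
  also have "\<dots> = R / 2" using r by simp
  finally have 1: "dist z x \<le> R / 2" by (simp add: dist_norm)
  have "z - a = (1 - R / (2 * r)) *\<^sub>R (x - a)" by (simp add: z_def algebra_simps)
  then have "norm (z - a) = (1 - R / (2 * r)) * norm (a - x)"
    using R r by (simp add: norm_minus_commute)
  also have "\<dots> \<le> (1 - R / (2 * r)) * r" using n R r by (intro mult_left_mono) auto
  also have "\<dots> = r - R / 2" using r by (simp add: field_simps)
  finally have 2: "dist z a \<le> r - R / 2" by (simp add: dist_norm)
  have "ball z (R / 2) \<subseteq> ball a r \<inter> ball x R"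
  proof
    fix y assume "y \<in> ball z (R / 2)"
    then have "dist z y < R / 2" by simp
    then show "y \<in> ball a r \<inter> ball x R"
      using 1 2 dist_triangle[of a y z] dist_triangle[of x y z] by (simp add: dist_commute)
  qed
  then show thesis by (rule that)
qed

lemma emeasure_superlevel_powr_le:
  fixes g :: "'a::euclidean_space \<Rightarrow> real"
  assumes g [measurable]: "g \<in> borel_measurable lebesgue" and nn: "\<And>x. 0 \<le> g x"
    and S: "S \<in> sets lebesgue" and q: "q > 0" and t: "t > 0"
    and I: "(\<integral>\<^sup>+y\<in>S. ennreal (g y powr q) \<partial>lebesgue) \<le> ennreal I" "I \<ge> 0"
  shows "emeasure lebesgue {x\<in>S. t < g x} \<le> ennreal (I * t powr - q)"
proof -
  have [measurable]: "S \<in> sets lebesgue" by fact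
  have "{x\<in>space lebesgue. x \<in> S \<and> t < g x} \<in> sets lebesgue" by measurable
  then have m: "{x\<in>S. t < g x} \<in> sets lebesgue" by simp
  have "ennreal (t powr q) * emeasure lebesgue {x\<in>S. t < g x} = (\<integral>\<^sup>+y. ennreal (t powr q) * indicator {x\<in>S. t < g x} y \<partial>lebesgue)"
    by (rule nn_integral_cmult_indicator[symmetric]) (rule m)
  also have "\<dots> \<le> (\<integral>\<^sup>+y\<in>S. ennreal (g y powr q) \<partial>lebesgue)"
    using t q by (intro nn_integral_mono) (auto split: split_indicator intro!: ennreal_leI powr_mono2)
  also have "\<dots> \<le> ennreal I" by (rule I)
  finally have *: "ennreal (t powr q) * emeasure lebesgue {x\<in>S. t < g x} \<le> ennreal I" .
  have "emeasure lebesgue {x\<in>S. t < g x} = ennreal (t powr - q) * (ennreal (t powr q) * emeasure lebesgue {x\<in>S. t < g x})"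
    using t by (simp add: mult.assoc[symmetric] ennreal_mult[symmetric] powr_minus)
  also have "\<dots> \<le> ennreal (t powr - q) * ennreal I" by (rule mult_left_mono[OF *]) simp
  also have "\<dots> = ennreal (I * t powr - q)" using I(2) by (simp add: ennreal_mult mult.commute)
  finally show ?thesis .
qed

text \<open>The value of \<open>u\<close> at \<open>x\<close> is reached from a fixed point where \<open>g\<close> is small by finitely many steps,
  each of which halves \<open>g\<close>; Chebyshev's inequality bounds the lengths of the steps.\<close>

lemma pointwise_gradient_chain:
  fixes u g :: "'a::euclidean_space \<Rightarrow> real"
  defines "n \<equiv> real DIM('a)"
  defines "q \<equiv> n / (n + 1)" and "v \<equiv> unit_ball_vol n"
  defines "\<tau> \<equiv> \<lambda>r I. (2 * I / (v * (r / 2) powr n)) powr (1 / q)"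
  defines "A \<equiv> \<lambda>I. 6 * (2 * I / v) powr (1 / n) / (2 powr q - 1)"
  assumes g [measurable]: "g \<in> borel_measurable lebesgue" and nn: "\<And>x. 0 \<le> g x"
    and r: "r > 0" and E: "negligible E"
    and ug: "\<And>x y. x \<in> ball a r - E \<Longrightarrow> y \<in> ball a r - E \<Longrightarrow> \<bar>u x - u y\<bar> \<le> dist x y * (g x + g y)"
    and I: "(\<integral>\<^sup>+y\<in>ball a r. ennreal (g y powr q) \<partial>lebesgue) \<le> ennreal I" "I > 0"
  obtains c where "\<And>x. x \<in> ball a r - E \<Longrightarrow>
    \<bar>u x - c\<bar> \<le> 4 * r * \<tau> r I + A I * \<tau> r I powr q + A I * 2 powr q * g x powr q"
proof -
  have n: "n \<ge> 1" unfolding n_def using DIM_positive[where 'a='a] by linarith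
  have q: "0 < q" "q < 1" using n by (auto simp: q_def)
  have v: "v > 0" using n by (simp add: v_def)
  define t where "t = \<tau> r I"
  have t: "t > 0" using v r I(2) by (simp add: t_def \<tau>_def)
  \<comment> \<open>Chosen so that a ball of radius \<open>R s / 2\<close> has twice the measure
    that Chebyshev's inequality allows for the set where \<open>g\<close> exceeds \<open>s\<close>.
    Hence every point has within distance \<open>R s\<close> a point where \<open>g\<close> is at
    most \<open>s\<close>.\<close>
  define R where "R s = 2 * (2 * I * s powr - q / v) powr (1 / n)" for s
  have R0: "R s > 0" if "s > 0" for s using that I v by (simp add: R_def)
  have Rv: "v * (R s / 2) ^ DIM('a) = 2 * I * s powr - q" if "s > 0" for s
  proof -
    have "(R s / 2) ^ DIM('a) = (R s / 2) powr n"
      using R0[OF that] by (simp add: powr_realpow n_def)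
    also have "\<dots> = 2 * I * s powr - q / v"
      using n I v that by (simp add: R_def powr_powr)
    finally show ?thesis using v by simp
  qed
  \<comment> \<open>The level \<tau> is the one at which the search radius reaches the radius of the
    ball; for larger levels the search stays within scale \<open>r\<close>.\<close>
  have Rt: "R t = r"
  proof -
    have "t powr - q = v * (r / 2) powr n / (2 * I)"
    proof -
      have "t powr q = 2 * I / (v * (r / 2) powr n)"
        using q I v r by (simp add: t_def \<tau>_def powr_powr)
      then show ?thesis using I v r t by (simp add: powr_minus divide_simps mult_ac)
    qed
    then have "2 * I * t powr - q / v = (r / 2) powr n" using I v by simp
    then show ?thesis using n r by (simp add: R_def powr_powr)
  qed
  have Rmono: "R s \<le> r" if "s \<ge> t" for s
  proof -
    have "s powr - q \<le> t powr - q" using that t q by (intro powr_mono2') auto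
    then have "2 * I * s powr - q / v \<le> 2 * I * t powr - q / v"
      using I v by (intro divide_right_mono mult_left_mono) auto
    then have "R s \<le> R t" unfolding R_def using I v n
      by (intro mult_left_mono powr_mono2) auto
    then show ?thesis using Rt by simp
  qed
  have pt: "\<exists>y \<in> ball a r - E. dist x y \<le> R s \<and> g y \<le> s" if x: "x \<in> ball a r" and s: "s \<ge> t" for x s
  proof (rule ccontr)
    assume no: "\<not> ?thesis"
    have s0: "s > 0" using s t by simp
    obtain z where z: "ball z (R s / 2) \<subseteq> ball a r \<inter> ball x (R s)"
      using ball_subset_Int_balls[OF x R0[OF s0] Rmono[OF s]] by blast
    have "ball z (R s / 2) \<subseteq> {x \<in> ball a r. s < g x} \<union> E" using z no by force
    moreover have m: "{x \<in> ball a r. s < g x} \<in> sets lebesgue"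
    proof -
      have "{x \<in> space lebesgue. s < g x} \<in> sets lebesgue" by measurable
      then have "ball a r \<inter> {x. s < g x} \<in> sets lebesgue" by (intro sets.Int) auto
      moreover have "{x \<in> ball a r. s < g x} = ball a r \<inter> {x. s < g x}" by auto
      ultimately show ?thesis by simp
    qed
    moreover have E': "E \<in> null_sets lebesgue" using E by (simp add: negligible_iff_null_sets)
    ultimately have "emeasure lebesgue (ball z (R s / 2)) \<le> emeasure lebesgue ({x \<in> ball a r. s < g x} \<union> E)"
      by (intro emeasure_mono) auto
    also have "\<dots> = emeasure lebesgue {x \<in> ball a r. s < g x}"
      using m E' by (rule emeasure_Un_null_set)
    also have "\<dots> \<le> ennreal (I * s powr - q)"
      using q s0 I by (intro emeasure_superlevel_powr_le g nn) auto
    also have "\<dots> < ennreal (2 * I * s powr - q)"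
      using I s0 by (intro ennreal_lessI) auto
    also have "\<dots> = emeasure lebesgue (ball z (R s / 2))"
      using Rv[OF s0] R0[OF s0] emeasure_lebesgue_ball[of "R s / 2" z] by (simp add: v_def n_def)
    finally show False by simp
  qed
  \<comment> \<open>This identity fixes the exponent: s R(s) is proportional to s^(1 - q/n), and 1 -
    q/n = q for q = n/(n+1). The 3 comes from gradients 2 s and s at the ends of a step. The factor
    2^q - 1 in \<open>A\<close> makes the steps telescope, as A (2^q - 1) s^q = A (2 s)^q - A
    s^q.\<close>
  have step: "3 * s * R s = A I * (2 powr q - 1) * s powr q" if "s > 0" for s
  proof -
    have "q / n = 1 / (n + 1)" using n by (simp add: q_def)
    then have "1 - q / n = q" using n by (simp add: q_def field_simps)
    have "2 powr q - 1 > (0::real)" using q by simp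
    have "R s = 2 * ((2 * I / v) powr (1 / n) * s powr (- q / n))"
    proof -
      have "(2 * I * s powr - q / v) powr (1 / n) = (2 * I / v * s powr - q) powr (1 / n)" by simp
      also have "\<dots> = (2 * I / v) powr (1 / n) * (s powr - q) powr (1 / n)"
        by (rule powr_mult)
      finally show ?thesis by (simp add: R_def powr_powr)
    qed
    moreover have "s * s powr (- q / n) = s powr q"
      using that \<open>1 - q / n = q\<close> by (simp add: powr_mult_base)
    ultimately have "3 * s * R s = 6 * (2 * I / v) powr (1 / n) * s powr q"
      by (simp add: algebra_simps)
    moreover have "A I * (2 powr q - 1) = 6 * (2 * I / v) powr (1 / n)"
      using \<open>2 powr q - 1 > 0\<close> unfolding A_def
      by (metis less_irrefl nonzero_eq_divide_eq)
    ultimately show ?thesis by simp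
  qed
  have A: "A I > 0" using I v q by (simp add: A_def)
  obtain b where b: "b \<in> ball a r - E" "g b \<le> t"
    using pt[of a t] r by auto
  have chain: "\<bar>u x - u b\<bar> \<le> 4 * r * t + A I * (2 ^ k * t) powr q"
    if "x \<in> ball a r - E" "g x \<le> 2 ^ k * t" for x k
    using that
  proof (induction k arbitrary: x)
    case 0
    have "dist x b \<le> 2 * r"
      using 0(1) b(1) dist_triangle[of x b a] by (simp add: dist_commute)
    then have "dist x b * (g x + g b) \<le> 2 * r * (t + t)"
      using 0(2) b(2) nn[of x] nn[of b] r by (intro mult_mono add_mono) auto
    then have "\<bar>u x - u b\<bar> \<le> 2 * r * (t + t)"
      using ug[OF 0(1) b(1)] by linarith
    moreover have "A I * t powr q \<ge> 0" using A by simp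
    ultimately show ?case by (simp add: algebra_simps)
  next
    case (Suc k)
    have s: "2 ^ k * t \<ge> t" using t by simp
    obtain y where y: "y \<in> ball a r - E" "dist x y \<le> R (2 ^ k * t)" "g y \<le> 2 ^ k * t"
      using pt[of x "2 ^ k * t"] Suc.prems s by auto
    have "\<bar>u x - u y\<bar> \<le> dist x y * (g x + g y)" by (rule ug) (use Suc.prems y in auto)
    also have "\<dots> \<le> R (2 ^ k * t) * (2 ^ Suc k * t + 2 ^ k * t)"
      using y Suc.prems nn[of x] nn[of y] R0[of "2 ^ k * t"] t by (intro mult_mono add_mono) auto
    also have "\<dots> = 3 * (2 ^ k * t) * R (2 ^ k * t)" by simp
    also have "\<dots> = A I * (2 powr q - 1) * (2 ^ k * t) powr q"
      by (rule step) (use t in simp)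
    finally have "\<bar>u x - u b\<bar> \<le> A I * (2 powr q - 1) * (2 ^ k * t) powr q + (4 * r * t + A I * (2 ^ k * t) powr q)"
      using Suc.IH[OF y(1,3)] by linarith
    also have "\<dots> = 4 * r * t + A I * (2 powr q * (2 ^ k * t) powr q)"
      by (simp add: algebra_simps)
    also have "2 powr q * (2 ^ k * t) powr q = (2 ^ Suc k * t) powr q"
      using t by (simp add: powr_mult[symmetric] mult.assoc)
    finally show ?case .
  qed
  have "\<bar>u x - u b\<bar> \<le> 4 * r * t + A I * t powr q + A I * 2 powr q * g x powr q" if x: "x \<in> ball a r - E" for x
  proof (cases "g x \<le> t")
    case True
    then have "\<bar>u x - u b\<bar> \<le> 4 * r * t + A I * t powr q" using chain[OF x, of 0] by simp
    moreover have "0 \<le> A I * 2 powr q * g x powr q" using A by simp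
    ultimately show ?thesis by linarith
  next
    case False
    obtain m :: nat where "g x / t < 2 ^ m" using real_arch_pow[of 2] by auto
    then have ex: "g x \<le> 2 ^ m * t" using t by (simp add: field_simps)
    \<comment> \<open>Minimality gives 2^k t \<le> 2 g(x), which turns the bound in terms of the
      number of steps into one in terms of g(x).\<close>
    define k where "k = (LEAST k. g x \<le> 2 ^ k * t)"
    have k: "g x \<le> 2 ^ k * t" unfolding k_def using ex by (rule LeastI)
    obtain l where l: "k = Suc l" using k False by (cases k) auto
    have "\<not> g x \<le> 2 ^ l * t" using not_less_Least[of l "\<lambda>k. g x \<le> 2 ^ k * t"] l by (simp add: k_def)
    then have "2 ^ k * t \<le> 2 * g x" using l by simp
    then have "(2 ^ k * t) powr q \<le> (2 * g x) powr q" using t q by (intro powr_mono2) auto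
    also have "\<dots> = 2 powr q * g x powr q" using nn by (simp add: powr_mult)
    finally have "A I * (2 ^ k * t) powr q \<le> A I * (2 powr q * g x powr q)" using A by (intro mult_left_mono) auto
    moreover have "A I * t powr q \<ge> 0" using A by simp
    ultimately show ?thesis using chain[OF x k] by simp
  qed
  then show thesis unfolding t_def by (rule that)
qed

text \<open>Integrate the pointwise chain bound over the ball. The lower bound on the level in the
  chain makes \<open>I\<close> an arbitrary positive majorant of the integral instead of its value,
  which may be 0.\<close>

theorem sobolev_poincare:
  fixes n :: real
  assumes n_def: "n = real DIM('a::euclidean_space)"
  shows "\<exists>C>0. \<forall>(u :: 'a \<Rightarrow> real) g a r E I. g \<in> borel_measurable lebesgue \<longrightarrow> (\<forall>x. 0 \<le> g x) \<longrightarrow> r > 0 \<longrightarrow> negligible E \<longrightarrow>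
    (\<forall>x\<in>ball a r - E. \<forall>y\<in>ball a r - E. \<bar>u x - u y\<bar> \<le> dist x y * (g x + g y)) \<longrightarrow>
    (\<integral>\<^sup>+y\<in>ball a r. ennreal (g y powr (n / (n + 1))) \<partial>lebesgue) \<le> ennreal I \<longrightarrow> I > 0 \<longrightarrow>
    (\<exists>c. (\<integral>\<^sup>+y\<in>ball a r. ennreal \<bar>u y - c\<bar> \<partial>lebesgue) \<le> ennreal (C * I powr ((n + 1) / n)))"
proof -
  define q where "q = n / (n + 1)"
  define v where "v = unit_ball_vol n"
  have n: "n \<ge> 1" unfolding n_def using DIM_positive[where 'a='a] by linarith
  have q: "0 < q" "q < 1" using n by (auto simp: q_def)
  have v: "v > 0" using n by (simp add: v_def)
  define L where "L = 6 * (2 / v) powr (1 / n) / (2 powr q - 1)"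
  have L: "L > 0" using v q by (simp add: L_def)
  define C where "C = 4 * v * (2 * 2 powr n / v) powr (1 / q) + L * (2 * 2 powr n + 2 powr q)"
  have C: "C > 0" using v L by (simp add: C_def add_pos_pos)
  show ?thesis
  proof (rule exI[of _ C], intro conjI allI impI C)
    fix u g :: "'a \<Rightarrow> real" and a r E I
    assume g [measurable]: "g \<in> borel_measurable lebesgue" and nn: "\<forall>x. 0 \<le> g x" and r: "r > 0" and E: "negligible E"
      and ug: "\<forall>x\<in>ball a r - E. \<forall>y\<in>ball a r - E. \<bar>u x - u y\<bar> \<le> dist x y * (g x + g y)"
      and I: "(\<integral>\<^sup>+y\<in>ball a r. ennreal (g y powr (n / (n + 1))) \<partial>lebesgue) \<le> ennreal I" "I > 0"
    define t where "t = (2 * I / (v * (r / 2) powr n)) powr (1 / q)"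
    define A where "A = 6 * (2 * I / v) powr (1 / n) / (2 powr q - 1)"
    have A: "A > 0" using I v q by (simp add: A_def)
    have t: "t > 0" using v r I(2) by (simp add: t_def)
    obtain c where c: "\<And>x. x \<in> ball a r - E \<Longrightarrow> \<bar>u x - c\<bar> \<le> 4 * r * t + A * t powr q + A * 2 powr q * g x powr q"
      using pointwise_gradient_chain[OF g _ r E, where u = u and a = a and I = I] nn ug I
      unfolding n_def[symmetric] q_def[symmetric] v_def[symmetric] t_def[symmetric] A_def[symmetric] by blast
    define K where "K = 4 * r * t + A * t powr q"
    have K: "K \<ge> 0" using r t A by (simp add: K_def)
    have Bm [measurable]: "ball a r \<in> sets lebesgue" by simp
    have Aeq: "A = L * I powr (1 / n)"
    proof -
      have "(2 * I / v) powr (1 / n) = (2 / v) powr (1 / n) * I powr (1 / n)"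
        using I v by (subst powr_mult[symmetric]) auto
      then show ?thesis by (simp add: A_def L_def)
    qed
    \<comment> \<open>By this and the next identity the radius cancels from every term; what remains
      is a multiple of I^(1/q), with 1/q = 1 + 1/n.\<close>
    have tq: "t powr q * r powr n = 2 * 2 powr n * I / v"
    proof -
      have "t powr q = 2 * I / (v * (r / 2) powr n)" using q I v r by (simp add: t_def powr_powr)
      also have "(r / 2) powr n = r powr n / 2 powr n" using r by (simp add: powr_divide)
      finally show ?thesis using r v by simp
    qed
    have tr: "r * t * r powr n = (2 * 2 powr n / v) powr (1 / q) * I powr (1 / q)"
    proof -
      have "r * t * r powr n = t * r powr (n + 1)" using r by (simp add: powr_add)
      also have "r powr (n + 1) = (r powr n) powr (1 / q)" using n by (simp add: powr_powr q_def)
      also have "t * \<dots> = (t powr q) powr (1 / q) * (r powr n) powr (1 / q)" using t q by (simp add: powr_powr)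
      also have "\<dots> = (t powr q * r powr n) powr (1 / q)" using t r by (simp add: powr_mult)
      also have "\<dots> = (2 * 2 powr n / v * I) powr (1 / q)" by (simp add: tq)
      also have "\<dots> = (2 * 2 powr n / v) powr (1 / q) * I powr (1 / q)" by (rule powr_mult)
      finally show ?thesis .
    qed
    have inv_q: "1 / q = 1 + 1 / n" using n by (simp add: q_def field_simps)
    have I1: "I powr (1 / n) * I = I powr (1 / q)"
      using I by (simp add: inv_q powr_add mult.commute)
    have Iq: "I powr (1 / q) = I powr ((n + 1) / n)" using n by (simp add: q_def)
    have "(\<integral>\<^sup>+y\<in>ball a r. ennreal \<bar>u y - c\<bar> \<partial>lebesgue)
      \<le> (\<integral>\<^sup>+y. ennreal K * indicator (ball a r) y + ennreal (A * 2 powr q) * (ennreal (g y powr q) * indicator (ball a r) y) \<partial>lebesgue)"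
    proof (rule nn_integral_mono_AE)
      show "AE y in lebesgue. ennreal \<bar>u y - c\<bar> * indicator (ball a r) y
         \<le> ennreal K * indicator (ball a r) y + ennreal (A * 2 powr q) * (ennreal (g y powr q) * indicator (ball a r) y)"
        using AE_notin_negligible[OF E]
      proof eventually_elim
        case (elim y)
        show ?case
        proof (cases "y \<in> ball a r")
          case True
          then have "\<bar>u y - c\<bar> \<le> K + A * 2 powr q * g y powr q" using c[of y] elim by (simp add: K_def)
          then have "ennreal \<bar>u y - c\<bar> \<le> ennreal (K + A * 2 powr q * g y powr q)"
            by (rule ennreal_leI)
          also have "\<dots> = ennreal K + ennreal (A * 2 powr q * g y powr q)"
            using K A by (intro ennreal_plus) auto
          finally have "ennreal \<bar>u y - c\<bar> \<le> ennreal K + ennreal (A * 2 powr q * g y powr q)" .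
          then show ?thesis using True A by (simp add: ennreal_mult)
        qed simp
      qed
    qed
    also have "\<dots> = (\<integral>\<^sup>+y\<in>ball a r. ennreal K \<partial>lebesgue) + (\<integral>\<^sup>+y. ennreal (A * 2 powr q) * (ennreal (g y powr q) * indicator (ball a r) y) \<partial>lebesgue)"
      by (rule nn_integral_add) measurable
    also have "\<dots> = ennreal K * ennreal (v * r ^ DIM('a)) + ennreal (A * 2 powr q) * (\<integral>\<^sup>+y\<in>ball a r. ennreal (g y powr q) \<partial>lebesgue)"
      
    proof -
      have 1: "(\<integral>\<^sup>+y\<in>ball a r. ennreal K \<partial>lebesgue) = ennreal K * ennreal (v * r ^ DIM('a))"
        unfolding v_def n_def by (rule nn_integral_ball_const) (use r in simp)
      have 2: "(\<integral>\<^sup>+y. ennreal (A * 2 powr q) * (ennreal (g y powr q) * indicator (ball a r) y) \<partial>lebesgue)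
        = ennreal (A * 2 powr q) * (\<integral>\<^sup>+y\<in>ball a r. ennreal (g y powr q) \<partial>lebesgue)"
        by (rule nn_integral_cmult) measurable
      show ?thesis by (simp only: 1 2)
    qed
    also have "\<dots> \<le> ennreal K * ennreal (v * r ^ DIM('a)) + ennreal (A * 2 powr q) * ennreal I"
      using I by (intro add_mono mult_left_mono order_refl) (auto simp: q_def)
    also have "\<dots> = ennreal (K * (v * r ^ DIM('a)) + A * 2 powr q * I)"
      using K v r A I by (simp add: ennreal_mult ennreal_plus)
    also have "K * (v * r ^ DIM('a)) + A * 2 powr q * I = C * I powr ((n + 1) / n)"
    proof -
      have "r ^ DIM('a) = r powr n" using r by (simp add: n_def powr_realpow)
      then have "K * (v * r ^ DIM('a)) + A * 2 powr q * I
        = 4 * v * (r * t * r powr n) + A * v * (t powr q * r powr n) + A * 2 powr q * I"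
        by (simp add: K_def algebra_simps)
      also have "\<dots> = 4 * v * ((2 * 2 powr n / v) powr (1 / q) * I powr (1 / q)) + A * (2 * 2 powr n) * I + A * 2 powr q * I"
        unfolding tr tq using v by simp
      also have "\<dots> = 4 * v * ((2 * 2 powr n / v) powr (1 / q) * I powr (1 / q)) + L * (2 * 2 powr n + 2 powr q) * (I powr (1 / n) * I)"
        unfolding Aeq by (simp add: algebra_simps)
      also have "\<dots> = C * I powr (1 / q)" unfolding I1 C_def by (simp add: algebra_simps)
      finally show ?thesis using Iq by simp
    qed
    finally show "\<exists>c. (\<integral>\<^sup>+y\<in>ball a r. ennreal \<bar>u y - c\<bar> \<partial>lebesgue) \<le> ennreal (C * I powr ((n + 1) / n))"
      by blast
  qed
qed

section \<open>Smooth bump functions\<close>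

text \<open>Differentiability of finite order as a recursion on the order, so that sums, products
  and affine substitutions are handled by induction. The last derivative need not be continuous,
  which is harmless as the predicate is used for all orders at once.\<close>

primrec Ck :: "nat \<Rightarrow> (real \<Rightarrow> real) \<Rightarrow> bool" where
  "Ck 0 f = True"
| "Ck (Suc k) f = (\<exists>f'. (\<forall>t. (f has_real_derivative f' t) (at t)) \<and> Ck k f')"

lemma Ck_SucD: "Ck (Suc k) f \<Longrightarrow> Ck k f"
proof (induction k arbitrary: f)
  case (Suc k)
  then obtain f' where "\<forall>t. (f has_real_derivative f' t) (at t)" "Ck (Suc k) f'" by auto
  then show ?case using Suc.IH by auto
qed simp

lemma Ck_add: "Ck k f \<Longrightarrow> Ck k g \<Longrightarrow> Ck k (\<lambda>t. f t + g t)"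
proof (induction k arbitrary: f g)
  case (Suc k)
  obtain f' g' where "\<forall>t. (f has_real_derivative f' t) (at t)" "Ck k f'" 
    "\<forall>t. (g has_real_derivative g' t) (at t)" "Ck k g'" using Suc.prems by auto
  then show ?case using Suc.IH by (auto intro!: exI[of _ "\<lambda>t. f' t + g' t"] derivative_eq_intros)
qed simp

lemma Ck_mult: "Ck k f \<Longrightarrow> Ck k g \<Longrightarrow> Ck k (\<lambda>t. f t * g t)"
proof (induction k arbitrary: f g)
  case (Suc k)
  obtain f' g' where *: "\<forall>t. (f has_real_derivative f' t) (at t)" "Ck k f'" 
    "\<forall>t. (g has_real_derivative g' t) (at t)" "Ck k g'" using Suc.prems by auto
  have "((\<lambda>t. f t * g t) has_real_derivative f' t * g t + f t * g' t) (at t)" for t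
    using * by (auto intro!: derivative_eq_intros)
  moreover have "Ck k (\<lambda>t. f' t * g t + f t * g' t)"
    using * Suc.prems by (intro Ck_add Suc.IH Ck_SucD[of k f] Ck_SucD[of k g])
  ultimately show ?case by (auto intro!: exI[of _ "\<lambda>t. f' t * g t + f t * g' t"])
qed simp

lemma Ck_const: "Ck k (\<lambda>t. c)"
proof (induction k arbitrary: c)
  case (Suc k)
  show ?case using Suc[of 0] by (auto intro!: exI[of _ "\<lambda>t. 0"] derivative_eq_intros)
qed simp

lemma Ck_ident: "Ck k (\<lambda>t. t)"
proof (cases k)
  case (Suc j)
  show ?thesis using Ck_const[of j 1] Suc by (auto intro!: exI[of _ "\<lambda>t. 1"] derivative_eq_intros)
qed simp

lemma Ck_affine: "Ck k f \<Longrightarrow> Ck k (\<lambda>t. f (a + b * t))"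
proof (induction k arbitrary: f)
  case (Suc k)
  obtain f' where f': "\<forall>t. (f has_real_derivative f' t) (at t)" "Ck k f'" using Suc.prems by auto
  have "((\<lambda>t. f (a + b * t)) has_real_derivative f' (a + b * t) * b) (at t)" for t
    by (rule DERIV_chain2[OF f'(1)[rule_format]]) (auto intro!: derivative_eq_intros)
  moreover have "Ck k (\<lambda>t. f' (a + b * t) * b)"
    using Suc.IH[OF f'(2)] Ck_const by (rule Ck_mult)
  ultimately show ?case by (auto intro!: exI[of _ "\<lambda>t. f' (a + b * t) * b"])
qed simp

text \<open>A function packaged with all its derivatives: \<open>H k\<close> is the k-th derivative
  of \<open>H 0\<close>. For products over the coordinates, partial differentiation then becomes a
  shift of an index.\<close>

definition deriv_family :: "(nat \<Rightarrow> real \<Rightarrow> real) \<Rightarrow> bool" where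
  "deriv_family H \<longleftrightarrow> (\<forall>k t. (H k has_real_derivative H (Suc k) t) (at t))"

text \<open>Each order supplies its own witness for the derivative. Uniqueness identifies all of
  them with \<open>deriv g\<close>, so \<open>deriv g\<close> is again differentiable to every order
  and \<open>deriv\<close> can be iterated.\<close>

lemma Ck_imp_deriv_family:
  assumes "\<And>k. Ck k f"
  obtains H where "deriv_family H" "H 0 = f"
proof -
  have *: "(\<forall>t. (g has_real_derivative deriv g t) (at t)) \<and> (\<forall>k. Ck k (deriv g))" if g: "\<forall>k. Ck k g" for g
  proof -
    have "Ck (Suc k) g" for k using g by blast
    then have k: "\<exists>g'. (\<forall>t. (g has_real_derivative g' t) (at t)) \<and> Ck k g'" for k by simp
    have eq: "g' = deriv g" if "\<forall>t. (g has_real_derivative g' t) (at t)" for g'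
      by (rule ext) (metis DERIV_imp_deriv that)
    show ?thesis using k eq by metis
  qed
  have all: "\<forall>k. Ck k ((deriv ^^ j) f)" for j
    by (induction j) (use assms * in auto)
  have "deriv_family (\<lambda>j. (deriv ^^ j) f)"
    unfolding deriv_family_def using *[OF all] by simp
  then show thesis by (rule that) simp
qed

text \<open>The functions p(1/t) exp(-1/t) for t > 0 are closed under differentiation: in terms of x
  = 1/t, the polynomial p becomes x^2 (p - p'). Keeping \<open>p\<close> as a parameter makes
  infinite differentiability an induction.\<close>

definition exp_flat :: "real poly \<Rightarrow> real \<Rightarrow> real" where
  "exp_flat p t = (if t > 0 then poly p (1 / t) * exp (- (1 / t)) else 0)"

lemma tendsto_poly_exp_minus: "((\<lambda>x. poly p x * exp (- x)) \<longlongrightarrow> (0::real)) at_top"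
proof -
  have "((\<lambda>x. \<Sum>i\<le>degree p. coeff p i * (x ^ i / exp x)) \<longlongrightarrow> (\<Sum>i\<le>degree p. coeff p i * 0)) at_top"
    by (intro tendsto_intros tendsto_power_div_exp_0)
  then show ?thesis by (simp add: poly_altdef sum_distrib_right sum_divide_distrib exp_minus field_simps)
qed

lemma exp_flat_has_derivative:
  "(exp_flat p has_real_derivative exp_flat (monom 1 2 * (p - pderiv p)) t) (at t)"
proof -
  consider "t > 0" | "t < 0" | "t = 0" by linarith
  then show ?thesis
  proof cases
    case 1
    have "((\<lambda>t. poly p (1 / t) * exp (- (1 / t))) has_real_derivative exp_flat (monom 1 2 * (p - pderiv p)) t) (at t)"
      using 1 by (auto intro!: derivative_eq_intros simp: exp_flat_def poly_monom power2_eq_square field_simps)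
    moreover have "eventually (\<lambda>y. exp_flat p y = poly p (1 / y) * exp (- (1 / y))) (nhds t)"
      using eventually_nhds_in_open[of "{0<..}" t] 1 by (auto elim!: eventually_mono simp: exp_flat_def)
    ultimately show ?thesis by (simp cong: DERIV_cong_ev)
  next
    case 2
    have ev: "eventually (\<lambda>y. exp_flat p y = 0) (nhds t)"
      using eventually_nhds_in_open[of "{..<0}" t] 2 by (auto elim!: eventually_mono simp: exp_flat_def)
    have "((\<lambda>t. 0) has_real_derivative exp_flat (monom 1 2 * (p - pderiv p)) t) (at t)"
      using 2 by (auto simp: exp_flat_def)
    then show ?thesis by (subst DERIV_cong_ev[OF refl ev refl])
  next
    case 3
    have "((\<lambda>h. (exp_flat p (0 + h) - exp_flat p 0) / h) \<longlongrightarrow> 0) (at 0)"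
    proof (rule filterlim_split_at)
      have "eventually (\<lambda>h::real. (exp_flat p (0 + h) - exp_flat p 0) / h = 0) (at_left 0)"
        by (auto simp: eventually_at_filter exp_flat_def)
      then show "((\<lambda>h. (exp_flat p (0 + h) - exp_flat p 0) / h) \<longlongrightarrow> 0) (at_left 0)"
        by (rule tendsto_eventually)
      \<comment> \<open>With x = 1/h the difference quotient at 0 is x p(x) exp(-x): dividing by h
        contributes the extra factor x, and the exponential still wins.\<close>
      have "((\<lambda>h::real. poly (monom 1 1 * p) (inverse h) * exp (- inverse h)) \<longlongrightarrow> 0) (at_right 0)"
        by (rule filterlim_compose[OF tendsto_poly_exp_minus filterlim_inverse_at_top_right])
      moreover have "eventually (\<lambda>h::real. (exp_flat p (0 + h) - exp_flat p 0) / h = poly (monom 1 1 * p) (inverse h) * exp (- inverse h)) (at_right 0)"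
        by (auto simp: eventually_at_filter exp_flat_def poly_monom field_simps)
      ultimately show "((\<lambda>h. (exp_flat p (0 + h) - exp_flat p 0) / h) \<longlongrightarrow> 0) (at_right 0)"
        by (simp add: tendsto_cong)
    qed
    then show ?thesis using 3 by (simp add: DERIV_def exp_flat_def)
  qed
qed

lemma Ck_exp_flat: "Ck k (exp_flat p)"
proof (induction k arbitrary: p)
  case (Suc k)
  then show ?case using exp_flat_has_derivative by auto
qed simp

lemma exists_bump:
  fixes a :: real
  assumes a: "a > 0"
  obtains h where "\<And>k. Ck k h" "\<And>t. 0 \<le> h t" "h 0 > 0" "\<And>t. a \<le> \<bar>t\<bar> \<Longrightarrow> h t = 0"
proof -
  define h where "h t = exp_flat 1 (a + 1 * t) * exp_flat 1 (a + (- 1) * t)" for t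
  have "Ck k h" for k
    unfolding h_def by (rule Ck_mult; rule Ck_affine; rule Ck_exp_flat)
  moreover have "0 \<le> h t" "h 0 > 0" "a \<le> \<bar>t\<bar> \<Longrightarrow> h t = 0" for t
    using a by (auto simp: h_def exp_flat_def)
  ultimately show thesis by (rule that)
qed

section \<open>Supports, bounds and rescaling of derivative families\<close>

lemma deriv_family_continuous: "deriv_family H \<Longrightarrow> continuous_on UNIV (H k)"
  unfolding deriv_family_def by (meson DERIV_isCont continuous_at_imp_continuous_on)

lemma deriv_family_vanish:
  assumes H: "deriv_family H" and z: "\<And>t. a < \<bar>t\<bar> \<Longrightarrow> H 0 t = 0"
  shows "a < \<bar>t\<bar> \<Longrightarrow> H k t = 0"
proof (induction k arbitrary: t)
  case (Suc k)
  have o: "open {t::real. a < \<bar>t\<bar>}" by (intro open_Collect_less continuous_intros)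
  have "(H k has_real_derivative 0) (at t)"
  proof (rule DERIV_cong_ev[THEN iffD1])
    show "eventually (\<lambda>y. (0::real) = H k y) (nhds t)"
      using eventually_nhds_in_open[OF o, of t] Suc by (auto elim!: eventually_mono)
    show "((\<lambda>t. 0::real) has_real_derivative 0) (at t)" by simp
  qed simp_all
  then show ?case using H DERIV_unique unfolding deriv_family_def by blast
qed (use z in auto)

lemma deriv_family_bounded:
  assumes H: "deriv_family H" and z: "\<And>t. a < \<bar>t\<bar> \<Longrightarrow> H 0 t = 0"
  obtains B where "0 < B" "\<And>k t. k \<le> N \<Longrightarrow> \<bar>H k t\<bar> \<le> B"
proof -
  have "\<exists>B. \<forall>t. \<bar>H k t\<bar> \<le> B" for k
  proof -
    have "compact (H k ` {-a..a})"
      by (rule compact_continuous_image) (auto intro: continuous_on_subset[OF deriv_family_continuous[OF H]])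
    then obtain B where B: "\<forall>t\<in>{-a..a}. \<bar>H k t\<bar> \<le> B"
      using bounded_real[of "H k ` {-a..a}"] compact_imp_bounded by auto
    show ?thesis
    proof (intro exI[of _ "max B 0"] allI)
      fix t show "\<bar>H k t\<bar> \<le> max B 0"
      proof (cases "a < \<bar>t\<bar>")
        case True
        then show ?thesis using deriv_family_vanish[of H a t k, OF H z] by simp
      next
        case False
        then have "t \<in> {-a..a}" by auto
        then show ?thesis using B by fastforce
      qed
    qed
  qed
  then obtain B where B: "\<And>k t. \<bar>H k t\<bar> \<le> B k" by metis
  have "\<bar>H k t\<bar> \<le> 1 + (\<Sum>k\<le>N. \<bar>B k\<bar>)" if "k \<le> N" for k t
  proof -
    have "\<bar>H k t\<bar> \<le> \<bar>B k\<bar>" using B[of k t] by linarith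
    also have "\<dots> \<le> (\<Sum>k\<le>N. \<bar>B k\<bar>)" using that by (intro member_le_sum) auto
    finally show ?thesis by simp
  qed
  moreover have "0 < 1 + (\<Sum>k\<le>N. \<bar>B k\<bar>)" by (simp add: add_pos_nonneg sum_nonneg)
  ultimately show thesis using that by blast
qed

lemma deriv_family_scale:
  assumes "deriv_family H"
  shows "deriv_family (\<lambda>k t. c * b ^ k * H k (b * (t - x)))"
  unfolding deriv_family_def
proof (intro allI)
  fix k t
  have "(H k has_real_derivative H (Suc k) (b * (t - x))) (at (b * (t - x)))"
    using assms by (simp add: deriv_family_def)
  moreover have "((\<lambda>t. b * (t - x)) has_real_derivative b) (at t)" by (auto intro!: derivative_eq_intros)
  ultimately have "((\<lambda>t. H k (b * (t - x))) has_real_derivative H (Suc k) (b * (t - x)) * b) (at t)"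
    by (rule DERIV_chain2)
  from DERIV_cmult[OF this, of "c * b ^ k"]
  show "((\<lambda>t. c * b ^ k * H k (b * (t - x))) has_real_derivative c * b ^ Suc k * H (Suc k) (b * (t - x))) (at t)"
    by (simp add: mult_ac)
qed

lemma deriv_family_add_cmult:
  "deriv_family G \<Longrightarrow> deriv_family H \<Longrightarrow> deriv_family (\<lambda>k t. G k t + c * H k t)"
  unfolding deriv_family_def by (auto intro!: derivative_eq_intros)

text \<open>A tensor product of one-variable functions in which \<open>m i\<close> is the order of
  differentiation in coordinate \<open>i\<close>. The partial derivative in direction
  \<open>j\<close> raises \<open>m j\<close> by one, so an iterated derivative along a list only
  depends on how often each coordinate occurs.\<close>

definition pfun :: "('n \<Rightarrow> nat \<Rightarrow> real \<Rightarrow> real) \<Rightarrow> ('n \<Rightarrow> nat) \<Rightarrow> real^'n \<Rightarrow> real" where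
  "pfun H m z = (\<Prod>i\<in>UNIV. H i (m i) (z $ i))"

lemma pfun_upd:
  "pfun H (m(j := k)) z = H j k (z $ j) * (\<Prod>i\<in>UNIV - {j}. H i (m i) (z $ i))"
proof -
  have "pfun H (m(j := k)) z = H j k (z $ j) * (\<Prod>i\<in>UNIV - {j}. H i ((m(j := k)) i) (z $ i))"
    unfolding pfun_def by (subst prod.remove[of UNIV j]) auto
  also have "(\<Prod>i\<in>UNIV - {j}. H i ((m(j := k)) i) (z $ i)) = (\<Prod>i\<in>UNIV - {j}. H i (m i) (z $ i))"
    by (rule prod.cong) auto
  finally show ?thesis .
qed

lemma has_derivative_pfun:
  fixes H :: "'n::finite \<Rightarrow> nat \<Rightarrow> real \<Rightarrow> real"
  assumes H: "\<And>i. deriv_family (H i)"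
  shows "(pfun H m has_derivative (\<lambda>y. \<Sum>j\<in>UNIV. y $ j * pfun H (m(j := Suc (m j))) z)) (at z)"
proof -
  have 1: "((\<lambda>z. H i (m i) (z $ i)) has_derivative (\<lambda>y. H i (Suc (m i)) (z $ i) * (y $ i))) (at z)" for i
  proof -
    have "(H i (m i) has_derivative (\<lambda>h. H i (Suc (m i)) (z $ i) * h)) (at (z $ i))"
      using H[of i] unfolding deriv_family_def has_field_derivative_def by blast
    moreover have "((\<lambda>z. z $ i) has_derivative (\<lambda>y. y $ i)) (at z)"
      by (rule bounded_linear_imp_has_derivative) (rule bounded_linear_vec_nth)
    ultimately show ?thesis using has_derivative_compose[of "\<lambda>z. z $ i" "\<lambda>y. y $ i" z UNIV "H i (m i)"] by blast
  qed
  have "((\<lambda>z. \<Prod>i\<in>UNIV. H i (m i) (z $ i)) has_derivative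
     (\<lambda>y. \<Sum>i\<in>UNIV. H i (Suc (m i)) (z $ i) * (y $ i) * (\<Prod>j\<in>UNIV - {i}. H j (m j) (z $ j)))) (at z)"
    by (rule has_derivative_prod) (rule 1)
  moreover have "(\<lambda>z. \<Prod>i\<in>UNIV. H i (m i) (z $ i)) = pfun H m" by (simp add: pfun_def fun_eq_iff)
  moreover have "(\<lambda>y. \<Sum>i\<in>UNIV. H i (Suc (m i)) (z $ i) * (y $ i) * (\<Prod>j\<in>UNIV - {i}. H j (m j) (z $ j)))
     = (\<lambda>y. \<Sum>j\<in>UNIV. y $ j * pfun H (m(j := Suc (m j))) z)"
    by (simp add: pfun_upd mult_ac)
  ultimately show ?thesis by simp
qed

lemma pderiv_at_eqI:
  assumes "(\<phi> has_derivative D) (at x)"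
  shows "pderiv_at j \<phi> x = D (axis j 1)"
  unfolding pderiv_at_def using frechet_derivative_at[OF assms] by simp

lemma pderiv_at_pfun:
  fixes H :: "'n::finite \<Rightarrow> nat \<Rightarrow> real \<Rightarrow> real"
  assumes H: "\<And>i. deriv_family (H i)"
  shows "pderiv_at j (pfun H m) = pfun H (m(j := Suc (m j)))"
proof
  fix z
  have "pderiv_at j (pfun H m) z = (\<Sum>i\<in>UNIV. axis j 1 $ i * pfun H (m(i := Suc (m i))) z)"
    by (rule pderiv_at_eqI[OF has_derivative_pfun[OF H]])
  also have "\<dots> = (\<Sum>i\<in>{j}. pfun H (m(i := Suc (m i))) z)"
    by (rule sum.mono_neutral_cong_right) (auto simp: axis_def)
  finally show "pderiv_at j (pfun H m) z = pfun H (m(j := Suc (m j))) z" by simp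
qed

lemma pderivs_pfun:
  fixes H :: "'n::finite \<Rightarrow> nat \<Rightarrow> real \<Rightarrow> real"
  assumes H: "\<And>i. deriv_family (H i)"
  shows "pderivs js (pfun H m) = pfun H (\<lambda>i. m i + count_list js i)"
proof (induction js)
  case (Cons j js)
  have "pderivs (j # js) (pfun H m) = pderiv_at j (pderivs js (pfun H m))" by (simp add: pderivs_def)
  also have "\<dots> = pfun H ((\<lambda>i. m i + count_list js i)(j := Suc (m j + count_list js j)))"
    by (simp add: Cons pderiv_at_pfun[OF H])
  also have "(\<lambda>i. m i + count_list js i)(j := Suc (m j + count_list js j)) = (\<lambda>i. m i + count_list (j # js) i)"
    by auto
  finally show ?case .
qed (simp add: pderivs_def)

lemma smooth_pfun:
  fixes H :: "'n::finite \<Rightarrow> nat \<Rightarrow> real \<Rightarrow> real"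
  assumes H: "\<And>i. deriv_family (H i)"
  shows "smooth (pfun H m)"
  unfolding smooth_def pderivs_pfun[of H, OF H] differentiable_def using has_derivative_pfun[of H, OF H] by blast

lemma test_funsI:
  assumes "smooth \<phi>" "compact K" "K \<subseteq> U" "\<And>x. x \<notin> K \<Longrightarrow> \<phi> x = 0"
  shows "\<phi> \<in> test_funs U"
proof -
  have "closure (support_on UNIV \<phi>) \<subseteq> K"
    using assms by (intro closure_minimal compact_imp_closed) (auto simp: support_on_def)
  moreover have "compact (closure (support_on UNIV \<phi>))"
    using calculation assms(2) closed_closure by (metis compact_Int_closed inf.absorb_iff2)
  ultimately show ?thesis using assms by (auto simp: test_funs_def)
qed

lemma sum_count_list_UNIV: "(\<Sum>i\<in>(UNIV::'n::finite set). count_list js i) = length js"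
proof (induction js)
  case (Cons j js)
  have "(\<Sum>i\<in>UNIV. count_list (j # js) i) = (\<Sum>i\<in>UNIV. (if i = j then 1 else 0) + count_list js i)"
    by (rule sum.cong) auto
  also have "\<dots> = 1 + length js" by (simp add: sum.distrib Cons)
  finally show ?case by simp
qed simp

text \<open>Every coordinate contributes one factor 1/s from the normalisation and every derivative
  another one. This is the power of \<open>s\<close> in the definition of
  \<open>test_funs_N\<close>, so rescaling preserves admissibility up to the constant B^n.\<close>

lemma pderivs_scaled_pfun_le:
  fixes G :: "'n::finite \<Rightarrow> nat \<Rightarrow> real \<Rightarrow> real" and c :: "real^'n"
  assumes G: "\<And>i. deriv_family (G i)" and B: "\<And>i k t. k \<le> N \<Longrightarrow> \<bar>G i k t\<bar> \<le> B" and s: "s > 0"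
    and js: "length js \<le> N"
  shows "\<bar>pderivs js (pfun (\<lambda>i k t. (1 / s) * (1 / s) ^ k * G i k ((1 / s) * (t - c $ i))) (\<lambda>_. 0)) z\<bar>
    \<le> B ^ CARD('n) / s ^ (CARD('n) + length js)"
proof -
  have le: "count_list js i \<le> N" for i using js count_le_length[of js i] by linarith
  have "\<bar>pderivs js (pfun (\<lambda>i k t. (1 / s) * (1 / s) ^ k * G i k ((1 / s) * (t - c $ i))) (\<lambda>_. 0)) z\<bar>
    = (\<Prod>i\<in>UNIV. \<bar>(1 / s) * (1 / s) ^ count_list js i * G i (count_list js i) ((1 / s) * (z $ i - c $ i))\<bar>)"
    by (subst pderivs_pfun, rule deriv_family_scale, rule G) (simp add: pfun_def abs_prod)
  also have "\<dots> \<le> (\<Prod>i\<in>(UNIV::'n set). (1 / s) ^ Suc (count_list js i) * B)"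
    using s B[OF le] by (intro prod_mono) (auto simp: abs_mult intro!: mult_left_mono divide_right_mono)
  also have "\<dots> = (1 / s) ^ (\<Sum>i\<in>(UNIV::'n set). Suc (count_list js i)) * B ^ CARD('n)"
    by (simp only: prod.distrib prod_constant power_sum)
  also have "(\<Sum>i\<in>(UNIV::'n set). Suc (count_list js i)) = CARD('n) + length js"
  proof -
    have "(\<Sum>i\<in>(UNIV::'n set). Suc (count_list js i)) = (\<Sum>i\<in>UNIV. 1 + count_list js i)" by simp
    also have "\<dots> = CARD('n) + length js" unfolding sum.distrib sum_count_list_UNIV by simp
    finally show ?thesis .
  qed
  finally show ?thesis by (simp add: power_one_over field_simps)
qed

section \<open>Mollification along a flow\<close>

lemma integrable_mult_bounded:
  fixes w f :: "'b \<Rightarrow> real"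
  assumes w: "integrable M w" and f: "f \<in> borel_measurable M" "\<And>z. \<bar>f z\<bar> \<le> B"
  shows "integrable M (\<lambda>z. w z * f z)"
proof (rule Bochner_Integration.integrable_bound)
  show "integrable M (\<lambda>z. w z * B)" using w by (rule integrable_mult_left)
  show "(\<lambda>z. w z * f z) \<in> borel_measurable M" using w f by measurable
  show "AE z in M. norm (w z * f z) \<le> norm (w z * B)"
  proof (rule AE_I2)
    fix z
    have "\<bar>f z\<bar> \<le> \<bar>B\<bar>" using f(2)[of z] by linarith
    then show "norm (w z * f z) \<le> norm (w z * B)" by (simp add: abs_mult mult_left_mono)
  qed
qed

text \<open>Dominated convergence for the difference quotients: the bound on \<phi>' and the mean
  value inequality give the integrable majorant |w| B.\<close>

lemma has_derivative_integral_param: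
  fixes \<phi> \<phi>' :: "real \<Rightarrow> 'b \<Rightarrow> real" and w :: "'b \<Rightarrow> real"
  assumes w: "integrable M w"
    and m: "\<And>t. t \<in> {a<..<b} \<Longrightarrow> \<phi> t \<in> borel_measurable M" "\<And>t. t \<in> {a<..<b} \<Longrightarrow> \<phi>' t \<in> borel_measurable M"
    and bd: "\<And>t z. t \<in> {a<..<b} \<Longrightarrow> \<bar>\<phi> t z\<bar> \<le> B" "\<And>t z. t \<in> {a<..<b} \<Longrightarrow> \<bar>\<phi>' t z\<bar> \<le> B"
    and der: "\<And>t z. t \<in> {a<..<b} \<Longrightarrow> ((\<lambda>t. \<phi> t z) has_real_derivative \<phi>' t z) (at t)"
    and t: "t \<in> {a<..<b}"
  shows "((\<lambda>t. \<integral>z. w z * \<phi> t z \<partial>M) has_real_derivative (\<integral>z. w z * \<phi>' t z \<partial>M)) (at t)"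
proof -
  have wm [measurable]: "w \<in> borel_measurable M" using w by auto
  have int: "integrable M (\<lambda>z. w z * \<phi> s z)" if "s \<in> {a<..<b}" for s
    by (rule integrable_mult_bounded[OF w m(1)[OF that] bd(1)[OF that]])
  define d where "d = min (t - a) (b - t)"
  have d: "d > 0" using t by (auto simp: d_def)
  have in_ab: "t + h \<in> {a<..<b}" if "h \<in> {-d<..<d}" for h using that by (auto simp: d_def)
  have "((\<lambda>h. ((\<integral>z. w z * \<phi> (t + h) z \<partial>M) - (\<integral>z. w z * \<phi> t z \<partial>M)) / h) \<longlongrightarrow> (\<integral>z. w z * \<phi>' t z \<partial>M)) (at 0 within {-d<..<d})"
    unfolding tendsto_at_iff_sequentially comp_def
  proof (intro allI impI)
    fix X :: "nat \<Rightarrow> real" assume X: "\<forall>i. X i \<in> {- d<..<d} - {0}" "X \<longlonglongrightarrow> 0"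
    have eq: "((\<integral>z. w z * \<phi> (t + X i) z \<partial>M) - (\<integral>z. w z * \<phi> t z \<partial>M)) / X i
       = (\<integral>z. w z * ((\<phi> (t + X i) z - \<phi> t z) / X i) \<partial>M)" for i
    proof -
      have "(\<integral>z. w z * \<phi> (t + X i) z \<partial>M) - (\<integral>z. w z * \<phi> t z \<partial>M) = (\<integral>z. w z * \<phi> (t + X i) z - w z * \<phi> t z \<partial>M)"
        using X in_ab t by (intro Bochner_Integration.integral_diff[symmetric] int) auto
      also have "\<dots> / X i = (\<integral>z. (w z * \<phi> (t + X i) z - w z * \<phi> t z) / X i \<partial>M)"
        by (rule integral_divide_zero[symmetric])
      finally show ?thesis by (simp add: algebra_simps diff_divide_distrib)
    qed
    have "(\<lambda>i. \<integral>z. w z * ((\<phi> (t + X i) z - \<phi> t z) / X i) \<partial>M) \<longlonglongrightarrow> (\<integral>z. w z * \<phi>' t z \<partial>M)"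
    proof (rule integral_dominated_convergence)
      show "(\<lambda>z. w z * \<phi>' t z) \<in> borel_measurable M" using m(2)[OF t] by measurable
      show "(\<lambda>z. w z * ((\<phi> (t + X i) z - \<phi> t z) / X i)) \<in> borel_measurable M" for i
      proof -
        have "t + X i \<in> {a<..<b}" using X(1) by (intro in_ab) auto
        note [measurable] = m(1)[OF this] m(1)[OF t]
        show ?thesis by measurable
      qed
      show "integrable M (\<lambda>z. \<bar>w z\<bar> * B)" using w by (intro integrable_mult_left integrable_abs)
      show "AE z in M. (\<lambda>i. w z * ((\<phi> (t + X i) z - \<phi> t z) / X i)) \<longlonglongrightarrow> w z * \<phi>' t z"
      proof (rule AE_I2)
        fix z
        have "((\<lambda>h. (\<phi> (t + h) z - \<phi> t z) / h) \<longlongrightarrow> \<phi>' t z) (at 0)"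
          using der[OF t, of z] by (simp add: DERIV_def)
        then have "(\<lambda>i. (\<phi> (t + X i) z - \<phi> t z) / X i) \<longlonglongrightarrow> \<phi>' t z"
          using X unfolding tendsto_at_iff_sequentially comp_def by auto
        then show "(\<lambda>i. w z * ((\<phi> (t + X i) z - \<phi> t z) / X i)) \<longlonglongrightarrow> w z * \<phi>' t z"
          by (rule tendsto_mult_left)
      qed
      show "AE z in M. norm (w z * ((\<phi> (t + X i) z - \<phi> t z) / X i)) \<le> \<bar>w z\<bar> * B" for i
      proof (rule AE_I2)
        fix z
        have "norm (\<phi> (t + X i) z - \<phi> t z) \<le> B * norm (t + X i - t)"
        proof (rule field_differentiable_bound[of "{a<..<b}"])
          show "((\<lambda>t. \<phi> t z) has_real_derivative \<phi>' s z) (at s within {a<..<b})" if "s \<in> {a<..<b}" for s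
            using der[OF that] by (rule has_field_derivative_at_within)
          show "norm (\<phi>' s z) \<le> B" if "s \<in> {a<..<b}" for s using bd(2)[OF that] by simp
        qed (use t in_ab X in auto)
        then have "\<bar>(\<phi> (t + X i) z - \<phi> t z) / X i\<bar> \<le> B"
          using X(1) by (auto simp: field_simps)
        then show "norm (w z * ((\<phi> (t + X i) z - \<phi> t z) / X i)) \<le> \<bar>w z\<bar> * B"
          unfolding real_norm_def abs_mult[of "w z"] by (rule mult_left_mono) simp
      qed
    qed
    then show "(\<lambda>i. ((\<integral>z. w z * \<phi> (t + X i) z \<partial>M) - (\<integral>z. w z * \<phi> t z \<partial>M)) / X i) \<longlonglongrightarrow> (\<integral>z. w z * \<phi>' t z \<partial>M)"
      by (simp add: eq)
  qed
  moreover have "at 0 within {-d<..<d} = at (0::real)" using d by (intro at_within_open) auto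
  ultimately show ?thesis by (simp add: DERIV_def)
qed

lemma pderivs_cmult:
  assumes "smooth \<phi>"
  shows "pderivs js (\<lambda>z. c * \<phi> z) = (\<lambda>z. c * pderivs js \<phi> z)"
proof (induction js)
  case (Cons j js)
  have "pderivs (j # js) (\<lambda>z. c * \<phi> z) = pderiv_at j (\<lambda>z. c * pderivs js \<phi> z)"
    using Cons by (simp add: pderivs_def)
  also have "\<dots> = (\<lambda>z. c * pderivs (j # js) \<phi> z)"
  proof
    fix z
    have "(pderivs js \<phi> has_derivative frechet_derivative (pderivs js \<phi>) (at z)) (at z)"
      using assms by (simp add: smooth_def frechet_derivative_works)
    then have "((\<lambda>z. c * pderivs js \<phi> z) has_derivative (\<lambda>h. c * frechet_derivative (pderivs js \<phi>) (at z) h)) (at z)"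
      by (rule has_derivative_mult_right)
    then have "pderiv_at j (\<lambda>z. c * pderivs js \<phi> z) z = c * frechet_derivative (pderivs js \<phi>) (at z) (axis j 1)"
      by (rule pderiv_at_eqI)
    then show "pderiv_at j (\<lambda>z. c * pderivs js \<phi> z) z = c * pderivs (j # js) \<phi> z"
      by (simp add: pderivs_def pderiv_at_def)
  qed
  finally show ?case .
qed (simp add: pderivs_def)

lemma smooth_cmult:
  assumes "smooth \<phi>"
  shows "smooth (\<lambda>z. c * \<phi> z)"
  using assms unfolding smooth_def pderivs_cmult[OF assms] by (auto intro: differentiable_mult)

lemma locally_integrable_indicator:
  assumes "locally_integrable \<Omega> u" "compact K" "K \<subseteq> \<Omega>"
  shows "integrable lebesgue (\<lambda>z. indicator K z * u z)"
  using assms by (simp add: locally_integrable_def set_integrable_def)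

abbreviation weak_deriv where
  "weak_deriv \<Omega> u j \<equiv> distr_deriv j (regular_distr \<Omega> u)"

lemma regular_distr_eq:
  assumes "K \<subseteq> \<Omega>" "\<And>z. z \<notin> K \<Longrightarrow> \<phi> z = 0"
  shows "regular_distr \<Omega> u \<phi> = (\<integral>z. (indicator K z * u z) * \<phi> z \<partial>lebesgue)"
  unfolding regular_distr_def set_lebesgue_integral_def
  by (rule Bochner_Integration.integral_cong) (use assms in \<open>auto split: split_indicator\<close>)

lemma distr_deriv_cmult:
  assumes "smooth \<phi>"
  shows "weak_deriv \<Omega> u j (\<lambda>z. c * \<phi> z) = c * weak_deriv \<Omega> u j \<phi>"
proof -
  have "pderiv_at j (\<lambda>z. c * \<phi> z) = (\<lambda>z. c * pderiv_at j \<phi> z)"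
    using pderivs_cmult[OF assms, of "[j]" c] by (simp add: pderivs_def)
  then have "weak_deriv \<Omega> u j (\<lambda>z. c * \<phi> z)
    = - (LINT z:\<Omega>|lebesgue. c * (u z * pderiv_at j \<phi> z))"
    by (simp add: distr_deriv_def regular_distr_def mult_ac)
  also have "\<dots> = c * weak_deriv \<Omega> u j \<phi>"
    by (subst set_integral_mult_right) (simp add: distr_deriv_def regular_distr_def)
  finally show ?thesis .
qed

text \<open>The bump with centre \<open>c\<close> and scale \<open>s\<close>, normalised by s^(-n)
  so that the integral does not depend on \<open>s\<close>. The one-variable factors may differ
  between the coordinates, because the flow derivative modifies one of them.\<close>

definition bump_at :: "('n::finite \<Rightarrow> nat \<Rightarrow> real \<Rightarrow> real) \<Rightarrow> real^'n \<Rightarrow> real \<Rightarrow> ('n \<Rightarrow> nat) \<Rightarrow> real^'n \<Rightarrow> real" where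
  "bump_at G c s m = pfun (\<lambda>i k t. (1 / s) * (1 / s) ^ k * G i k ((1 / s) * (t - c $ i))) m"

lemma deriv_family_bump:
  "(\<And>i. deriv_family (G i)) \<Longrightarrow> deriv_family (\<lambda>k t. (1 / s) * (1 / s) ^ k * G i k ((1 / s) * (t - c $ i)))"
  by (rule deriv_family_scale)

lemma smooth_bump_at: "(\<And>i. deriv_family (G i)) \<Longrightarrow> smooth (bump_at G c s m)"
  unfolding bump_at_def by (rule smooth_pfun) (rule deriv_family_bump)

lemma pderiv_bump_at:
  assumes "\<And>i. deriv_family (G i)"
  shows "pderiv_at j (bump_at G c s m) = bump_at G c s (m(j := Suc (m j)))"
  unfolding bump_at_def by (rule pderiv_at_pfun) (rule deriv_family_bump[OF assms])

lemma continuous_bump_at: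
  assumes G: "\<And>i. deriv_family (G i)"
  shows "continuous_on UNIV (bump_at G c s m)"
proof -
  have "(bump_at G c s m) differentiable (at z)" for z
    using smooth_bump_at[of G c s m, OF G] unfolding smooth_def pderivs_def
    by (metis foldr.simps(1) id_apply)
  then show ?thesis
    by (auto intro!: continuous_at_imp_continuous_on differentiable_imp_continuous_within)
qed

text \<open>The l^1 norm dominates the Euclidean norm, so factors vanishing beyond b/n in every
  coordinate yield a product vanishing outside a ball of radius b s.\<close>

lemma bump_at_eq_0:
  fixes c z :: "real^'n"
  assumes G: "\<And>i. deriv_family (G i)" and s: "s > 0" and b: "0 \<le> b"
    and van: "\<And>i t. b / real CARD('n) < \<bar>t\<bar> \<Longrightarrow> G i 0 t = 0" and z: "b * s < dist c z"
  shows "bump_at G c s m z = 0"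
proof -
  have "\<exists>i. b / real CARD('n) < \<bar>(1 / s) * (z $ i - c $ i)\<bar>"
  proof (rule ccontr)
    assume "\<not> ?thesis"
    then have "\<bar>(1 / s) * (z $ i - c $ i)\<bar> \<le> b / real CARD('n)" for i by (metis not_le)
    then have "\<bar>(z - c) $ i\<bar> \<le> b * s / real CARD('n)" for i
      using s by (simp add: abs_mult field_simps)
    then have "(\<Sum>i\<in>UNIV. \<bar>(z - c) $ i\<bar>) \<le> (\<Sum>i\<in>(UNIV::'n set). b * s / real CARD('n))"
      by (intro sum_mono) auto
    then have "norm (z - c) \<le> b * s" using norm_le_l1_cart[of "z - c"] by simp
    then show False using z by (simp add: dist_norm norm_minus_commute)
  qed
  then obtain i where i: "b / real CARD('n) < \<bar>(1 / s) * (z $ i - c $ i)\<bar>" by blast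
  have "G i (m i) ((1 / s) * (z $ i - c $ i)) = 0"
    using deriv_family_vanish[of "G i" "b / real CARD('n)" "(1 / s) * (z $ i - c $ i)" "m i", OF G] van i by blast
  then show ?thesis unfolding bump_at_def pfun_def by (intro prod_zero) auto
qed

lemma bump_at_bound:
  fixes c z :: "real^'n"
  assumes G: "\<And>i. deriv_family (G i)" and B: "\<And>i k t. k \<le> N \<Longrightarrow> \<bar>G i k t\<bar> \<le> B" and s: "s > 0"
    and js: "length js \<le> N"
  shows "\<bar>pderivs js (bump_at G c s (\<lambda>_. 0)) z\<bar> \<le> B ^ CARD('n) / s ^ (CARD('n) + length js)"
  unfolding bump_at_def by (rule pderivs_scaled_pfun_le) (use assms in auto)

text \<open>The centre may be off \<open>x\<close> by \<open>s\<close> and the support has radius s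
  / 4, hence it lies in the ball of radius 2 s about \<open>x\<close>. The factor 2^(n + N) pays for
  measuring derivatives against the radius 2 s instead of \<open>s\<close>.\<close>

lemma bump_at_in_test_funs_N:
  fixes c x :: "real^'n"
  assumes G: "\<And>i. deriv_family (G i)" and B: "\<And>i k t. k \<le> N \<Longrightarrow> \<bar>G i k t\<bar> \<le> B" "B > 0" and s: "s > 0"
    and van: "\<And>i t. (1/4) / real CARD('n) < \<bar>t\<bar> \<Longrightarrow> G i 0 t = 0" and c: "dist x c \<le> s"
  shows "(\<lambda>z. 1 / (B ^ CARD('n) * 2 ^ (CARD('n) + N)) * bump_at G c s (\<lambda>_. 0) z) \<in> test_funs_N N x (2 * s)"
  unfolding test_funs_N_def
proof (intro CollectI conjI allI impI)
  define C where "C = B ^ CARD('n) * 2 ^ (CARD('n) + N)"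
  have C: "C > 0" using B(2) by (simp add: C_def)
  have sm: "smooth (bump_at G c s (\<lambda>_. 0))" using G by (rule smooth_bump_at)
  show "(\<lambda>z. 1 / (B ^ CARD('n) * 2 ^ (CARD('n) + N)) * bump_at G c s (\<lambda>_. 0) z) \<in> test_funs (ball x (2 * s))"
  proof (rule test_funsI[of _ "cball c (s / 4)"])
    show "cball c (s / 4) \<subseteq> ball x (2 * s)"
    proof
      fix z assume "z \<in> cball c (s / 4)"
      then show "z \<in> ball x (2 * s)" using dist_triangle[of x z c] c s by simp
    qed
    show "1 / (B ^ CARD('n) * 2 ^ (CARD('n) + N)) * bump_at G c s (\<lambda>_. 0) z = 0" if "z \<notin> cball c (s / 4)" for z
      using bump_at_eq_0[of G s "1/4" c z "\<lambda>_. 0", OF G s _ van] that by simp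
    show "smooth (\<lambda>z. 1 / (B ^ CARD('n) * 2 ^ (CARD('n) + N)) * bump_at G c s (\<lambda>_. 0) z)"
      by (rule smooth_cmult[OF sm])
  qed auto
  fix js :: "'n list" and y assume js: "length js \<le> N"
  have "\<bar>pderivs js (\<lambda>z. 1 / C * bump_at G c s (\<lambda>_. 0) z) y\<bar> = 1 / C * \<bar>pderivs js (bump_at G c s (\<lambda>_. 0)) y\<bar>"
    unfolding pderivs_cmult[OF sm] using C by (simp add: abs_mult)
  also have "\<dots> \<le> 1 / C * (B ^ CARD('n) / s ^ (CARD('n) + length js))"
    using C by (intro mult_left_mono bump_at_bound[of G N B s js, OF G B(1) s js]) auto
  also have "\<dots> \<le> 1 / (2 * s) ^ (CARD('n) + length js)"
  proof -
    have "(2::real) ^ (CARD('n) + length js) \<le> 2 ^ (CARD('n) + N)" using js by (intro power_increasing) auto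
    then have "1 / 2 ^ (CARD('n) + N) \<le> 1 / (2::real) ^ (CARD('n) + length js)" by (intro divide_left_mono) auto
    then have "1 / 2 ^ (CARD('n) + N) * (1 / s ^ (CARD('n) + length js)) \<le> 1 / (2::real) ^ (CARD('n) + length js) * (1 / s ^ (CARD('n) + length js))"
      using s by (intro mult_right_mono) auto
    then show ?thesis using B(2) by (simp add: C_def power_mult_distrib)
  qed
  finally show "\<bar>pderivs js (\<lambda>z. 1 / (B ^ CARD('n) * 2 ^ (CARD('n) + N)) * bump_at G c s (\<lambda>_. 0) z) y\<bar> \<le> 1 / (2 * s) ^ (CARD('n) + length js)"
    by (simp add: C_def)
qed

lemma integral_bump_at:
  fixes c :: "real^'n"
  assumes G: "\<And>i. deriv_family (G i)" and s: "s > 0"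
  shows "(\<integral>z. bump_at G c s (\<lambda>_. 0) z \<partial>lebesgue) = (\<integral>z. pfun G (\<lambda>_. 0) z \<partial>lebesgue)"
proof -
  define f where "f = bump_at G c s (\<lambda>_. 0)"
  have fm [measurable]: "f \<in> borel_measurable borel"
    unfolding f_def by (rule borel_measurable_continuous_onI[OF continuous_bump_at[of G, OF G]])
  have eq: "s ^ CARD('n) * f (c + s *\<^sub>R z) = pfun G (\<lambda>_. 0) z" for z
    using s by (simp add: f_def bump_at_def pfun_def prod.distrib prod_dividef power_one_over)
  have "(\<integral>z. f z \<partial>lebesgue) = (\<integral>z. f z \<partial>lborel)" by (rule integral_completion) simp
  also have "\<dots> = (\<integral>z. f z \<partial>density (distr lborel borel (\<lambda>x. c + s *\<^sub>R x)) (\<lambda>_. ennreal (\<bar>s\<bar> ^ DIM(real^'n))))"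
    using s by (subst lborel_affine[of s c]) auto
  also have "\<dots> = (\<integral>z. s ^ CARD('n) * f (c + s *\<^sub>R z) \<partial>lborel)"
    using s by (subst integral_density) (auto simp: integral_distr)
  also have "\<dots> = (\<integral>z. pfun G (\<lambda>_. 0) z \<partial>lborel)" by (simp add: eq)
  also have "\<dots> = (\<integral>z. pfun G (\<lambda>_. 0) z \<partial>lebesgue)"
  proof (rule integral_completion[symmetric])
    have "pfun G (\<lambda>_. 0) = bump_at G 0 1 (\<lambda>_. 0)" by (simp add: bump_at_def)
    then show "pfun G (\<lambda>_. 0) \<in> borel_measurable lborel"
      using borel_measurable_continuous_onI[OF continuous_bump_at[of G 0 1 "\<lambda>_. 0", OF G]] by simp
  qed
  finally show ?thesis by (simp add: f_def)
qed

text \<open>This integral is the coefficient of u(x) in the flow estimate below; it has to be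
  nonzero in order to be divided out.\<close>

lemma integral_bump_pos:
  fixes h :: "nat \<Rightarrow> real \<Rightarrow> real"
  assumes h: "deriv_family h" and nn: "\<And>t. 0 \<le> h 0 t" "h 0 0 > 0" and van: "\<And>t. b / real CARD('n) < \<bar>t\<bar> \<Longrightarrow> h 0 t = 0"
    and b: "b \<ge> 0"
  shows "0 < (\<integral>z. pfun (\<lambda>_::'n::finite. h) (\<lambda>_. 0) z \<partial>lebesgue)"
    and "integrable lebesgue (pfun (\<lambda>_::'n::finite. h) (\<lambda>_. 0))"
proof -
  let ?P = "pfun (\<lambda>_::'n::finite. h) (\<lambda>_. 0)"
  have P: "?P = bump_at (\<lambda>_. h) 0 1 (\<lambda>_. 0)" by (simp add: bump_at_def)
  have c: "continuous_on UNIV ?P" unfolding P by (rule continuous_bump_at) (rule h)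
  have zero: "?P z = 0" if "b < norm z" for z
    unfolding P by (rule bump_at_eq_0[of _ 1 b]) (use h b van that in auto)
  have "set_integrable lborel (cball 0 b) ?P"
    unfolding set_integrable_def by (rule borel_integrable_compact) (auto intro: continuous_on_subset[OF c])
  moreover have "(\<lambda>z. indicator (cball 0 b) z *\<^sub>R ?P z) = ?P" using zero by (auto split: split_indicator simp: not_le fun_eq_iff)
  ultimately have "integrable lborel ?P" by (simp add: set_integrable_def)
  then show int: "integrable lebesgue ?P" by (subst integrable_completion) auto
  have Pnn: "0 \<le> ?P z" for z using nn(1) by (simp add: pfun_def prod_nonneg)
  have "(\<integral>z. ?P z \<partial>lebesgue) \<noteq> 0"
  proof
    assume "(\<integral>z. ?P z \<partial>lebesgue) = 0"
    then have ae: "AE z in lebesgue. ?P z = 0"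
      using integral_nonneg_eq_0_iff_AE[OF int] Pnn by simp
    have "isCont ?P 0" using c by (simp add: continuous_on_eq_continuous_at)
    moreover have "?P 0 > 0" using nn(2) by (simp add: pfun_def)
    ultimately obtain e where e0: "e > 0" "\<And>z. dist z 0 < e \<Longrightarrow> dist (?P z) (?P 0) < ?P 0"
      unfolding continuous_at_eps_delta by blast
    have e: "e > 0" "\<And>z. dist z 0 < e \<Longrightarrow> ?P z > 0"
      using e0 by (fastforce simp: dist_real_def)+
    have "AE z in lebesgue. z \<notin> ball (0::real^'n) e"
      using ae
    proof eventually_elim
      case (elim z)
      then show ?case using e(2)[of z] by (auto simp: dist_commute)
    qed
    then have "ball (0::real^'n) e \<in> null_sets lebesgue" by (subst AE_iff_null_sets) auto
    then show False using open_not_negligible[of "ball (0::real^'n) e"] e(1) by (auto simp: negligible_iff_null_sets)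
  qed
  moreover have "0 \<le> (\<integral>z. ?P z \<partial>lebesgue)" using Pnn by (intro integral_nonneg_AE) auto
  ultimately show "0 < (\<integral>z. ?P z \<partial>lebesgue)" by linarith
qed

text \<open>The difference is the integral of (u - u(x)) \<Phi>, at most \<open>M\<close> times the
  oscillation integral over the ball. \<open>w\<close> is a cut-off of \<open>u\<close>: integrable
  on the whole space and equal to \<open>u\<close> where \<Phi> lives.\<close>

lemma lebesgue_point_mollifier:
  fixes \<Phi> u :: "'a::euclidean_space \<Rightarrow> real"
  assumes w: "integrable lebesgue w" and \<Phi>: "integrable lebesgue \<Phi>" "\<And>z. \<bar>\<Phi> z\<bar> \<le> M"
    and van: "\<And>z. z \<notin> ball x s \<Longrightarrow> \<Phi> z = 0" and wu: "\<And>z. z \<in> ball x s \<Longrightarrow> w z = u z"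
    and lp: "(\<integral>\<^sup>+y\<in>ball x s. ennreal \<bar>u y - u x\<bar> \<partial>lebesgue) \<le> ennreal e" and e: "e \<ge> 0"
  shows "\<bar>(\<integral>z. w z * \<Phi> z \<partial>lebesgue) - u x * (\<integral>z. \<Phi> z \<partial>lebesgue)\<bar> \<le> M * e"
proof -
  have M: "M \<ge> 0" using \<Phi>(2) by (meson abs_ge_zero order_trans)
  have [measurable]: "\<Phi> \<in> borel_measurable lebesgue" "w \<in> borel_measurable lebesgue" using w \<Phi> by auto
  have i1: "integrable lebesgue (\<lambda>z. w z * \<Phi> z)" by (rule integrable_mult_bounded[OF w _ \<Phi>(2)]) simp
  have i2: "integrable lebesgue (\<lambda>z. u x * \<Phi> z)" using \<Phi>(1) by (rule integrable_mult_right)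
  have "(\<integral>z. w z * \<Phi> z \<partial>lebesgue) - u x * (\<integral>z. \<Phi> z \<partial>lebesgue) = (\<integral>z. w z * \<Phi> z - u x * \<Phi> z \<partial>lebesgue)"
    using i1 i2 by (simp add: Bochner_Integration.integral_diff)
  then have "ennreal \<bar>(\<integral>z. w z * \<Phi> z \<partial>lebesgue) - u x * (\<integral>z. \<Phi> z \<partial>lebesgue)\<bar> \<le> (\<integral>\<^sup>+z. ennreal (norm (w z * \<Phi> z - u x * \<Phi> z)) \<partial>lebesgue)"
    using integral_norm_bound_ennreal[OF Bochner_Integration.integrable_diff[OF i1 i2]] by simp
  also have "\<dots> \<le> (\<integral>\<^sup>+z. ennreal M * (ennreal \<bar>u z - u x\<bar> * indicator (ball x s) z) \<partial>lebesgue)"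
  proof (rule nn_integral_mono)
    fix z
    show "ennreal (norm (w z * \<Phi> z - u x * \<Phi> z)) \<le> ennreal M * (ennreal \<bar>u z - u x\<bar> * indicator (ball x s) z)"
    proof (cases "z \<in> ball x s")
      case True
      have "norm (w z * \<Phi> z - u x * \<Phi> z) = \<bar>\<Phi> z\<bar> * \<bar>u z - u x\<bar>"
        using wu[OF True] by (simp add: abs_mult[symmetric] algebra_simps)
      also have "\<dots> \<le> M * \<bar>u z - u x\<bar>" by (intro mult_right_mono \<Phi>(2)) auto
      finally have "ennreal (norm (w z * \<Phi> z - u x * \<Phi> z)) \<le> ennreal (M * \<bar>u z - u x\<bar>)" by (rule ennreal_leI)
      then show ?thesis using True M by (simp add: ennreal_mult)
    next
      case False
      then have "\<Phi> z = 0" by (rule van)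
      then show ?thesis by simp
    qed
  qed
  also have "\<dots> = (\<integral>\<^sup>+z. ennreal M * (ennreal \<bar>w z - u x\<bar> * indicator (ball x s) z) \<partial>lebesgue)"
    by (rule nn_integral_cong) (use wu in \<open>auto split: split_indicator\<close>)
  also have "\<dots> = ennreal M * (\<integral>\<^sup>+z\<in>ball x s. ennreal \<bar>w z - u x\<bar> \<partial>lebesgue)"
  proof (rule nn_integral_cmult)
    have [measurable]: "ball x s \<in> sets lebesgue" by simp
    show "(\<lambda>z. ennreal \<bar>w z - u x\<bar> * indicator (ball x s) z) \<in> borel_measurable lebesgue" by measurable
  qed
  also have "(\<integral>\<^sup>+z\<in>ball x s. ennreal \<bar>w z - u x\<bar> \<partial>lebesgue) = (\<integral>\<^sup>+z\<in>ball x s. ennreal \<bar>u z - u x\<bar> \<partial>lebesgue)"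
    by (rule nn_integral_cong) (use wu in \<open>auto split: split_indicator\<close>)
  also have "ennreal M * \<dots> \<le> ennreal M * ennreal e" by (rule mult_left_mono[OF lp]) simp
  also have "\<dots> = ennreal (M * e)" using M e by (simp add: ennreal_mult)
  finally show ?thesis using M e by simp
qed

text \<open>Moving centre and scale of a bump along a line is a flow, so the derivative of the bump in the
  flow parameter is a divergence; this turns it into a combination of test functions for the
  distributional derivatives of \<open>u\<close>.\<close>

lemma bump_at_flow_derivative:
  fixes x v z :: "real^'n"
  assumes h: "deriv_family h" and \<eta>: "deriv_family \<eta>" and \<eta>0: "\<And>t. \<eta> 0 t = t * h 0 t" and r: "r > 0" and s: "s > 0"
  defines "G \<equiv> \<lambda>j i. if i = j then (\<lambda>k t. \<eta> k t + (v $ j / r) * h k t) else h"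
  shows "((\<lambda>s. bump_at (\<lambda>_. h) (x + s *\<^sub>R v) (s * r) (\<lambda>_. 0) z) has_real_derivative
     - r * (\<Sum>j\<in>UNIV. pderiv_at j (bump_at (G j) (x + s *\<^sub>R v) (s * r) (\<lambda>_. 0)) z)) (at s)"
proof -
  have G: "deriv_family (G j i)" for i j
    using h deriv_family_add_cmult[OF \<eta> h, of "v $ j / r"] by (simp add: G_def)
  have h1: "(h 0 has_real_derivative h 1 t) (at t)" for t using h by (simp add: deriv_family_def)
  have \<eta>1: "\<eta> 1 t = h 0 t + t * h 1 t" for t
  proof -
    have "(\<eta> 0 has_real_derivative \<eta> 1 t) (at t)" using \<eta> by (simp add: deriv_family_def)
    moreover have "((\<lambda>t. t * h 0 t) has_real_derivative h 0 t + t * h 1 t) (at t)"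
      using DERIV_mult[OF DERIV_ident h1, of t] by (simp add: mult.commute)
    moreover have "\<eta> 0 = (\<lambda>t. t * h 0 t)" using \<eta>0 by auto
    ultimately show ?thesis using DERIV_unique by metis
  qed
  define w where "w s i = (1 / (s * r)) * (z $ i - (x + s *\<^sub>R v) $ i)" for s i
  define f where "f i s = (1 / (s * r)) * h 0 (w s i)" for i s
  define f' where "f' i = - r * ((1 / (s * r)) ^ 2 * (h 0 (w s i) + (w s i + v $ i / r) * h 1 (w s i)))" for i
  have f: "(f i has_real_derivative f' i) (at s)" for i
  proof -
    have w': "((\<lambda>s. w s i) has_real_derivative - (1 / s) * (w s i + v $ i / r)) (at s)"
      unfolding w_def using s r by (auto intro!: derivative_eq_intros simp: field_simps power2_eq_square)
    have "((\<lambda>s. (1 / (s * r)) * h 0 (w s i)) has_real_derivative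
        (- 1 / (s ^ 2 * r)) * h 0 (w s i) + (1 / (s * r)) * (h 1 (w s i) * (- (1 / s) * (w s i + v $ i / r)))) (at s)"
    proof (rule DERIV_mult[THEN DERIV_cong])
      show "((\<lambda>s. 1 / (s * r)) has_real_derivative - 1 / (s ^ 2 * r)) (at s)"
        using s r by (auto intro!: derivative_eq_intros simp: field_simps power2_eq_square)
      show "((\<lambda>s. h 0 (w s i)) has_real_derivative h 1 (w s i) * (- (1 / s) * (w s i + v $ i / r))) (at s)"
        by (rule DERIV_chain2[OF h1 w'])
    qed (simp add: algebra_simps)
    moreover have "(- 1 / (s ^ 2 * r)) * h 0 (w s i) + (1 / (s * r)) * (h 1 (w s i) * (- (1 / s) * (w s i + v $ i / r))) = f' i"
    proof -
      have "(1 / (s * r)) ^ 2 * r = 1 / (s ^ 2 * r)" using r by (simp add: power2_eq_square)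
      moreover have "(1 / (s * r)) * (1 / s) = 1 / (s ^ 2 * r)" by (simp add: power2_eq_square)
      ultimately show ?thesis unfolding f'_def
        by (smt (verit, ccfv_SIG) distrib_left minus_divide_left mult.assoc mult.commute mult_minus_left)
    qed
    ultimately show ?thesis by (simp add: f_def[abs_def])
  qed
  have "((\<lambda>s. \<Prod>i\<in>UNIV. f i s) has_derivative (\<lambda>y. \<Sum>i\<in>UNIV. f' i * y * (\<Prod>j\<in>UNIV - {i}. f j s))) (at s)"
    by (rule has_derivative_prod) (use f in \<open>simp add: has_field_derivative_def\<close>)
  moreover have "(\<lambda>y. \<Sum>i\<in>UNIV. f' i * y * (\<Prod>j\<in>UNIV - {i}. f j s)) = (*) (\<Sum>i\<in>UNIV. f' i * (\<Prod>j\<in>UNIV - {i}. f j s))"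
    by (simp add: fun_eq_iff sum_distrib_left mult_ac)
  ultimately have "((\<lambda>s. \<Prod>i\<in>UNIV. f i s) has_real_derivative (\<Sum>i\<in>UNIV. f' i * (\<Prod>j\<in>UNIV - {i}. f j s))) (at s)"
    by (simp add: has_field_derivative_def)
  moreover have "(\<lambda>s. \<Prod>i\<in>UNIV. f i s) = (\<lambda>s. bump_at (\<lambda>_. h) (x + s *\<^sub>R v) (s * r) (\<lambda>_. 0) z)"
    by (simp add: bump_at_def pfun_def f_def w_def)
  \<comment> \<open>In coordinate \<open>j\<close> the factor h(t) of the bump is replaced by (t +
    v_j / r) h(t), with v_j the component of v; its derivative h + (t + v_j / r) h' is, up to
    scaling, what differentiation of one factor along the flow produces. The product rule thus
    becomes a sum of partial derivatives.\<close>
  moreover have "f' j * (\<Prod>i\<in>UNIV - {j}. f i s) = - r * pderiv_at j (bump_at (G j) (x + s *\<^sub>R v) (s * r) (\<lambda>_. 0)) z" for j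
  proof -
    have "pderiv_at j (bump_at (G j) (x + s *\<^sub>R v) (s * r) (\<lambda>_. 0)) z
      = bump_at (G j) (x + s *\<^sub>R v) (s * r) ((\<lambda>_. 0)(j := 1)) z"
      by (subst pderiv_bump_at) (use G in auto)
    also have "\<dots> = (1 / (s * r)) * (1 / (s * r)) ^ 1 * G j j 1 (w s j) *
       (\<Prod>i\<in>UNIV - {j}. (1 / (s * r)) * (1 / (s * r)) ^ 0 * G j i 0 (w s i))"
      unfolding bump_at_def pfun_upd w_def ..
    also have "(\<Prod>i\<in>UNIV - {j}. (1 / (s * r)) * (1 / (s * r)) ^ 0 * G j i 0 (w s i)) = (\<Prod>i\<in>UNIV - {j}. f i s)"
      by (rule prod.cong) (auto simp: G_def f_def)
    also have "G j j 1 (w s j) = h 0 (w s j) + (w s j + v $ j / r) * h 1 (w s j)"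
      using \<eta>1 by (simp add: G_def algebra_simps)
    finally show ?thesis by (simp add: f'_def power2_eq_square mult_ac)
  qed
  ultimately show ?thesis by (simp add: sum_distrib_left)
qed

text \<open>The bump with centre x + s v and scale s r shrinks to \<open>x\<close> as s tends to 0
  and is the target bump at s = 1. The s-derivative of the mean of \<open>u\<close> is
  \<open>r\<close> times a sum of weak derivatives tested against functions admissible at
  \<open>x\<close> up to a constant, hence bounded uniformly in \<open>s\<close>. The Lebesgue point
  condition identifies the limit at 0.\<close>

lemma mollifier_flow_bound:
  fixes \<Omega> :: "(real^'n) set" and h \<eta> :: "nat \<Rightarrow> real \<Rightarrow> real" and N :: nat
  assumes h: "deriv_family h" and \<eta>: "deriv_family \<eta>" and \<eta>0: "\<And>t. \<eta> 0 t = t * h 0 t" and N: "N \<ge> 1"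
    and nn: "\<And>t. 0 \<le> h 0 t" "h 0 0 > 0" and van: "\<And>t. (1/4) / real CARD('n) < \<bar>t\<bar> \<Longrightarrow> h 0 t = 0"
    and B: "\<And>k t. k \<le> N \<Longrightarrow> \<bar>h k t\<bar> \<le> B" "\<And>k t. k \<le> N \<Longrightarrow> \<bar>\<eta> k t\<bar> \<le> B" "B > 0"
    and u: "locally_integrable \<Omega> u" and r: "r > 0" and sub: "ball x (2 * r) \<subseteq> \<Omega>" and v: "norm v \<le> r"
    and lp: "lebesgue_point u x"
    and \<gamma>: "\<And>j s \<phi>. 0 < s \<Longrightarrow> s \<le> 2 * r \<Longrightarrow> \<phi> \<in> test_funs_N N x s \<Longrightarrow> \<bar>weak_deriv \<Omega> u j \<phi>\<bar> \<le> \<gamma> j"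
  shows "\<bar>(\<integral>z. pfun (\<lambda>_::'n. h) (\<lambda>_. 0) z \<partial>lebesgue) * u x - regular_distr \<Omega> u (bump_at (\<lambda>_. h) (x + v) r (\<lambda>_. 0))\<bar>
    \<le> (2 * B) ^ CARD('n) * 2 ^ (CARD('n) + N) * r * (\<Sum>j\<in>UNIV. \<gamma> j)"
proof -
  define n where "n = CARD('n)"
  define c0 where "c0 = (\<integral>z. pfun (\<lambda>_::'n. h) (\<lambda>_. 0) z \<partial>lebesgue)"
  define C where "C = (2 * B) ^ n * 2 ^ (n + N)"
  have C: "C > 0" using B(3) by (simp add: C_def)
  \<comment> \<open>Contains all supports for s < 6/5: centre displacement s r plus support radius s
    r / 4 stays below 3 r / 2. Going slightly beyond s = 1 makes the derivative at the end point
    two-sided.\<close>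
  define K where "K = cball x (3 * r / 2)"
  have K: "compact K" "K \<subseteq> \<Omega>" using sub r by (auto simp: K_def)
  define w where "w z = indicator K z * u z" for z
  have w: "integrable lebesgue w" unfolding w_def by (rule locally_integrable_indicator[OF u K])
  define \<Phi> where "\<Phi> s = bump_at (\<lambda>_. h) (x + s *\<^sub>R v) (s * r) (\<lambda>_::'n. 0)" for s
  define G where "G j i = (if i = j then (\<lambda>k t. \<eta> k t + (v $ j / r) * h k t) else h)" for i j :: 'n
  define \<Psi> where "\<Psi> s j = bump_at (G j) (x + s *\<^sub>R v) (s * r) (\<lambda>_::'n. 0)" for s j
  define D where "D s z = - r * (\<Sum>j\<in>UNIV. pderiv_at j (\<Psi> s j) z)" for s z
  have G: "deriv_family (G j i)" for i j
    using h deriv_family_add_cmult[OF \<eta> h, of "v $ j / r"] by (simp add: G_def)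
  \<comment> \<open>The doubled bound accounts for the modified factor \<eta> + (v_j / r) h, where
    |v_j| \<le> r.\<close>
  have GB: "\<bar>G j i k t\<bar> \<le> 2 * B" if "k \<le> N" for i j k t
  proof (cases "i = j")
    case True
    have "\<bar>v $ j / r\<bar> \<le> 1" using v component_le_norm_cart[of v j] r by (simp add: field_simps)
    then have "\<bar>(v $ j / r) * h k t\<bar> \<le> 1 * B" unfolding abs_mult using B(1)[OF that, of t] by (intro mult_mono) auto
    moreover have "G j i k t = \<eta> k t + (v $ j / r) * h k t" using True by (simp add: G_def)
    ultimately show ?thesis using B(2)[OF that, of t] by linarith
  qed (use B(1)[OF that, of t] B(3) in \<open>auto simp: G_def\<close>)
  have hB: "\<bar>h k t\<bar> \<le> 2 * B" if "k \<le> N" for k t using B(1)[OF that, of t] B(3) by linarith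
  have Gvan: "G j i 0 t = 0" if "(1/4) / real CARD('n) < \<bar>t\<bar>" for i j t
    using van[OF that] \<eta>0 by (auto simp: G_def)
  have far: "(1/4) * (s * r) < dist (x + s *\<^sub>R v) z" if "0 < s" "s < 6/5" "z \<notin> K" for s z
  proof -
    have "3 * r / 2 < dist x z" using that by (auto simp: K_def)
    also have "\<dots> \<le> dist x (x + s *\<^sub>R v) + dist (x + s *\<^sub>R v) z" by (rule dist_triangle)
    also have "dist x (x + s *\<^sub>R v) \<le> s * r" using that v by (simp add: dist_norm mult_left_mono)
    finally have "3 * r / 2 - s * r < dist (x + s *\<^sub>R v) z" by simp
    moreover have "s * r \<le> (6/5) * r" using that r by (intro mult_right_mono) auto
    ultimately show ?thesis by linarith
  qed
  have \<Phi>0: "\<Phi> s z = 0" if "0 < s" "s < 6/5" "z \<notin> K" for s z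
    unfolding \<Phi>_def using that r h van far by (intro bump_at_eq_0[of "\<lambda>_. h" "s * r" "1/4"]) auto
  have \<Psi>0: "pderiv_at j (\<Psi> s j) z = 0" if "0 < s" "s < 6/5" "z \<notin> K" for s j z
    unfolding \<Psi>_def pderiv_bump_at[of "G j", OF G] using that r G Gvan far
    by (intro bump_at_eq_0[of "G j" "s * r" "1/4"]) auto
  have \<Phi>c: "continuous_on UNIV (\<Phi> s)" for s unfolding \<Phi>_def using h by (rule continuous_bump_at)
  have \<Psi>c: "continuous_on UNIV (pderiv_at j (\<Psi> s j))" for s j
    unfolding \<Psi>_def pderiv_bump_at[of "G j", OF G] using G by (rule continuous_bump_at)
  have \<Phi>m [measurable]: "\<Phi> s \<in> borel_measurable lebesgue" for s by (rule continuous_imp_lebesgue_measurable[OF \<Phi>c])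
  have \<Psi>m [measurable]: "pderiv_at j (\<Psi> s j) \<in> borel_measurable lebesgue" for s j by (rule continuous_imp_lebesgue_measurable[OF \<Psi>c])
  have Dm [measurable]: "D s \<in> borel_measurable lebesgue" for s unfolding D_def by measurable
  have \<Phi>b: "\<bar>\<Phi> s z\<bar> \<le> (2 * B) ^ n / (s * r) ^ n" if "s > 0" for s z
    using bump_at_bound[of "\<lambda>_. h" N "2 * B" "s * r" "[]" "x + s *\<^sub>R v" z] h hB that r
    by (simp add: \<Phi>_def pderivs_def n_def)
  have \<Psi>b: "\<bar>pderiv_at j (\<Psi> s j) z\<bar> \<le> (2 * B) ^ n / (s * r) ^ Suc n" if "s > 0" for s j z
    using bump_at_bound[of "G j" N "2 * B" "s * r" "[j]" "x + s *\<^sub>R v" z] G GB that r N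
    by (simp add: \<Psi>_def pderivs_def n_def)
  define F where "F s = (\<integral>z. w z * \<Phi> s z \<partial>lebesgue)" for s
  define F' where "F' s = (\<integral>z. w z * D s z \<partial>lebesgue)" for s
  have FD: "(F has_real_derivative F' s) (at s)" if s: "0 < s" "s \<le> 1" for s
    unfolding F_def F'_def
  proof (rule has_derivative_integral_param[OF w])
    let ?M = "(2 * B) ^ n / (s / 2 * r) ^ n + r * real n * ((2 * B) ^ n / (s / 2 * r) ^ Suc n)"
    \<comment> \<open>The bounds on the bump and its derivatives blow up as the scale tends to 0, so
      domination is obtained on an interval that stays away from 0.\<close>
    show "s \<in> {s / 2<..<6/5}" using s by auto
    fix t z assume t: "t \<in> {s / 2<..<(6/5::real)}"
    then have t0: "0 < t" using s by auto
    have 1: "(2 * B) ^ n / (t * r) ^ k \<le> (2 * B) ^ n / (s / 2 * r) ^ k" for k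
      using t s r B(3) by (intro divide_left_mono power_mono mult_right_mono mult_pos_pos zero_less_power) auto
    have 2: "0 \<le> (2 * B) ^ n / (s / 2 * r) ^ k" for k using s r B(3) by simp
    have 3: "0 \<le> r * real n * ((2 * B) ^ n / (s / 2 * r) ^ Suc n)" by (rule mult_nonneg_nonneg[OF _ 2]) (use r in simp)
    show "\<bar>\<Phi> t z\<bar> \<le> ?M" using \<Phi>b[OF t0, of z] 1[of n] 3 by linarith
    have "\<bar>D t z\<bar> \<le> r * (\<Sum>j\<in>(UNIV::'n set). \<bar>pderiv_at j (\<Psi> t j) z\<bar>)"
      unfolding D_def using r by (simp add: abs_mult mult_left_mono)
    also have "\<dots> \<le> r * (\<Sum>j\<in>(UNIV::'n set). (2 * B) ^ n / (s / 2 * r) ^ Suc n)"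
      using r \<Psi>b[OF t0] 1[of "Suc n"] by (intro mult_left_mono sum_mono) (auto intro: order_trans)
    also have "\<dots> = r * real n * ((2 * B) ^ n / (s / 2 * r) ^ Suc n)" by (simp add: n_def)
    finally show "\<bar>D t z\<bar> \<le> ?M" using 2[of n] by linarith
    show "((\<lambda>s. \<Phi> s z) has_real_derivative D t z) (at t)"
      unfolding \<Phi>_def D_def \<Psi>_def G_def by (rule bump_at_flow_derivative[OF h \<eta> \<eta>0 r t0])
  qed measurable
  have F'b: "\<bar>F' s\<bar> \<le> C * r * (\<Sum>j\<in>UNIV. \<gamma> j)" if s: "0 < s" "s \<le> 1" for s
  proof -
    have int: "integrable lebesgue (\<lambda>z. w z * pderiv_at j (\<Psi> s j) z)" for j
      by (rule integrable_mult_bounded[OF w \<Psi>m \<Psi>b[OF s(1)]])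
    have "F' s = (\<integral>z. - r * (\<Sum>j\<in>UNIV. w z * pderiv_at j (\<Psi> s j) z) \<partial>lebesgue)"
      unfolding F'_def D_def by (simp add: sum_distrib_left mult_ac)
    also have "\<dots> = - r * (\<Sum>j\<in>UNIV. \<integral>z. w z * pderiv_at j (\<Psi> s j) z \<partial>lebesgue)"
      using int by (simp add: Bochner_Integration.integral_sum)
    \<comment> \<open>The minus sign in the definition of the distributional derivative cancels the
      one in the flow derivative.\<close>
    also have "\<dots> = r * (\<Sum>j\<in>UNIV. weak_deriv \<Omega> u j (\<Psi> s j))"
    proof -
      have "(\<integral>z. w z * pderiv_at j (\<Psi> s j) z \<partial>lebesgue) = - weak_deriv \<Omega> u j (\<Psi> s j)" for j
        unfolding distr_deriv_def w_def
        by (subst regular_distr_eq[OF K(2)]) (use \<Psi>0 s in auto)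
      then show ?thesis by (simp add: sum_negf)
    qed
    finally have "\<bar>F' s\<bar> \<le> r * (\<Sum>j\<in>UNIV. \<bar>weak_deriv \<Omega> u j (\<Psi> s j)\<bar>)"
      using r by (simp add: abs_mult mult_left_mono)
    also have "\<dots> \<le> r * (\<Sum>j\<in>UNIV. C * \<gamma> j)"
    proof (intro mult_left_mono sum_mono)
      fix j
      have "dist x (x + s *\<^sub>R v) \<le> s * r" using s v by (simp add: dist_norm mult_left_mono)
      then have "(\<lambda>z. 1 / C * \<Psi> s j z) \<in> test_funs_N N x (2 * (s * r))"
        unfolding C_def n_def \<Psi>_def using s r B(3) G GB Gvan
        by (intro bump_at_in_test_funs_N) auto
      moreover have "2 * (s * r) \<le> 2 * r" using s r by simp
      ultimately have "\<bar>weak_deriv \<Omega> u j (\<lambda>z. 1 / C * \<Psi> s j z)\<bar> \<le> \<gamma> j"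
        using s r by (intro \<gamma>[of "2 * (s * r)"]) auto
      moreover have "smooth (\<Psi> s j)" unfolding \<Psi>_def using G by (rule smooth_bump_at)
      ultimately have "\<bar>1 / C * weak_deriv \<Omega> u j (\<Psi> s j)\<bar> \<le> \<gamma> j"
        using distr_deriv_cmult[of "\<Psi> s j" j \<Omega> u "1 / C"] by simp
      then show "\<bar>weak_deriv \<Omega> u j (\<Psi> s j)\<bar> \<le> C * \<gamma> j"
        using C by (simp add: abs_mult field_simps)
    qed (use r in auto)
    finally show ?thesis by (simp add: sum_distrib_left mult_ac)
  qed
  have F1: "\<bar>F 1 - F s\<bar> \<le> C * r * (\<Sum>j\<in>UNIV. \<gamma> j)" if s: "0 < s" "s < 1" for s
  proof -
    have "norm (F 1 - F s) \<le> C * r * (\<Sum>j\<in>UNIV. \<gamma> j) * norm (1 - s)"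
    proof (rule field_differentiable_bound[of "{s..1}" F F'])
      show "(F has_real_derivative F' t) (at t within {s..1})" if "t \<in> {s..1}" for t
        by (rule has_field_derivative_at_within[OF FD]) (use that s in auto)
      show "norm (F' t) \<le> C * r * (\<Sum>j\<in>UNIV. \<gamma> j)" if "t \<in> {s..1}" for t
        using F'b[of t] that s by simp
    qed (use s in auto)
    also have "\<dots> \<le> C * r * (\<Sum>j\<in>UNIV. \<gamma> j) * 1"
    proof (rule mult_left_mono)
      have "\<bar>F' 1\<bar> \<le> C * r * (\<Sum>j\<in>UNIV. \<gamma> j)" by (rule F'b) auto
      then show "0 \<le> C * r * (\<Sum>j\<in>UNIV. \<gamma> j)" by linarith
    qed (use s in simp)
    finally show ?thesis by simp
  qed
  have "\<bar>c0 * u x - F 1\<bar> \<le> C * r * (\<Sum>j\<in>UNIV. \<gamma> j) + e" if e: "e > 0" for e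
  proof -
    \<comment> \<open>The bump at parameter \<open>s\<close> is bounded by (2 B)^n / (s r)^n and
      integrated over a ball of radius 2 s r, so the scale cancels and (2 B)^n 2^n remains.\<close>
    define e' where "e' = e / ((2 * B) ^ n * 2 ^ n)"
    have e': "e' > 0" using e B(3) by (simp add: e'_def)
    obtain d where d: "d > 0" "\<And>s. 0 < s \<Longrightarrow> s < d \<Longrightarrow>
       (\<integral>\<^sup>+y\<in>ball x s. ennreal \<bar>u y - u x\<bar> \<partial>lebesgue) \<le> ennreal (e' * s ^ DIM(real^'n))"
      using lp e' unfolding lebesgue_point_def by blast
    \<comment> \<open>The second entry puts the radius 2 s r below \<open>d\<close>, the first keeps
      the ball of that radius inside \<open>K\<close>, where \<open>w\<close> equals
      \<open>u\<close>.\<close>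
    define s where "s = min (1/2) (d / (4 * r))"
    have s: "0 < s" "s < 1" using d r by (auto simp: s_def)
    have "s \<le> d / (4 * r)" by (simp add: s_def)
    then have sd: "2 * s * r < d" using r d by (simp add: field_simps)
    have "\<bar>(\<integral>z. w z * \<Phi> s z \<partial>lebesgue) - u x * (\<integral>z. \<Phi> s z \<partial>lebesgue)\<bar> \<le> (2 * B) ^ n / (s * r) ^ n * (e' * (2 * s * r) ^ n)"
    proof (rule lebesgue_point_mollifier[OF w, where s = "2 * s * r"])
      have "set_integrable lborel K (\<Phi> s)"
        unfolding set_integrable_def by (rule borel_integrable_compact) (auto intro: continuous_on_subset[OF \<Phi>c] K)
      moreover have "(\<lambda>z. indicator K z *\<^sub>R \<Phi> s z) = \<Phi> s"
        using \<Phi>0[of s] s by (auto split: split_indicator simp: fun_eq_iff)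
      ultimately have "integrable lborel (\<Phi> s)" by (simp add: set_integrable_def)
      then show "integrable lebesgue (\<Phi> s)" by (subst integrable_completion) auto
      show "\<bar>\<Phi> s z\<bar> \<le> (2 * B) ^ n / (s * r) ^ n" for z using \<Phi>b s by auto
      show "\<Phi> s z = 0" if "z \<notin> ball x (2 * s * r)" for z
      proof -
        have "2 * s * r \<le> dist x z" using that by simp
        also have "\<dots> \<le> dist x (x + s *\<^sub>R v) + dist (x + s *\<^sub>R v) z" by (rule dist_triangle)
        also have "dist x (x + s *\<^sub>R v) \<le> s * r" using s v by (simp add: dist_norm mult_left_mono)
        finally have "s * r \<le> dist (x + s *\<^sub>R v) z" by (simp add: algebra_simps)
        moreover have "(1/4) * (s * r) < s * r" using s r by simp
        ultimately have "(1/4) * (s * r) < dist (x + s *\<^sub>R v) z" by linarith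
        then show ?thesis
          unfolding \<Phi>_def using s r h van by (intro bump_at_eq_0[of "\<lambda>_. h" "s * r" "1/4"]) auto
      qed
      show "w z = u z" if "z \<in> ball x (2 * s * r)" for z
      proof -
        have "s \<le> 1/2" by (simp add: s_def)
        then have "s * r \<le> 1/2 * r" using r by (intro mult_right_mono) auto
        moreover have "dist x z < 2 * (s * r)" using that by simp
        ultimately have "dist x z \<le> 3 * r / 2" using r by linarith
        then have "z \<in> K" by (simp add: K_def)
        then show ?thesis by (simp add: w_def)
      qed
      show "(\<integral>\<^sup>+y\<in>ball x (2 * s * r). ennreal \<bar>u y - u x\<bar> \<partial>lebesgue) \<le> ennreal (e' * (2 * s * r) ^ n)"
        using d(2)[of "2 * s * r"] sd s r by (simp add: n_def)
      show "0 \<le> e' * (2 * s * r) ^ n" using e' s r by simp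
    qed
    also have "\<dots> = e"
      using s r B(3) by (simp add: e'_def power_mult_distrib field_simps)
    also have "(\<integral>z. \<Phi> s z \<partial>lebesgue) = c0"
      unfolding \<Phi>_def c0_def using h s r by (intro integral_bump_at) auto
    finally have "\<bar>F s - c0 * u x\<bar> \<le> e" by (simp add: F_def mult.commute)
    then show ?thesis using F1[OF s] by linarith
  qed
  then have "\<bar>c0 * u x - F 1\<bar> \<le> C * r * (\<Sum>j\<in>UNIV. \<gamma> j)" by (rule field_le_epsilon)
  moreover have "F 1 = regular_distr \<Omega> u (bump_at (\<lambda>_. h) (x + v) r (\<lambda>_. 0))"
    unfolding F_def w_def by (subst regular_distr_eq[OF K(2)]) (use \<Phi>0[of 1] in \<open>auto simp: \<Phi>_def\<close>)
  ultimately show ?thesis by (simp add: c0_def C_def n_def)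
qed

text \<open>Both points flow to the same bump, centred at \<open>y\<close> with scale
  \<open>dist x y\<close>: from \<open>x\<close> with velocity y - x, from \<open>y\<close> with
  velocity 0. The two estimates are combined by the triangle inequality and divided by the integral
  of the bump.\<close>

theorem H1p_pointwise:
  fixes N :: nat
  assumes N: "N \<ge> 1"
  shows "\<exists>C>0. \<forall>(\<Omega>::(real^'n) set) u x y \<gamma> \<gamma>'. locally_integrable \<Omega> u \<longrightarrow> x \<noteq> y \<longrightarrow>
    ball x (2 * dist x y) \<subseteq> \<Omega> \<longrightarrow> ball y (2 * dist x y) \<subseteq> \<Omega> \<longrightarrow> lebesgue_point u x \<longrightarrow> lebesgue_point u y \<longrightarrow>
    (\<forall>j s \<phi>. 0 < s \<longrightarrow> s \<le> 2 * dist x y \<longrightarrow> \<phi> \<in> test_funs_N N x s \<longrightarrow> \<bar>weak_deriv \<Omega> u j \<phi>\<bar> \<le> \<gamma> j) \<longrightarrow>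
    (\<forall>j s \<phi>. 0 < s \<longrightarrow> s \<le> 2 * dist x y \<longrightarrow> \<phi> \<in> test_funs_N N y s \<longrightarrow> \<bar>weak_deriv \<Omega> u j \<phi>\<bar> \<le> \<gamma>' j) \<longrightarrow>
    \<bar>u x - u y\<bar> \<le> dist x y * (C * (\<Sum>j\<in>UNIV. \<gamma> j) + C * (\<Sum>j\<in>UNIV. \<gamma>' j))"
proof -
  obtain h0 where h0: "\<And>k. Ck k h0" "\<And>t. 0 \<le> h0 t" "h0 0 > 0" "\<And>t. (1/4) / real CARD('n) \<le> \<bar>t\<bar> \<Longrightarrow> h0 t = 0"
    using exists_bump[of "(1/4) / real CARD('n)"] by auto
  obtain h where h: "deriv_family h" "h 0 = h0" using Ck_imp_deriv_family[OF h0(1)] by blast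
  have "Ck k (\<lambda>t. t * h0 t)" for k by (rule Ck_mult[OF Ck_ident h0(1)])
  then obtain \<eta> where \<eta>: "deriv_family \<eta>" "\<eta> 0 = (\<lambda>t. t * h0 t)" using Ck_imp_deriv_family by blast
  have van: "h 0 t = 0" "\<eta> 0 t = 0" if "(1/4) / real CARD('n) < \<bar>t\<bar>" for t
    using h0(4)[of t] that by (auto simp: h \<eta>)
  obtain B1 where B1: "B1 > 0" "\<And>k t. k \<le> N \<Longrightarrow> \<bar>h k t\<bar> \<le> B1"
    using deriv_family_bounded[of h "(1/4) / real CARD('n)", OF h(1) van(1)] by blast
  obtain B2 where B2: "B2 > 0" "\<And>k t. k \<le> N \<Longrightarrow> \<bar>\<eta> k t\<bar> \<le> B2"
    using deriv_family_bounded[of \<eta> "(1/4) / real CARD('n)", OF \<eta>(1) van(2)] by blast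
  define B where "B = max B1 B2"
  have B: "\<And>k t. k \<le> N \<Longrightarrow> \<bar>h k t\<bar> \<le> B" "\<And>k t. k \<le> N \<Longrightarrow> \<bar>\<eta> k t\<bar> \<le> B" "B > 0"
    using B1 B2 by (auto simp: B_def le_max_iff_disj)
  define c0 where "c0 = (\<integral>z. pfun (\<lambda>_::'n. h) (\<lambda>_. 0) z \<partial>lebesgue)"
  have c0: "c0 > 0" unfolding c0_def
    by (rule integral_bump_pos(1)[of h "1/4", OF h(1) _ _ van(1)]) (use h h0 in auto)
  define A where "A = (2 * B) ^ CARD('n) * 2 ^ (CARD('n) + N)"
  have A: "A > 0" using B(3) by (simp add: A_def)
  show ?thesis
  proof (rule exI[of _ "A / c0"], intro conjI allI impI)
    fix \<Omega> :: "(real^'n) set" and u x y \<gamma> \<gamma>'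
    assume u: "locally_integrable \<Omega> u" and xy: "x \<noteq> y"
      and b: "ball x (2 * dist x y) \<subseteq> \<Omega>" "ball y (2 * dist x y) \<subseteq> \<Omega>" and l: "lebesgue_point u x" "lebesgue_point u y"
      and \<gamma>: "\<forall>j s \<phi>. 0 < s \<longrightarrow> s \<le> 2 * dist x y \<longrightarrow> \<phi> \<in> test_funs_N N x s \<longrightarrow> \<bar>weak_deriv \<Omega> u j \<phi>\<bar> \<le> \<gamma> j"
        "\<forall>j s \<phi>. 0 < s \<longrightarrow> s \<le> 2 * dist x y \<longrightarrow> \<phi> \<in> test_funs_N N y s \<longrightarrow> \<bar>weak_deriv \<Omega> u j \<phi>\<bar> \<le> \<gamma>' j"
    let ?r = "dist x y" and ?M = "regular_distr \<Omega> u (bump_at (\<lambda>_. h) y (dist x y) (\<lambda>_. 0))"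
    have r: "?r > 0" using xy by simp
    have eta: "\<eta> 0 t = t * h 0 t" for t by (simp add: h \<eta>)
    have "\<bar>c0 * u x - regular_distr \<Omega> u (bump_at (\<lambda>_. h) (x + (y - x)) ?r (\<lambda>_. 0))\<bar> \<le> A * ?r * (\<Sum>j\<in>UNIV. \<gamma> j)"
      unfolding c0_def A_def
      by (rule mollifier_flow_bound[OF h(1) \<eta>(1) eta N _ _ van(1) B u r b(1) _ l(1)])
         (use h h0 \<gamma> in \<open>auto simp: dist_norm norm_minus_commute\<close>)
    then have 1: "\<bar>c0 * u x - ?M\<bar> \<le> A * ?r * (\<Sum>j\<in>UNIV. \<gamma> j)" by simp
    have "\<bar>c0 * u y - regular_distr \<Omega> u (bump_at (\<lambda>_. h) (y + 0) ?r (\<lambda>_. 0))\<bar> \<le> A * ?r * (\<Sum>j\<in>UNIV. \<gamma>' j)"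
      unfolding c0_def A_def
      by (rule mollifier_flow_bound[OF h(1) \<eta>(1) eta N _ _ van(1) B u r b(2) _ l(2)])
         (use h h0 \<gamma> in auto)
    then have 2: "\<bar>c0 * u y - ?M\<bar> \<le> A * ?r * (\<Sum>j\<in>UNIV. \<gamma>' j)" by simp
    have "c0 * \<bar>u x - u y\<bar> = \<bar>c0 * u x - c0 * u y\<bar>" using c0 by (simp add: abs_mult flip: right_diff_distrib)
    also have "\<dots> \<le> A * ?r * (\<Sum>j\<in>UNIV. \<gamma> j) + A * ?r * (\<Sum>j\<in>UNIV. \<gamma>' j)" using 1 2 by linarith
    finally show "\<bar>u x - u y\<bar> \<le> ?r * (A / c0 * (\<Sum>j\<in>UNIV. \<gamma> j) + A / c0 * (\<Sum>j\<in>UNIV. \<gamma>' j))"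
      using c0 by (simp add: field_simps)
  qed (use A c0 in auto)
qed

section \<open>Distributional derivatives and oscillation\<close>

lemma pderivs_differentiable: "smooth \<phi> \<Longrightarrow> pderivs js \<phi> differentiable (at x)"
  by (simp add: smooth_def)

lemma pderivs_continuous: "smooth \<phi> \<Longrightarrow> continuous_on UNIV (pderivs js \<phi>)"
  by (auto intro!: continuous_at_imp_continuous_on differentiable_imp_continuous_within pderivs_differentiable)

lemma pderivs_Cons: "pderivs (j # js) \<phi> = pderiv_at j (pderivs js \<phi>)"
  by (simp add: pderivs_def)

lemma pderivs_singleton: "pderivs [j] \<phi> = pderiv_at j \<phi>"
  by (simp add: pderivs_def)

lemma pderivs_outside_support:
  assumes "z \<notin> closure (support_on UNIV \<phi>)"
  shows "pderivs js \<phi> z = 0"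
  using assms
proof (induction js arbitrary: z)
  case Nil
  then show ?case using closure_subset[of "support_on UNIV \<phi>"] by (auto simp: pderivs_def support_on_def)
next
  case (Cons j js)
  have "(pderivs js \<phi> has_derivative (\<lambda>_. 0)) (at z)"
  proof (rule has_derivative_transform_within_open[of "\<lambda>_. 0"])
    show "open (- closure (support_on UNIV \<phi>))" by auto
  qed (use Cons in auto)
  then show ?case unfolding pderivs_Cons by (subst pderiv_at_eqI) auto
qed

lemma pderivs_bounded:
  assumes \<phi>: "\<phi> \<in> test_funs U"
  obtains B where "B \<ge> 0" "\<And>z. \<bar>pderivs js \<phi> z\<bar> \<le> B"
proof -
  let ?S = "closure (support_on UNIV \<phi>)"
  have "compact (pderivs js \<phi> ` ?S)"
    using \<phi> by (intro compact_continuous_image) (auto simp: test_funs_def intro: continuous_on_subset[OF pderivs_continuous])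
  then obtain B where B: "\<forall>z\<in>?S. \<bar>pderivs js \<phi> z\<bar> \<le> B"
    using bounded_real[of "pderivs js \<phi> ` ?S"] compact_imp_bounded by auto
  have "\<bar>pderivs js \<phi> z\<bar> \<le> max B 0" for z
    using B pderivs_outside_support[of z \<phi> js] by (cases "z \<in> ?S") (auto simp: le_max_iff_disj)
  then show thesis by (intro that[of "max B 0"]) auto
qed

lemma pderivs_measurable: "\<phi> \<in> test_funs U \<Longrightarrow> pderivs js \<phi> \<in> borel_measurable lebesgue"
  by (auto simp: test_funs_def intro: continuous_imp_lebesgue_measurable[OF pderivs_continuous])

lemma integrable_indicator_cball:
  "integrable lebesgue (indicator (cball (a::'a::euclidean_space) R) :: 'a \<Rightarrow> real)"
  using emeasure_bounded_finite[OF bounded_cball, of a R] by (intro integrable_real_indicator) auto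

text \<open>By translation invariance the integral of the translates \<phi>(z + t e) is constant in
  \<open>t\<close>; differentiating under the integral at t = 0 gives the claim.\<close>

lemma integral_pderiv_eq_0:
  assumes \<phi>: "\<phi> \<in> test_funs U"
  shows "(\<integral>z. pderiv_at j \<phi> z \<partial>lebesgue) = 0"
proof -
  let ?S = "closure (support_on UNIV \<phi>)"
  define e where "e = (axis j 1 :: real^'a)"
  have ne: "norm e = 1" by (simp add: e_def)
  have sm: "smooth \<phi>" and S: "compact ?S" using \<phi> by (auto simp: test_funs_def)
  have nil: "pderivs [] \<phi> = \<phi>" by (simp add: pderivs_def)
  obtain R where R: "\<And>z. z \<in> ?S \<Longrightarrow> norm z \<le> R"
    using compact_imp_bounded[OF S] unfolding bounded_iff by blast
  obtain B0 where B0: "\<And>z. \<bar>\<phi> z\<bar> \<le> B0" using pderivs_bounded[OF \<phi>, of "[]"] nil by metis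
  obtain B1 where B1: "\<And>z. \<bar>pderiv_at j \<phi> z\<bar> \<le> B1" using pderivs_bounded[OF \<phi>, of "[j]"] pderivs_singleton by metis
  \<comment> \<open>An integrable weight, required for differentiation under the integral. The
    margin 1 in the radius makes it equal to 1 on the supports of all translates with |t| <
    1.\<close>
  define w where "w = (indicator (cball 0 (R + 1)) :: real^'a \<Rightarrow> real)"
  have w: "integrable lebesgue w" unfolding w_def by (rule integrable_indicator_cball)
  have cont: "continuous_on UNIV \<phi>" "continuous_on UNIV (pderiv_at j \<phi>)"
    using pderivs_continuous[OF sm, of "[]"] pderivs_continuous[OF sm, of "[j]"] by (simp_all add: nil pderivs_singleton)
  have contt: "continuous_on UNIV (\<lambda>z. f (z + t *\<^sub>R e))" if "continuous_on UNIV f" for t and f :: "real^'a \<Rightarrow> real"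
    by (rule continuous_on_compose2[OF that]) (auto intro!: continuous_intros)
  have supp: "w z * f (z + t *\<^sub>R e) = f (z + t *\<^sub>R e)" if "\<bar>t\<bar> < 1" "\<And>z. z \<notin> ?S \<Longrightarrow> f z = 0" for t z f
  proof (cases "z \<in> cball 0 (R + 1)")
    case False
    then have "R + 1 < norm z" by simp
    also have "norm z \<le> norm (z + t *\<^sub>R e) + norm (t *\<^sub>R e)" by (metis add_diff_cancel_right' norm_triangle_ineq4)
    finally have "R < norm (z + t *\<^sub>R e)" using that(1) ne by simp
    then have "z + t *\<^sub>R e \<notin> ?S" using R by force
    then show ?thesis using that(2) by simp
  qed (simp add: w_def)
  have z0: "\<phi> z = 0" "pderiv_at j \<phi> z = 0" if "z \<notin> ?S" for z
    using pderivs_outside_support[OF that, of "[]"] pderivs_outside_support[OF that, of "[j]"] by (simp_all add: nil pderivs_singleton)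
  have D: "((\<lambda>t. \<integral>z. w z * \<phi> (z + t *\<^sub>R e) \<partial>lebesgue) has_real_derivative (\<integral>z. w z * pderiv_at j \<phi> (z + 0 *\<^sub>R e) \<partial>lebesgue)) (at 0)"
  proof (rule has_derivative_integral_param[OF w, where a = "-1" and b = 1 and B = "max B0 B1"])
    fix t :: real and z
    show "\<bar>\<phi> (z + t *\<^sub>R e)\<bar> \<le> max B0 B1" "\<bar>pderiv_at j \<phi> (z + t *\<^sub>R e)\<bar> \<le> max B0 B1"
      using B0 B1 by (auto simp: le_max_iff_disj)
    show "(\<lambda>z. \<phi> (z + t *\<^sub>R e)) \<in> borel_measurable lebesgue" "(\<lambda>z. pderiv_at j \<phi> (z + t *\<^sub>R e)) \<in> borel_measurable lebesgue"
      by (intro continuous_imp_lebesgue_measurable contt cont)+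
    have "(\<phi> has_derivative frechet_derivative \<phi> (at (z + t *\<^sub>R e))) (at (z + t *\<^sub>R e))"
      using pderivs_differentiable[OF sm, of "[]"] by (simp add: nil frechet_derivative_works)
    moreover have "((\<lambda>t. z + t *\<^sub>R e) has_derivative (\<lambda>h. h *\<^sub>R e)) (at t)"
      by (auto intro!: derivative_eq_intros)
    ultimately have *: "((\<lambda>t. \<phi> (z + t *\<^sub>R e)) has_derivative (\<lambda>h. frechet_derivative \<phi> (at (z + t *\<^sub>R e)) (h *\<^sub>R e))) (at t)"
      using has_derivative_compose by blast
    have "linear (frechet_derivative \<phi> (at (z + t *\<^sub>R e)))"
      using pderivs_differentiable[OF sm, of "[]"] by (simp add: nil linear_frechet_derivative)
    then have "(\<lambda>h. frechet_derivative \<phi> (at (z + t *\<^sub>R e)) (h *\<^sub>R e)) = (*) (pderiv_at j \<phi> (z + t *\<^sub>R e))"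
      by (simp add: linear_scale pderiv_at_def e_def fun_eq_iff)
    then show "((\<lambda>t. \<phi> (z + t *\<^sub>R e)) has_real_derivative pderiv_at j \<phi> (z + t *\<^sub>R e)) (at t)"
      using * by (simp add: has_field_derivative_def)
  qed auto
  have const: "(\<integral>z. w z * \<phi> (z + t *\<^sub>R e) \<partial>lebesgue) = (\<integral>z. \<phi> z \<partial>lborel)" if t: "t \<in> {-1<..<1}" for t
  proof -
    have [measurable]: "\<phi> \<in> borel_measurable borel" using cont(1) by (rule borel_measurable_continuous_onI)
    have "(\<integral>z. w z * \<phi> (z + t *\<^sub>R e) \<partial>lebesgue) = (\<integral>z. \<phi> (z + t *\<^sub>R e) \<partial>lebesgue)"
      by (intro Bochner_Integration.integral_cong refl supp) (use z0 t in auto)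
    also have "\<dots> = (\<integral>z. \<phi> (z + t *\<^sub>R e) \<partial>lborel)" by (rule integral_completion) simp
    also have "\<dots> = (\<integral>z. \<phi> (t *\<^sub>R e + z) \<partial>lborel)" by (simp add: add.commute)
    also have "\<dots> = (\<integral>z. \<phi> z \<partial>distr lborel borel ((+) (t *\<^sub>R e)))" by (rule integral_distr[symmetric]) auto
    finally show ?thesis by (simp add: lborel_distr_plus)
  qed
  have "((\<lambda>t. \<integral>z. w z * \<phi> (z + t *\<^sub>R e) \<partial>lebesgue) has_real_derivative 0) (at 0)"
  proof (subst DERIV_cong_ev[OF refl _ refl])
    show "eventually (\<lambda>t. (\<integral>z. w z * \<phi> (z + t *\<^sub>R e) \<partial>lebesgue) = (\<integral>z. \<phi> z \<partial>lborel)) (nhds 0)"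
      using eventually_nhds_in_open[of "{-1<..<1::real}" 0] const by (auto elim!: eventually_mono)
  qed simp
  then have "(\<integral>z. w z * pderiv_at j \<phi> (z + 0 *\<^sub>R e) \<partial>lebesgue) = 0" using D DERIV_unique by blast
  moreover have "(\<integral>z. w z * pderiv_at j \<phi> (z + 0 *\<^sub>R e) \<partial>lebesgue) = (\<integral>z. pderiv_at j \<phi> z \<partial>lebesgue)"
  proof (rule Bochner_Integration.integral_cong[OF refl])
    fix z show "w z * pderiv_at j \<phi> (z + 0 *\<^sub>R e) = pderiv_at j \<phi> z"
      using supp[of 0 "pderiv_at j \<phi>" z] z0 by simp
  qed
  ultimately show ?thesis by simp
qed

lemma test_fun_support:
  assumes "\<phi> \<in> test_funs U"
  obtains K where "compact K" "K \<subseteq> U" "\<And>js z. z \<notin> K \<Longrightarrow> pderivs js \<phi> z = 0"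
proof (rule that[of "closure (support_on UNIV \<phi>)"])
  show "pderivs js \<phi> z = 0" if "z \<notin> closure (support_on UNIV \<phi>)" for js z
    using that by (rule pderivs_outside_support)
qed (use assms in \<open>auto simp: test_funs_def\<close>)

text \<open>Since the derivative of \<phi> has integral 0, any constant \<open>c\<close> may be
  subtracted from \<open>u\<close>; the remaining factor is bounded by s^(-n-1), one of the
  admissibility conditions because N \<ge> 1.\<close>

lemma distr_deriv_le_oscillation:
  fixes u :: "real^'n \<Rightarrow> real"
  assumes u: "locally_integrable \<Omega> u" and sub: "ball x s \<subseteq> \<Omega>" and s: "s > 0" and N: "N \<ge> 1"
    and \<phi>: "\<phi> \<in> test_funs_N N x s"
    and J: "(\<integral>\<^sup>+y\<in>ball x s. ennreal \<bar>u y - c\<bar> \<partial>lebesgue) \<le> ennreal J" "J \<ge> 0"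
  shows "\<bar>weak_deriv \<Omega> u j \<phi>\<bar> \<le> J / s ^ (CARD('n) + 1)"
proof -
  have \<phi>1: "\<phi> \<in> test_funs (ball x s)" and \<phi>2: "\<bar>pderiv_at j \<phi> z\<bar> \<le> 1 / s ^ (CARD('n) + 1)" for z
    using \<phi> N pderivs_singleton[of j \<phi>] unfolding test_funs_N_def by (auto dest!: spec[of _ "[j]"])
  obtain K where K: "compact K" "K \<subseteq> ball x s" "\<And>js z. z \<notin> K \<Longrightarrow> pderivs js \<phi> z = 0"
    using test_fun_support[OF \<phi>1] by blast
  have K0: "z \<notin> K \<Longrightarrow> pderiv_at j \<phi> z = 0" for z using K(3)[of z "[j]"] by (simp add: pderivs_singleton)
  define w where "w z = indicator K z * u z" for z
  have w: "integrable lebesgue w" unfolding w_def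
    using K(2) sub by (intro locally_integrable_indicator[OF u K(1)]) auto
  have dm [measurable]: "pderiv_at j \<phi> \<in> borel_measurable lebesgue"
    using pderivs_measurable[OF \<phi>1, of "[j]"] by (simp add: pderivs_singleton)
  have wm [measurable]: "w \<in> borel_measurable lebesgue" using w by auto
  have i1: "integrable lebesgue (\<lambda>z. w z * pderiv_at j \<phi> z)"
    by (rule integrable_mult_bounded[OF w dm \<phi>2])
  have i2: "integrable lebesgue (\<lambda>z. c * (indicator (cball x s) z * pderiv_at j \<phi> z))"
    by (intro integrable_mult_right integrable_mult_bounded[OF integrable_indicator_cball dm \<phi>2])
  have eq: "indicator (cball x s) z * pderiv_at j \<phi> z = pderiv_at j \<phi> z" for z
    using K0[of z] subsetD[OF K(2), of z] by (cases "z \<in> K") auto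
  have i2': "integrable lebesgue (\<lambda>z. c * pderiv_at j \<phi> z)" using i2 by (simp add: eq)
  have "\<bar>weak_deriv \<Omega> u j \<phi>\<bar> = \<bar>(\<integral>z. w z * pderiv_at j \<phi> z \<partial>lebesgue)\<bar>"
    unfolding distr_deriv_def w_def by (subst regular_distr_eq[of K]) (use K sub K0 in auto)
  also have "(\<integral>z. w z * pderiv_at j \<phi> z \<partial>lebesgue) = (\<integral>z. w z * pderiv_at j \<phi> z \<partial>lebesgue) - (\<integral>z. c * pderiv_at j \<phi> z \<partial>lebesgue)"
    by (simp add: integral_pderiv_eq_0[OF \<phi>1])
  also have "\<dots> = (\<integral>z. w z * pderiv_at j \<phi> z - c * pderiv_at j \<phi> z \<partial>lebesgue)"
    by (rule Bochner_Integration.integral_diff[symmetric, OF i1 i2'])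
  finally have "ennreal \<bar>weak_deriv \<Omega> u j \<phi>\<bar>
     \<le> (\<integral>\<^sup>+z. ennreal (norm (w z * pderiv_at j \<phi> z - c * pderiv_at j \<phi> z)) \<partial>lebesgue)"
    using integral_norm_bound_ennreal[OF Bochner_Integration.integrable_diff[OF i1 i2']] by simp
  also have "\<dots> \<le> (\<integral>\<^sup>+z. ennreal (1 / s ^ (CARD('n) + 1)) * (ennreal \<bar>w z - c\<bar> * indicator K z) \<partial>lebesgue)"
  proof (rule nn_integral_mono)
    fix z
    show "ennreal (norm (w z * pderiv_at j \<phi> z - c * pderiv_at j \<phi> z)) \<le> ennreal (1 / s ^ (CARD('n) + 1)) * (ennreal \<bar>w z - c\<bar> * indicator K z)"
    proof (cases "z \<in> K")
      case True
      have "norm (w z * pderiv_at j \<phi> z - c * pderiv_at j \<phi> z) = \<bar>pderiv_at j \<phi> z\<bar> * \<bar>w z - c\<bar>"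
        by (simp add: abs_mult[symmetric] algebra_simps)
      also have "\<dots> \<le> 1 / s ^ (CARD('n) + 1) * \<bar>w z - c\<bar>" by (intro mult_right_mono \<phi>2) auto
      finally show ?thesis using True s by (simp add: ennreal_mult[symmetric] ennreal_leI)
    qed (simp add: K0)
  qed
  also have "\<dots> = ennreal (1 / s ^ (CARD('n) + 1)) * (\<integral>\<^sup>+z\<in>K. ennreal \<bar>w z - c\<bar> \<partial>lebesgue)"
  proof (rule nn_integral_cmult)
    have [measurable]: "K \<in> sets lebesgue" using K(1) by (simp add: compact_imp_closed)
    show "(\<lambda>z. ennreal \<bar>w z - c\<bar> * indicator K z) \<in> borel_measurable lebesgue" by measurable
  qed
  also have "\<dots> \<le> ennreal (1 / s ^ (CARD('n) + 1)) * ennreal J"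
  proof (rule mult_left_mono)
    have "(\<integral>\<^sup>+z\<in>K. ennreal \<bar>w z - c\<bar> \<partial>lebesgue) \<le> (\<integral>\<^sup>+y\<in>ball x s. ennreal \<bar>u y - c\<bar> \<partial>lebesgue)"
      using K(2) by (intro nn_integral_mono) (auto simp: w_def split: split_indicator)
    then show "(\<integral>\<^sup>+z\<in>K. ennreal \<bar>w z - c\<bar> \<partial>lebesgue) \<le> ennreal J" using J(1) by (rule order_trans)
  qed simp
  also have "\<dots> = ennreal (J / s ^ (CARD('n) + 1))" using s J(2) by (simp add: ennreal_mult[symmetric])
  finally show ?thesis using s J(2) by simp
qed

text \<open>Continuity holds with order 1 and with the L^1 norm of \<open>u\<close> on the compact
  set as constant: a single term of the sum, the list \<open>[j]\<close>, already dominates.\<close>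

lemma distribution_on_distr_deriv:
  fixes u :: "real^'n \<Rightarrow> real"
  assumes u: "locally_integrable \<Omega> u"
  shows "distribution_on \<Omega> (weak_deriv \<Omega> u j)"
  unfolding distribution_on_def
proof (intro conjI ballI allI impI)
  fix \<phi> \<psi> a b assume \<phi>: "\<phi> \<in> test_funs \<Omega>" and \<psi>: "\<psi> \<in> test_funs \<Omega>"
  obtain K where K: "compact K" "K \<subseteq> \<Omega>" "\<And>js z. z \<notin> K \<Longrightarrow> pderivs js \<phi> z = 0" using test_fun_support[OF \<phi>] by blast
  obtain L where L: "compact L" "L \<subseteq> \<Omega>" "\<And>js z. z \<notin> L \<Longrightarrow> pderivs js \<psi> z = 0" using test_fun_support[OF \<psi>] by blast
  define w where "w z = indicator (K \<union> L) z * u z" for z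
  have KL: "K \<union> L \<subseteq> \<Omega>" using K L by auto
  have w: "integrable lebesgue w" unfolding w_def using K L KL by (intro locally_integrable_indicator[OF u]) auto
  have d: "pderiv_at j (\<lambda>x. a * \<phi> x + b * \<psi> x) z = a * pderiv_at j \<phi> z + b * pderiv_at j \<psi> z" for z
  proof -
    have "(\<phi> has_derivative frechet_derivative \<phi> (at z)) (at z)" "(\<psi> has_derivative frechet_derivative \<psi> (at z)) (at z)"
      using \<phi> \<psi> pderivs_differentiable[of \<phi> "[]" z] pderivs_differentiable[of \<psi> "[]" z]
      by (auto simp: test_funs_def pderivs_def frechet_derivative_works)
    then have "((\<lambda>x. a * \<phi> x + b * \<psi> x) has_derivative (\<lambda>h. a * frechet_derivative \<phi> (at z) h + b * frechet_derivative \<psi> (at z) h)) (at z)"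
      by (intro has_derivative_add has_derivative_mult_right)
    then show ?thesis by (subst pderiv_at_eqI) (auto simp: pderiv_at_def)
  qed
  have int: "integrable lebesgue (\<lambda>z. w z * pderiv_at j \<theta> z)" if \<theta>: "\<theta> \<in> test_funs \<Omega>" for \<theta>
  proof -
    obtain B where "\<And>z. \<bar>pderiv_at j \<theta> z\<bar> \<le> B" using pderivs_bounded[OF \<theta>, of "[j]"] pderivs_singleton by metis
    then show ?thesis using pderivs_measurable[OF \<theta>, of "[j]"] by (intro integrable_mult_bounded[OF w]) (auto simp: pderivs_singleton)
  qed
  have z: "z \<notin> K \<union> L \<Longrightarrow> pderiv_at j \<phi> z = 0" "z \<notin> K \<union> L \<Longrightarrow> pderiv_at j \<psi> z = 0" for z
    using K(3)[of z "[j]"] L(3)[of z "[j]"] by (auto simp: pderivs_singleton)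
  have "regular_distr \<Omega> u (pderiv_at j (\<lambda>x. a * \<phi> x + b * \<psi> x)) = (\<integral>z. w z * (a * pderiv_at j \<phi> z + b * pderiv_at j \<psi> z) \<partial>lebesgue)"
    unfolding w_def by (subst regular_distr_eq[OF KL]) (use z in \<open>auto simp: d\<close>)
  also have "\<dots> = (\<integral>z. a * (w z * pderiv_at j \<phi> z) + b * (w z * pderiv_at j \<psi> z) \<partial>lebesgue)"
    by (simp add: algebra_simps)
  also have "\<dots> = a * (\<integral>z. w z * pderiv_at j \<phi> z \<partial>lebesgue) + b * (\<integral>z. w z * pderiv_at j \<psi> z \<partial>lebesgue)"
    using int[OF \<phi>] int[OF \<psi>] by simp
  also have "(\<integral>z. w z * pderiv_at j \<phi> z \<partial>lebesgue) = regular_distr \<Omega> u (pderiv_at j \<phi>)"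
    unfolding w_def by (subst regular_distr_eq[OF KL]) (use z in auto)
  also have "(\<integral>z. w z * pderiv_at j \<psi> z \<partial>lebesgue) = regular_distr \<Omega> u (pderiv_at j \<psi>)"
    unfolding w_def by (subst regular_distr_eq[OF KL]) (use z in auto)
  finally show "weak_deriv \<Omega> u j (\<lambda>x. a * \<phi> x + b * \<psi> x)
     = a * weak_deriv \<Omega> u j \<phi> + b * weak_deriv \<Omega> u j \<psi>"
    by (simp add: distr_deriv_def)
next
  fix K :: "(real^'n) set" assume K: "compact K" "K \<subseteq> \<Omega>"
  define w where "w z = indicator K z * u z" for z
  have w: "integrable lebesgue w" unfolding w_def by (rule locally_integrable_indicator[OF u K])
  define C where "C = (\<integral>z. \<bar>w z\<bar> \<partial>lebesgue)"
  have C: "C \<ge> 0" unfolding C_def by (intro integral_nonneg_AE) auto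
  show "\<exists>C m. \<forall>\<phi>\<in>test_funs \<Omega>. closure (support_on UNIV \<phi>) \<subseteq> K \<longrightarrow>
     \<bar>weak_deriv \<Omega> u j \<phi>\<bar> \<le> C * (\<Sum>js | length js \<le> m. SUP x. \<bar>pderivs js \<phi> x\<bar>)"
  proof (rule exI[of _ C], rule exI[of _ 1], intro ballI impI)
    fix \<phi> assume \<phi>: "\<phi> \<in> test_funs \<Omega>" and S: "closure (support_on UNIV \<phi>) \<subseteq> K"
    have bdd: "bdd_above (range (\<lambda>x. \<bar>pderivs js \<phi> x\<bar>))" for js
    proof -
      obtain B where "\<And>z. \<bar>pderivs js \<phi> z\<bar> \<le> B" using pderivs_bounded[OF \<phi>, of js] by metis
      then show ?thesis by (auto intro!: bdd_aboveI)
    qed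
    define A where "A = (SUP x. \<bar>pderivs [j] \<phi> x\<bar>)"
    have A: "\<bar>pderiv_at j \<phi> z\<bar> \<le> A" for z
      unfolding A_def pderivs_singleton[symmetric] by (rule cSUP_upper[OF UNIV_I bdd])
    have nn: "0 \<le> (SUP x. \<bar>pderivs js \<phi> x\<bar>)" for js
      using cSUP_upper[OF UNIV_I[of 0] bdd[of js]] by (meson abs_ge_zero order_trans)
    have K0: "z \<notin> K \<Longrightarrow> pderiv_at j \<phi> z = 0" for z
      using pderivs_outside_support[of z \<phi> "[j]"] S by (auto simp: pderivs_singleton)
    have dm: "pderiv_at j \<phi> \<in> borel_measurable lebesgue"
      using pderivs_measurable[OF \<phi>, of "[j]"] by (simp add: pderivs_singleton)
    have int: "integrable lebesgue (\<lambda>z. w z * pderiv_at j \<phi> z)" by (rule integrable_mult_bounded[OF w dm A])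
    have "\<bar>weak_deriv \<Omega> u j \<phi>\<bar> = \<bar>(\<integral>z. w z * pderiv_at j \<phi> z \<partial>lebesgue)\<bar>"
      unfolding distr_deriv_def w_def by (subst regular_distr_eq[OF K(2)]) (use K0 in auto)
    also have "\<dots> \<le> (\<integral>z. \<bar>w z * pderiv_at j \<phi> z\<bar> \<partial>lebesgue)"
      using integral_norm_bound[of lebesgue "\<lambda>z. w z * pderiv_at j \<phi> z"] by simp
    also have "\<dots> \<le> (\<integral>z. \<bar>w z\<bar> * A \<partial>lebesgue)"
    proof (rule integral_mono)
      show "\<bar>w z * pderiv_at j \<phi> z\<bar> \<le> \<bar>w z\<bar> * A" for z unfolding abs_mult by (intro mult_left_mono A) auto
    qed (use int w in auto)
    also have "\<dots> = C * A" by (simp add: C_def)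
    also have "\<dots> \<le> C * (\<Sum>js | length js \<le> 1. SUP x. \<bar>pderivs js \<phi> x\<bar>)"
    proof (intro mult_left_mono C)
      have fin: "finite {js :: 'n list. length js \<le> 1}" using finite_lists_length_le[of "UNIV :: 'n set" 1] by simp
      show "A \<le> (\<Sum>js | length js \<le> 1. SUP x. \<bar>pderivs js \<phi> x\<bar>)"
        unfolding A_def by (rule member_le_sum[OF _ _ fin]) (use nn in auto)
    qed
    finally show "\<bar>weak_deriv \<Omega> u j \<phi>\<bar> \<le> C * (\<Sum>js | length js \<le> 1. SUP x. \<bar>pderivs js \<phi> x\<bar>)" .
  qed
qed

section \<open>Chains in uniform domains\<close>

lemma ball_subset_of_le_bdist:
  fixes x :: "real^'n"
  assumes x: "x \<in> \<Omega>" and R: "ennreal R \<le> bdist \<Omega> x"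
  shows "ball x R \<subseteq> \<Omega>"
proof (rule ccontr)
  assume n: "\<not> ball x R \<subseteq> \<Omega>"
  then have "x \<in> ball x R" by (metis ball_empty centre_in_ball empty_subsetI not_le)
  then have "ball x R \<inter> \<Omega> \<noteq> {}" "ball x R - \<Omega> \<noteq> {}" using x n by blast+
  then have "ball x R \<inter> frontier \<Omega> \<noteq> {}" by (intro connected_Int_frontier connected_ball)
  then obtain y where y: "y \<in> frontier \<Omega>" "dist x y < R" by auto
  have "bdist \<Omega> x \<le> ennreal (dist x y)" unfolding bdist_def by (rule INF_lower[OF y(1)])
  then have "ennreal R \<le> ennreal (dist x y)" using R by (rule order_trans[rotated])
  then show False using y(2) by simp
qed

lemma le_bdist_of_ball_subset:
  assumes O: "open \<Omega>" and "ball x R \<subseteq> \<Omega>"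
  shows "ennreal R \<le> bdist \<Omega> x"
  unfolding bdist_def
proof (rule INF_greatest)
  fix y assume "y \<in> frontier \<Omega>"
  then have "y \<notin> \<Omega>" using O by (simp add: frontier_def interior_open)
  then have "y \<notin> ball x R" using assms(2) by blast
  then show "ennreal R \<le> ennreal (dist x y)" by (simp add: ennreal_leI)
qed

lemma ennreal_le_divide_numeralI:
  assumes "ennreal (numeral k * d) \<le> b"
  shows "ennreal d \<le> b / numeral k"
proof -
  have "ennreal d = ennreal (numeral k * d) / numeral k"
    by (cases "d \<ge> 0") (simp_all add: ennreal_divide_numeral ennreal_neg mult_nonneg_nonpos)
  also have "\<dots> \<le> b / numeral k" by (rule divide_right_mono_ennreal[OF assms])
  finally show ?thesis .
qed

lemma ennreal_le_divide_numeralD: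
  assumes "ennreal d \<le> b / numeral k" and d: "d \<ge> 0"
  shows "ennreal (numeral k * d) \<le> b"
proof -
  have "ennreal (numeral k * d) = numeral k * ennreal d" using d by (simp add: ennreal_mult)
  also have "\<dots> \<le> numeral k * (b / numeral k)" by (rule mult_left_mono[OF assms(1)]) simp
  also have "\<dots> = b" by (simp add: ennreal_times_divide mult.commute[of "numeral k"] mult_divide_eq_ennreal)
  finally show ?thesis .
qed

lemma ball_pairsI:
  assumes O: "open \<Omega>" and b: "ball x R \<subseteq> \<Omega>" "ball y R \<subseteq> \<Omega>" and d: "4 * dist x y \<le> R"
  shows "ball_pairs \<Omega> x y"
proof -
  have "ennreal (4 * dist x y) \<le> ennreal R" using d by (rule ennreal_leI)
  also have "\<dots> \<le> min (bdist \<Omega> x) (bdist \<Omega> y)" using b by (simp add: le_bdist_of_ball_subset[OF O])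
  finally show ?thesis unfolding ball_pairs_def by (rule ennreal_le_divide_numeralI)
qed

lemma ball_pairsD:
  assumes "ball_pairs \<Omega> x y"
  shows "ennreal (4 * dist x y) \<le> bdist \<Omega> x" "ennreal (4 * dist x y) \<le> bdist \<Omega> y"
  using ennreal_le_divide_numeralD[of "dist x y" "min (bdist \<Omega> x) (bdist \<Omega> y)"] assms
  by (auto simp: ball_pairs_def)

section \<open>Curves and points where the gradient is small\<close>

lemma arclength_path_dist_le:
  assumes \<gamma>: "arclength_path T \<gamma>" and st: "0 \<le> s" "s \<le> t" "t \<le> T"
  shows "dist (\<gamma> s) (\<gamma> t) \<le> t - s"
proof -
  have "ennreal (\<Sum>i<length [s, t] - 1. dist (\<gamma> ([s, t] ! i)) (\<gamma> ([s, t] ! Suc i))) \<le> arc_variation \<gamma> s t"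
    unfolding arc_variation_def by (rule SUP_upper) (use st in auto)
  also have "\<dots> = ennreal (t - s)" using \<gamma> st by (simp add: arclength_path_def)
  finally show ?thesis using st by simp
qed

text \<open>Chebyshev's inequality: at the stated level the superlevel set fills at most half of the
  ball, and removing the null set \<open>E\<close> does not change this.\<close>

lemma exists_small_value_in_ball:
  fixes G :: "'a::euclidean_space \<Rightarrow> real"
  defines "v \<equiv> unit_ball_vol (real DIM('a))"
  assumes G [measurable]: "G \<in> borel_measurable lebesgue" and nn: "\<And>x. 0 \<le> G x" and E: "negligible E"
    and \<rho>: "\<rho> > 0" and q: "q > 0"
    and I: "(\<integral>\<^sup>+y\<in>ball a \<rho>. ennreal (G y powr q) \<partial>lebesgue) \<le> ennreal I" "I \<ge> 0"
  shows "\<exists>z\<in>ball a \<rho> - E. G z \<le> (2 * I / (v * \<rho> ^ DIM('a))) powr (1 / q)"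
proof (rule ccontr)
  define A where "A = (2 * I / (v * \<rho> ^ DIM('a))) powr (1 / q)"
  assume "\<not> ?thesis"
  then have big: "A < G z" if "z \<in> ball a \<rho>" "z \<notin> E" for z using that by (auto simp: A_def not_le)
  have v: "v > 0" by (simp add: v_def)
  have [measurable]: "ball a \<rho> \<in> sets lebesgue" by simp
  show False
  proof (cases "I = 0")
    \<comment> \<open>The level is 0 here, where Chebyshev's inequality says nothing; instead
      \<open>G\<close> vanishes almost everywhere on the ball.\<close>
    case True
    then have "(\<integral>\<^sup>+y\<in>ball a \<rho>. ennreal (G y powr q) \<partial>lebesgue) = 0" using I by simp
    then have "AE y in lebesgue. ennreal (G y powr q) * indicator (ball a \<rho>) y = 0"
      by (subst (asm) nn_integral_0_iff_AE) auto
    then have "AE y in lebesgue. y \<notin> ball a \<rho>"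
      using AE_notin_negligible[OF E]
    proof eventually_elim
      case (elim y)
      have "G y > 0" if "y \<in> ball a \<rho>" using big[of y] elim that by (auto simp: A_def intro: le_less_trans[OF powr_ge_zero])
      then show ?case using elim by (auto split: split_indicator)
    qed
    then have "ball a \<rho> \<in> null_sets lebesgue" by (subst AE_iff_null_sets) auto
    then show False using open_not_negligible[of "ball a \<rho>"] \<rho> by (auto simp: negligible_iff_null_sets)
  next
    case False
    then have I0: "I > 0" using I by simp
    have A: "A > 0" using I0 v \<rho> by (simp add: A_def)
    have "{x \<in> space lebesgue. A < G x} \<in> sets lebesgue" by measurable
    then have "ball a \<rho> \<inter> {x. A < G x} \<in> sets lebesgue" by (intro sets.Int) auto
    moreover have "ball a \<rho> \<inter> {x. A < G x} = {x \<in> ball a \<rho>. A < G x}" by auto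
    ultimately have m: "{x \<in> ball a \<rho>. A < G x} \<in> sets lebesgue" by simp
    have E': "E \<in> null_sets lebesgue" using E by (simp add: negligible_iff_null_sets)
    have "emeasure lebesgue (ball a \<rho>) \<le> emeasure lebesgue ({x \<in> ball a \<rho>. A < G x} \<union> E)"
      using big m E' by (intro emeasure_mono) auto
    also have "\<dots> = emeasure lebesgue {x \<in> ball a \<rho>. A < G x}" using m E' by (rule emeasure_Un_null_set)
    also have "\<dots> \<le> ennreal (I * A powr - q)"
      using I q A by (intro emeasure_superlevel_powr_le G nn) auto
    also have "A powr - q = v * \<rho> ^ DIM('a) / (2 * I)"
    proof -
      have "A powr q = 2 * I / (v * \<rho> ^ DIM('a))" using q I0 v \<rho> by (simp add: A_def powr_powr)
      then show ?thesis using I0 by (simp add: powr_minus)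
    qed
    also have "I * (v * \<rho> ^ DIM('a) / (2 * I)) = v * \<rho> ^ DIM('a) / 2" using I0 by simp
    also have "ennreal (v * \<rho> ^ DIM('a) / 2) < ennreal (v * \<rho> ^ DIM('a))"
      using v \<rho> by (intro ennreal_lessI) auto
    also have "\<dots> = emeasure lebesgue (ball a \<rho>)"
      using emeasure_lebesgue_ball[of \<rho> a] \<rho> by (simp add: v_def)
    finally show False by simp
  qed
qed

text \<open>Consecutive points of the chain lie at parameters \<open>\<theta> t\<close> and \<open>t\<close> of the curve and so close together
  that the local inequality applies; the geometric series of the steps sums to a multiple of \<open>S\<close>. The
  chain stops as soon as its end point and \<open>x\<close> form an admissible pair.\<close>

lemma half_chain:
  fixes \<gamma> :: "real \<Rightarrow> real^'n" and u g :: "real^'n \<Rightarrow> real"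
  assumes O: "open \<Omega>" and c: "c \<ge> 1" and S: "S > 0" and A: "A \<ge> 0" and x: "x \<in> \<Omega> - E" and gx: "0 \<le> g x"
    and \<gamma>: "\<gamma> 0 = x" "\<And>s t. 0 \<le> s \<Longrightarrow> s \<le> t \<Longrightarrow> t \<le> S \<Longrightarrow> dist (\<gamma> s) (\<gamma> t) \<le> t - s"
    and b: "\<And>t. 0 < t \<Longrightarrow> t \<le> S \<Longrightarrow> ball (\<gamma> t) (t / c) \<subseteq> \<Omega>"
    and ug: "\<And>y z. y \<in> \<Omega> - E \<Longrightarrow> z \<in> \<Omega> - E \<Longrightarrow> ball_pairs \<Omega> y z \<Longrightarrow> \<bar>u y - u z\<bar> \<le> dist y z * (g y + g z)"
    and good: "\<And>t. 0 < t \<Longrightarrow> t \<le> S \<Longrightarrow> \<exists>z\<in>ball (\<gamma> t) (t / (16 * c)) - E. g z \<le> A"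
  shows "\<exists>z\<in>ball (\<gamma> S) (S / (16 * c)) - E. g z \<le> A \<and> \<bar>u x - u z\<bar> \<le> 6 * S * (g x + A)"
proof -
  \<comment> \<open>Consecutive parameters differ by t / (16 c), which is also the radius of the
    ball from which the chain point at \<open>t\<close> is taken.\<close>
  define \<theta> where "\<theta> = 1 - 1 / (16 * c)"
  have \<theta>: "15/16 \<le> \<theta>" "\<theta> < 1" using c by (auto simp: \<theta>_def field_simps)
  obtain R where R: "R > 0" "ball x R \<subseteq> \<Omega>" using O x open_contains_ball by blast
  have inner: "ball z (15/16 * (t / c)) \<subseteq> ball (\<gamma> t) (t / c)" if "z \<in> ball (\<gamma> t) (t / (16 * c))" for z t
  proof
    fix y assume "y \<in> ball z (15/16 * (t / c))"
    moreover have "t / (16 * c) = 1/16 * (t / c)" by simp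
    ultimately show "y \<in> ball (\<gamma> t) (t / c)" using that dist_triangle[of "\<gamma> t" y z] by (simp del: divide_divide_eq_right)
  qed
  \<comment> \<open>The bound on \<theta>^k t guarantees that after \<open>k\<close> steps the
    parameter is at most R / 16. Then dist x z \<le> 2 t, and four times this is at most R / 2, the
    room left around \<open>z\<close>.\<close>
  have chain: "\<bar>u x - u z\<bar> \<le> 6 * t * (g x + A)"
    if "\<theta> ^ k * t \<le> R / 16" "0 < t" "t \<le> S" "z \<in> ball (\<gamma> t) (t / (16 * c)) - E" "g z \<le> A" for k t z
    using that
  proof (induction k arbitrary: t z)
    case 0
    have "t / (16 * c) \<le> t" using 0 c by (simp add: field_simps)
    moreover have "dist x (\<gamma> t) \<le> t" using \<gamma>(2)[of 0 t] 0 by (simp add: \<gamma>(1))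
    ultimately have xz: "dist x z \<le> 2 * t" using 0(4) dist_triangle[of x z "\<gamma> t"] by simp
    have "ball z (R / 2) \<subseteq> ball x R"
    proof
      fix y assume "y \<in> ball z (R / 2)"
      then show "y \<in> ball x R" using xz 0(1) dist_triangle[of x y z] R(1) by simp
    qed
    then have bz: "ball z (R / 2) \<subseteq> \<Omega>" using R(2) by blast
    have "ball_pairs \<Omega> x z"
      by (rule ball_pairsI[OF O _ bz]) (use R xz 0 in auto)
    moreover have "z \<in> \<Omega> - E" using bz R(1) 0(4) by auto
    ultimately have "\<bar>u x - u z\<bar> \<le> dist x z * (g x + g z)" using ug x by blast
    also have "\<dots> \<le> dist x z * (g x + A)" using 0 by (intro mult_left_mono) auto
    also have "\<dots> \<le> (6 * t) * (g x + A)" using xz gx A 0 by (intro mult_right_mono) auto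
    finally show ?case .
  next
    case (Suc k)
    define b' where "b' = t / c"
    have t: "0 < \<theta> * t" "\<theta> * t \<le> t" using Suc.prems \<theta> by (auto simp: mult_le_cancel_right1)
    have b0: "b' > 0" using Suc.prems c by (simp add: b'_def)
    have \<theta>t: "\<theta> * t = t - b' / 16" by (simp add: \<theta>_def b'_def algebra_simps)
    have \<theta>b: "\<theta> * t / c = \<theta> * b'" by (simp add: b'_def)
    have \<theta>b': "\<theta> * b' \<ge> 15/16 * b'" "\<theta> * b' \<le> b'" using \<theta> b0 by (auto simp: mult_le_cancel_right1)
    have tS: "\<theta> * t \<le> S" using t Suc.prems by linarith
    obtain y where y: "y \<in> ball (\<gamma> (\<theta> * t)) (\<theta> * t / (16 * c)) - E" "g y \<le> A" using good[OF t(1) tS] by auto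
    have IH: "\<bar>u x - u y\<bar> \<le> 6 * (\<theta> * t) * (g x + A)"
      using Suc.IH[of "\<theta> * t" y] Suc.prems y t tS by (simp add: mult_ac)
    have dz: "dist (\<gamma> t) z < b' / 16" using Suc.prems(4) by (simp add: b'_def)
    have dy: "dist (\<gamma> (\<theta> * t)) y < \<theta> * b' / 16" using y by (simp add: b'_def)
    have dg: "dist (\<gamma> (\<theta> * t)) (\<gamma> t) \<le> b' / 16" using \<gamma>(2)[of "\<theta> * t" t] t Suc.prems \<theta>t by simp
    have zy: "dist z y \<le> 3/16 * b'"
      using dz dy dg \<theta>b' dist_triangle[of z y "\<gamma> t"] dist_triangle[of "\<gamma> t" y "\<gamma> (\<theta> * t)"]
      by (simp add: dist_commute)
    have bz: "ball z (15/16 * b') \<subseteq> \<Omega>"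
      using inner[of z t] Suc.prems(4) b[OF Suc.prems(2,3)] unfolding b'_def by blast
    have by': "ball y (15/16 * (\<theta> * b')) \<subseteq> \<Omega>"
      using inner[of y "\<theta> * t"] y b[OF t(1) tS] unfolding \<theta>b by blast
    have "ball z (15/16 * (\<theta> * b')) \<subseteq> ball z (15/16 * b')" using \<theta>b' by (intro subset_ball) auto
    then have bz': "ball z (15/16 * (\<theta> * b')) \<subseteq> \<Omega>" using bz by (rule subset_trans)
    \<comment> \<open>The numbers fit: 4 times 3/16 is 3/4, while \<theta> \<ge> 15/16 leaves at
      least (15/16)^2 on the right.\<close>
    have "4 * dist z y \<le> 15/16 * (\<theta> * b')" using zy \<theta>b' b0 by linarith
    then have "ball_pairs \<Omega> z y" by (rule ball_pairsI[OF O bz' by'])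
    moreover have "z \<in> \<Omega> - E" "y \<in> \<Omega> - E"
      using bz by' b0 \<theta> Suc.prems(4) y by (auto simp: subset_iff)
    ultimately have "\<bar>u z - u y\<bar> \<le> dist z y * (g z + g y)" using ug by blast
    also have "\<dots> \<le> dist z y * (A + A)" using Suc.prems y by (intro mult_left_mono add_mono) auto
    also have "\<dots> \<le> 3/16 * b' * (A + A)" using zy A by (intro mult_right_mono) auto
    finally have "\<bar>u x - u z\<bar> \<le> 6 * (\<theta> * t) * (g x + A) + 3/16 * b' * (A + A)" using IH by linarith
    \<comment> \<open>Origin of the constant 6: shrinking the parameter by b' / 16 saves 6/16 b' (g
      x + A), which covers the cost 3/16 b' (A + A) of the step.\<close>
    also have "\<dots> = 6 * t * (g x + A) - 3/8 * b' * g x" unfolding \<theta>t by (simp add: algebra_simps)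
    also have "\<dots> \<le> 6 * t * (g x + A)" using b0 gx by simp
    finally show ?case .
  qed
  obtain z where z: "z \<in> ball (\<gamma> S) (S / (16 * c)) - E" "g z \<le> A" using good[of S] S by auto
  obtain k where "\<theta> ^ k < R / 16 / S"
    using real_arch_pow_inv[of "R / 16 / S" \<theta>] \<theta> R S by auto
  then have "\<theta> ^ k * S \<le> R / 16" using S by (simp add: field_simps)
  then have "\<bar>u x - u z\<bar> \<le> 6 * S * (g x + A)" using chain[of k S z] S z by auto
  then show ?thesis using z by blast
qed

text \<open>The curve is cut at its midpoint. On each half the distance to the nearer end is the
  parameter measured from that end, so the half chain applies to both, the second curve being
  reversed. Their last points lie close to the midpoint and form an admissible pair
  themselves.\<close>

theorem uniform_domain_chain:
  fixes \<Omega> :: "(real^'n) set"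
  assumes U: "uniform_domain \<Omega>" and q: "q > 0"
  shows "\<exists>C>0. \<forall>u g E. g \<in> borel_measurable lebesgue \<longrightarrow> (\<forall>x. 0 \<le> g x) \<longrightarrow> negligible E \<longrightarrow>
    (\<forall>y\<in>\<Omega> - E. \<forall>z\<in>\<Omega> - E. ball_pairs \<Omega> y z \<longrightarrow> \<bar>u y - u z\<bar> \<le> dist y z * (g y + g z)) \<longrightarrow>
    (\<forall>x\<in>\<Omega> - E. \<forall>y\<in>\<Omega> - E. \<forall>m m'. 0 \<le> m \<longrightarrow> 0 \<le> m' \<longrightarrow> maxf (\<lambda>x. ennreal (g x powr q)) x \<le> ennreal m \<longrightarrow>
       maxf (\<lambda>x. ennreal (g x powr q)) y \<le> ennreal m' \<longrightarrow>
       \<bar>u x - u y\<bar> \<le> dist x y * (C * (g x + m powr (1 / q)) + C * (g y + m' powr (1 / q))))"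
proof -
  obtain c0 where c0: "c0 > 0" and path: "\<And>x y. x \<in> \<Omega> \<Longrightarrow> y \<in> \<Omega> \<Longrightarrow> \<exists>T \<gamma>.
        arclength_path T \<gamma> \<and> \<gamma> ` {0..T} \<subseteq> \<Omega> \<and> \<gamma> 0 = x \<and> \<gamma> T = y \<and>
        T \<le> c0 * dist x y \<and> (\<forall>t\<in>{0<..<T}. ball (\<gamma> t) (1 / c0 * min t (T - t)) \<subseteq> \<Omega>)"
    and O: "open \<Omega>"
    using U unfolding uniform_domain_def domain_def by blast
  define c where "c = max c0 1"
  have c: "c \<ge> 1" "c \<ge> c0" by (auto simp: c_def)
  define v where "v = unit_ball_vol (real CARD('n))"
  have v: "v > 0" by (simp add: v_def)
  \<comment> \<open>A ball of radius t / (16 c) about the curve point lies in the ball of radius 2 t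
    about the end point; the ratio of radii is 32 c. The factor 2 is that of the small value
    lemma.\<close>
  define K where "K = (2 * (32 * c) ^ CARD('n) / v) powr (1 / q)"
  have K: "K > 0" using c v by (simp add: K_def)
  define C where "C = 4 * c * (K + 1)"
  have C: "C > 0" using c K by (simp add: C_def)
  show ?thesis
  proof (rule exI[of _ C], intro conjI allI impI ballI C)
    fix u g :: "real^'n \<Rightarrow> real" and E x y m m'
    assume g: "g \<in> borel_measurable lebesgue" and nn: "\<forall>x. 0 \<le> g x" and E: "negligible E"
      and ug: "\<forall>y\<in>\<Omega> - E. \<forall>z\<in>\<Omega> - E. ball_pairs \<Omega> y z \<longrightarrow> \<bar>u y - u z\<bar> \<le> dist y z * (g y + g z)"
      and x: "x \<in> \<Omega> - E" and y: "y \<in> \<Omega> - E" and m: "0 \<le> m" "0 \<le> m'" and M: "maxf (\<lambda>x. ennreal (g x powr q)) x \<le> ennreal m"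
       "maxf (\<lambda>x. ennreal (g x powr q)) y \<le> ennreal m'"
    have good: "\<exists>z\<in>ball (\<gamma> t) (t / (16 * c)) - E. g z \<le> K * \<mu> powr (1 / q)"
      if M: "maxf (\<lambda>x. ennreal (g x powr q)) a \<le> ennreal \<mu>" and "0 \<le> \<mu>" and t: "0 < t" and d: "dist a (\<gamma> t) \<le> t"
      for \<gamma> :: "real \<Rightarrow> real^'n" and t a \<mu>
    proof -
      let ?f = "\<lambda>x. ennreal (g x powr q)"
      have ts: "t / (16 * c) \<le> t" using t c by (simp add: field_simps)
      have sub: "ball (\<gamma> t) (t / (16 * c)) \<subseteq> ball a (2 * t)"
      proof
        fix z assume "z \<in> ball (\<gamma> t) (t / (16 * c))"
        then show "z \<in> ball a (2 * t)" using ts d dist_triangle[of a z "\<gamma> t"] by simp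
      qed
      have "(\<integral>\<^sup>+y\<in>ball (\<gamma> t) (t / (16 * c)). ?f y \<partial>lebesgue) \<le> (\<integral>\<^sup>+y\<in>ball a (2 * t). ?f y \<partial>lebesgue)"
        using sub by (intro nn_integral_mono) (auto split: split_indicator)
      also have "\<dots> \<le> ennreal ((2 * t) ^ DIM(real^'n)) * maxf ?f a" using t by (intro nn_integral_ball_le_maxf) auto
      also have "\<dots> \<le> ennreal ((2 * t) ^ DIM(real^'n)) * ennreal \<mu>" by (rule mult_left_mono[OF M]) simp
      also have "\<dots> = ennreal ((2 * t) ^ CARD('n) * \<mu>)" using t \<open>0 \<le> \<mu>\<close> by (simp add: ennreal_mult[symmetric])
      finally have "\<exists>z\<in>ball (\<gamma> t) (t / (16 * c)) - E. g z \<le> (2 * ((2 * t) ^ CARD('n) * \<mu>) / (unit_ball_vol (real DIM(real^'n)) * (t / (16 * c)) ^ DIM(real^'n))) powr (1 / q)"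
        using g nn E t c q \<open>0 \<le> \<mu>\<close> by (intro exists_small_value_in_ball) auto
      moreover have "2 * ((2 * t) ^ CARD('n) * \<mu>) / (unit_ball_vol (real DIM(real^'n)) * (t / (16 * c)) ^ DIM(real^'n)) = 2 * (32 * c) ^ CARD('n) / v * \<mu>"
      proof -
        have "2 * t = 32 * c * (t / (16 * c))" using c by simp
        then have "(2 * t) ^ CARD('n) = (32 * c) ^ CARD('n) * (t / (16 * c)) ^ CARD('n)"
          by (metis power_mult_distrib)
        then show ?thesis using t c v by (simp add: v_def)
      qed
      ultimately have "\<exists>z\<in>ball (\<gamma> t) (t / (16 * c)) - E. g z \<le> (2 * (32 * c) ^ CARD('n) / v * \<mu>) powr (1 / q)"
        by (simp only:)
      then show ?thesis unfolding K_def powr_mult .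
    qed
    show "\<bar>u x - u y\<bar> \<le> dist x y * (C * (g x + m powr (1 / q)) + C * (g y + m' powr (1 / q)))"
    proof (cases "x = y")
      case False
      obtain T \<gamma> where \<gamma>: "arclength_path T \<gamma>" "\<gamma> 0 = x" "\<gamma> T = y" "T \<le> c0 * dist x y"
        and b: "\<And>t. t \<in> {0<..<T} \<Longrightarrow> ball (\<gamma> t) (1 / c0 * min t (T - t)) \<subseteq> \<Omega>"
        using path[of x y] x y by blast
      have T0: "T \<ge> 0" using \<gamma>(1) by (simp add: arclength_path_def)
      have "dist x y \<le> T" using arclength_path_dist_le[OF \<gamma>(1), of 0 T] T0 \<gamma> by simp
      then have T: "T > 0" using False zero_less_dist_iff[of x y] by linarith
      define S where "S = T / 2"
      have S: "S > 0" using T by (simp add: S_def)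
      have bb: "ball (\<gamma> t) (s / c) \<subseteq> \<Omega>" if "t \<in> {0<..<T}" "0 < s" "s = min t (T - t)" for s t
      proof -
        have "s / c \<le> s / c0" using that c c0 by (intro divide_left_mono) auto
        then have "ball (\<gamma> t) (s / c) \<subseteq> ball (\<gamma> t) (1 / c0 * min t (T - t))" using that(3) by (intro subset_ball) simp
        then show ?thesis using b[OF that(1)] by blast
      qed
      have d1: "dist (\<gamma> s) (\<gamma> t) \<le> t - s" if "0 \<le> s" "s \<le> t" "t \<le> S" for s t
        using arclength_path_dist_le[OF \<gamma>(1) that(1,2)] that S by (simp add: S_def)
      define \<beta> where "\<beta> t = \<gamma> (T - t)" for t
      have d2: "dist (\<beta> s) (\<beta> t) \<le> t - s" if "0 \<le> s" "s \<le> t" "t \<le> S" for s t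
        using arclength_path_dist_le[OF \<gamma>(1), of "T - t" "T - s"] that S by (simp add: S_def \<beta>_def dist_commute)
      define A1 where "A1 = K * m powr (1 / q)"
      define A2 where "A2 = K * m' powr (1 / q)"
      have A: "A1 \<ge> 0" "A2 \<ge> 0" using K by (auto simp: A1_def A2_def)
      have "\<exists>z\<in>ball (\<gamma> S) (S / (16 * c)) - E. g z \<le> A1 \<and> \<bar>u x - u z\<bar> \<le> 6 * S * (g x + A1)"
      proof (rule half_chain[OF O c(1) S A(1) x _ \<gamma>(2) d1])
        show "ball (\<gamma> t) (t / c) \<subseteq> \<Omega>" if "0 < t" "t \<le> S" for t
          using that T by (intro bb) (auto simp: S_def)
        show "\<exists>z\<in>ball (\<gamma> t) (t / (16 * c)) - E. g z \<le> A1" if "0 < t" "t \<le> S" for t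
          unfolding A1_def using d1[of 0 t] that by (intro good[OF M(1) m(1)]) (auto simp: \<gamma>(2))
      qed (use nn ug in auto)
      then obtain z1 where z1: "z1 \<in> ball (\<gamma> S) (S / (16 * c))" "z1 \<notin> E" "g z1 \<le> A1" "\<bar>u x - u z1\<bar> \<le> 6 * S * (g x + A1)" by auto
      have "\<exists>z\<in>ball (\<beta> S) (S / (16 * c)) - E. g z \<le> A2 \<and> \<bar>u y - u z\<bar> \<le> 6 * S * (g y + A2)"
      proof (rule half_chain[OF O c(1) S A(2) y _ _ d2])
        show "ball (\<beta> t) (t / c) \<subseteq> \<Omega>" if "0 < t" "t \<le> S" for t
          unfolding \<beta>_def using that T by (intro bb) (auto simp: S_def)
        show "\<exists>z\<in>ball (\<beta> t) (t / (16 * c)) - E. g z \<le> A2" if "0 < t" "t \<le> S" for t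
          unfolding A2_def using d2[of 0 t] that by (intro good[OF M(2) m(2)]) (auto simp: \<beta>_def \<gamma>(3))
      qed (use nn ug \<gamma>(3) in \<open>auto simp: \<beta>_def\<close>)
      moreover have "\<beta> S = \<gamma> S" by (simp add: \<beta>_def S_def)
      ultimately obtain z2 where z2: "z2 \<in> ball (\<gamma> S) (S / (16 * c))" "z2 \<notin> E" "g z2 \<le> A2" "\<bar>u y - u z2\<bar> \<le> 6 * S * (g y + A2)" by auto
      define e where "e = S / c"
      have e: "e > 0" "e \<le> S" using S c by (auto simp: e_def field_simps)
      have zz: "dist (\<gamma> S) z1 < e / 16" "dist (\<gamma> S) z2 < e / 16" using z1 z2 by (auto simp: e_def)
      have bS: "ball (\<gamma> S) e \<subseteq> \<Omega>" unfolding e_def using S T by (intro bb) (auto simp: S_def)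
      have bz: "ball z (15/16 * e) \<subseteq> \<Omega>" if "dist (\<gamma> S) z < e / 16" for z
      proof
        fix w assume "w \<in> ball z (15/16 * e)"
        then have "w \<in> ball (\<gamma> S) e" using that dist_triangle[of "\<gamma> S" w z] by simp
        then show "w \<in> \<Omega>" using bS by blast
      qed
      \<comment> \<open>Both points are within e / 16 of the midpoint, so four times their distance
        is at most e / 2, below the radius 15/16 e of the balls around them.\<close>
      have d12: "dist z1 z2 \<le> e / 8" using zz dist_triangle[of z1 z2 "\<gamma> S"] by (simp add: dist_commute)
      then have "ball_pairs \<Omega> z1 z2" using bz zz e by (intro ball_pairsI[OF O, of _ "15/16 * e"]) auto
      moreover have "z1 \<in> \<Omega> - E" "z2 \<in> \<Omega> - E" using z1 z2 bz zz e by (auto simp: subset_iff)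
      ultimately have "\<bar>u z1 - u z2\<bar> \<le> dist z1 z2 * (g z1 + g z2)" using ug by blast
      also have "\<dots> \<le> S * (A1 + A2)" using d12 e z1 z2 nn by (intro mult_mono add_mono) auto
      finally have "\<bar>u x - u y\<bar> \<le> 6 * S * (g x + A1) + S * (A1 + A2) + 6 * S * (g y + A2)" using z1 z2 by linarith
      also have "\<dots> = S * (6 * g x + 7 * A1 + (6 * g y + 7 * A2))" by (simp add: algebra_simps)
      also have "\<dots> \<le> S * (8 * ((K + 1) * (g x + m powr (1 / q))) + 8 * ((K + 1) * (g y + m' powr (1 / q))))"
      proof (intro mult_left_mono add_mono)
        show "6 * g x + 7 * A1 \<le> 8 * ((K + 1) * (g x + m powr (1 / q)))"
        proof -
          have "0 \<le> K * g x" "0 \<le> g x" "0 \<le> m powr (1 / q)" using K nn by auto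
          then show ?thesis using A unfolding A1_def by (simp add: algebra_simps)
        qed
        show "6 * g y + 7 * A2 \<le> 8 * ((K + 1) * (g y + m' powr (1 / q)))"
        proof -
          have "0 \<le> K * g y" "0 \<le> g y" "0 \<le> m' powr (1 / q)" using K nn by auto
          then show ?thesis using A unfolding A2_def by (simp add: algebra_simps)
        qed
      qed (use S in auto)
      also have "\<dots> \<le> (c / 2 * dist x y) * (8 * ((K + 1) * (g x + m powr (1 / q))) + 8 * ((K + 1) * (g y + m' powr (1 / q))))"
      proof (rule mult_right_mono)
        have "c0 * dist x y \<le> c * dist x y" using c by (intro mult_right_mono) auto
        then show "S \<le> c / 2 * dist x y" using \<gamma>(4) by (simp add: S_def)
      qed (use K nn in auto)
      also have "\<dots> = dist x y * (C * (g x + m powr (1 / q)) + C * (g y + m' powr (1 / q)))"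
        by (simp add: C_def algebra_simps)
      finally show ?thesis .
    qed simp
  qed
qed

section \<open>Quasinorms and comparison of the spaces\<close>

lemma epowr_ennreal: "x \<ge> 0 \<Longrightarrow> epowr (ennreal x) a = ennreal (x powr a)"
  by (simp add: epowr_def)

lemma epowr_top [simp]: "epowr \<infinity> a = \<infinity>" "epowr top a = top"
  by (simp_all add: epowr_def)

lemma epowr_mono:
  assumes "x \<le> y" "a \<ge> 0"
  shows "epowr x a \<le> epowr y a"
proof (cases y)
  case (real r)
  then obtain s where s: "x = ennreal s" "0 \<le> s" using assms(1) by (cases x) (auto simp: top_unique)
  then have "s powr a \<le> r powr a" using assms real by (intro powr_mono2) auto
  then show ?thesis using s real by (simp add: epowr_ennreal ennreal_leI)
qed simp

lemma epowr_cmult: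
  assumes "c > 0"
  shows "epowr (ennreal c * x) a = ennreal (c powr a) * epowr x a"
proof (cases x)
  case (real r)
  then show ?thesis using assms by (simp add: ennreal_mult[symmetric] epowr_ennreal powr_mult)
next
  case top
  then show ?thesis using assms by (simp add: ennreal_mult_top)
qed

lemma epowr_epowr: "epowr (epowr x a) b = epowr x (a * b)"
  by (cases x) (simp_all add: epowr_ennreal powr_powr)

lemma epowr_one: "epowr x 1 = x"
  by (cases x) (simp_all add: epowr_ennreal)

lemma epowr_less_top: "epowr x a < top \<longleftrightarrow> x < top"
  by (cases x) (simp_all add: epowr_ennreal)

lemma borel_measurable_epowr [measurable]: "(\<lambda>x. epowr x a) \<in> borel_measurable borel"
  unfolding epowr_def by measurable

text \<open>Bounding the sum by its number of terms times the largest one works for every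
  nonnegative exponent, without distinguishing convex from concave powers.\<close>

lemma epowr_sum_le:
  fixes F :: "'b \<Rightarrow> ennreal"
  assumes A: "finite A" "A \<noteq> {}" and a: "a \<ge> 0"
  shows "epowr (\<Sum>j\<in>A. F j) a \<le> ennreal (real (card A) powr a) * (\<Sum>j\<in>A. epowr (F j) a)"
proof -
  have "Max (F ` A) \<in> F ` A" using A by simp
  then obtain k where k: "k \<in> A" "F k = Max (F ` A)" by auto
  have "(\<Sum>j\<in>A. F j) \<le> (\<Sum>j\<in>A. F k)" using A k by (intro sum_mono) simp
  also have "\<dots> = ennreal (real (card A)) * F k" by (simp add: ennreal_of_nat_eq_real_of_nat)
  finally have "epowr (\<Sum>j\<in>A. F j) a \<le> epowr (ennreal (real (card A)) * F k) a" using a by (rule epowr_mono)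
  also have "\<dots> = ennreal (real (card A) powr a) * epowr (F k) a"
    using A by (intro epowr_cmult) (simp add: card_gt_0_iff)
  also have "\<dots> \<le> ennreal (real (card A) powr a) * (\<Sum>j\<in>A. epowr (F j) a)"
    using A k by (intro mult_left_mono member_le_sum) auto
  finally show ?thesis .
qed

lemma epowr_add_le:
  assumes "a \<ge> 0"
  shows "epowr (x + y) a \<le> ennreal (2 powr a) * (epowr x a + epowr y a)"
  using epowr_sum_le[of "UNIV :: bool set" a "\<lambda>b. if b then x else y"] assms by (simp add: UNIV_bool add.commute)

lemma eLp_norm_le:
  assumes p: "p > 0" and K: "K > 0"
    and le: "(\<integral>\<^sup>+x. epowr (F x) p \<partial>lebesgue_on \<Omega>) \<le> ennreal K * (\<integral>\<^sup>+x. epowr (H x) p \<partial>lebesgue_on \<Omega>)"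
  shows "eLp_norm p \<Omega> F \<le> ennreal (K powr (1 / p)) * eLp_norm p \<Omega> H"
proof -
  have "eLp_norm p \<Omega> F \<le> epowr (ennreal K * (\<integral>\<^sup>+x. epowr (H x) p \<partial>lebesgue_on \<Omega>)) (1 / p)"
    unfolding eLp_norm_def using p by (intro epowr_mono le) auto
  then show ?thesis unfolding eLp_norm_def epowr_cmult[OF K] .
qed

lemma epowr_eLp_norm:
  assumes p: "p > 0"
  shows "epowr (eLp_norm p \<Omega> F) p = (\<integral>\<^sup>+x. epowr (F x) p \<partial>lebesgue_on \<Omega>)"
  using p by (simp add: eLp_norm_def epowr_epowr epowr_one)

lemma eLp_norm_mono:
  assumes "p > 0" "\<And>x. x \<in> \<Omega> \<Longrightarrow> F x \<le> H x"
  shows "eLp_norm p \<Omega> F \<le> eLp_norm p \<Omega> H"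
  unfolding eLp_norm_def using assms
  by (intro epowr_mono nn_integral_mono) auto

text \<open>Maximal functions live on the whole space, while \<open>g\<close> is given on \<Omega>
  only. Taking the absolute value preserves the gradient inequality and makes powers
  meaningful.\<close>

definition zero_ext :: "'a set \<Rightarrow> ('a \<Rightarrow> real) \<Rightarrow> 'a \<Rightarrow> real" where
  "zero_ext \<Omega> g x = indicator \<Omega> x * \<bar>g x\<bar>"

lemma zero_ext_nonneg: "0 \<le> zero_ext \<Omega> g x"
  by (simp add: zero_ext_def)

lemma zero_ext_eq: "x \<in> \<Omega> \<Longrightarrow> zero_ext \<Omega> g x = \<bar>g x\<bar>"
  by (simp add: zero_ext_def)

lemma zero_ext_measurable:
  assumes "open \<Omega>" "g \<in> borel_measurable (lebesgue_on \<Omega>)"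
  shows "zero_ext \<Omega> g \<in> borel_measurable lebesgue"
proof -
  have "(\<lambda>x. indicator \<Omega> x *\<^sub>R g x) \<in> borel_measurable lebesgue"
    using assms by (subst borel_measurable_restrict_space_iff[symmetric]) auto
  then have "(\<lambda>x. \<bar>indicator \<Omega> x *\<^sub>R g x\<bar>) \<in> borel_measurable lebesgue" by measurable
  moreover have "zero_ext \<Omega> g = (\<lambda>x. \<bar>indicator \<Omega> x *\<^sub>R g x\<bar>)"
    by (auto simp: zero_ext_def fun_eq_iff split: split_indicator)
  ultimately show ?thesis by simp
qed

lemma nn_integral_zero_ext:
  assumes "open \<Omega>"
  shows "(\<integral>\<^sup>+x. ennreal (zero_ext \<Omega> g x powr p) \<partial>lebesgue) = (\<integral>\<^sup>+x. epowr (ennreal \<bar>g x\<bar>) p \<partial>lebesgue_on \<Omega>)"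
  using assms by (subst nn_integral_restrict_space)
    (auto intro!: nn_integral_cong simp: zero_ext_def epowr_ennreal split: split_indicator)

text \<open>The maximal function M(g^q)^(1/q). For 0 < q < p it is bounded on L^p even if p \<le> 1,
  since the strong type bound is applied to g^q with the exponent p / q > 1.\<close>

definition max_grad :: "real \<Rightarrow> 'a set \<Rightarrow> ('a \<Rightarrow> real) \<Rightarrow> 'a::euclidean_space \<Rightarrow> ennreal" where
  "max_grad q \<Omega> g x = epowr (maxf (\<lambda>y. ennreal (zero_ext \<Omega> g y powr q)) x) (1 / q)"

lemma max_grad_measurable: "max_grad q \<Omega> g \<in> borel_measurable (lebesgue_on S)"
proof -
  have "max_grad q \<Omega> g \<in> borel_measurable borel" unfolding max_grad_def by measurable
  then show ?thesis by (intro measurable_restrict_space1 measurable_lebesgueI)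
qed

lemma max_grad_modular:
  assumes q: "0 < q" "q < p"
  shows "\<exists>C>0. \<forall>(\<Omega>::'a::euclidean_space set) g. open \<Omega> \<longrightarrow> g \<in> borel_measurable (lebesgue_on \<Omega>) \<longrightarrow>
    (\<integral>\<^sup>+x. epowr (max_grad q \<Omega> g x) p \<partial>lebesgue_on \<Omega>) \<le> ennreal C * (\<integral>\<^sup>+x. epowr (ennreal \<bar>g x\<bar>) p \<partial>lebesgue_on \<Omega>)"
proof -
  define s where "s = p / q"
  have s: "s > 1" using q by (simp add: s_def)
  define C where "C = s * (2 * 5 ^ DIM('a) * unit_ball_vol (real DIM('a))) *
         (2 * unit_ball_vol (real DIM('a))) powr (s - 1) / (s - 1)"
  define v where "v = unit_ball_vol (real DIM('a))"
  have "v > 0" by (simp add: v_def)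
  then have C: "C > 0" unfolding C_def v_def[symmetric] using s by simp
  show ?thesis
  proof (rule exI[of _ C], intro conjI allI impI C)
    fix \<Omega> :: "'a set" and g :: "'a \<Rightarrow> real" assume O: "open \<Omega>" and g: "g \<in> borel_measurable (lebesgue_on \<Omega>)"
    let ?f = "\<lambda>y. zero_ext \<Omega> g y powr q"
    have f: "?f \<in> borel_measurable lebesgue" using zero_ext_measurable[OF O g] by measurable
    have "(\<integral>\<^sup>+x. epowr (max_grad q \<Omega> g x) p \<partial>lebesgue_on \<Omega>) = (\<integral>\<^sup>+x. epowr (maxf (\<lambda>y. ennreal (?f y)) x) s * indicator \<Omega> x \<partial>lebesgue)"
      using O by (subst nn_integral_restrict_space) (auto simp: max_grad_def epowr_epowr s_def)
    also have "\<dots> \<le> (\<integral>\<^sup>+x. epowr (maxf (\<lambda>y. ennreal (?f y)) x) s \<partial>lebesgue)"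
      by (intro nn_integral_mono) (auto split: split_indicator)
    also have "\<dots> \<le> ennreal C * (\<integral>\<^sup>+x. ennreal (?f x powr s) \<partial>lebesgue)"
      unfolding C_def by (rule maxf_strong_type[OF f _ s]) simp
    also have "(\<integral>\<^sup>+x. ennreal (?f x powr s) \<partial>lebesgue) = (\<integral>\<^sup>+x. ennreal (zero_ext \<Omega> g x powr p) \<partial>lebesgue)"
      using q by (simp add: powr_powr s_def)
    also have "\<dots> = (\<integral>\<^sup>+x. epowr (ennreal \<bar>g x\<bar>) p \<partial>lebesgue_on \<Omega>)" by (rule nn_integral_zero_ext[OF O])
    finally show "(\<integral>\<^sup>+x. epowr (max_grad q \<Omega> g x) p \<partial>lebesgue_on \<Omega>) \<le> ennreal C * (\<integral>\<^sup>+x. epowr (ennreal \<bar>g x\<bar>) p \<partial>lebesgue_on \<Omega>)" .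
  qed
qed

section \<open>Finiteness almost everywhere\<close>

lemma Lp_norm_modular_finite:
  assumes "p > 0" "g \<in> Lp p \<Omega>"
  shows "(\<integral>\<^sup>+x. epowr (ennreal \<bar>g x\<bar>) p \<partial>lebesgue_on \<Omega>) < top"
  using assms epowr_less_top[of "eLp_norm p \<Omega> (\<lambda>x. ennreal \<bar>g x\<bar>)" p]
  by (simp add: Lp_def Lp_norm_def epowr_eLp_norm less_top[symmetric])

lemma negligible_of_AE_lebesgue_on:
  assumes O: "open \<Omega>" and ae: "AE x in lebesgue_on \<Omega>. P x"
  shows "negligible {x \<in> \<Omega>. \<not> P x}"
proof -
  have "AE x in lebesgue. x \<in> \<Omega> \<longrightarrow> P x" using ae O by (subst (asm) AE_restrict_space_iff) auto
  then have "{x. \<not> (x \<in> \<Omega> \<longrightarrow> P x)} \<in> null_sets lebesgue"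
    by (subst (asm) completion.AE_iff_null_sets) auto
  then show ?thesis by (simp add: negligible_iff_null_sets Collect_conj_eq)
qed

lemma negligible_infinite:
  assumes O: "open \<Omega>" and F [measurable]: "F \<in> borel_measurable (lebesgue_on \<Omega>)"
    and fin: "(\<integral>\<^sup>+x. epowr (F x) p \<partial>lebesgue_on \<Omega>) \<noteq> top"
  shows "negligible {x \<in> \<Omega>. F x = top}"
proof -
  have "AE x in lebesgue_on \<Omega>. epowr (F x) p \<noteq> \<infinity>"
    using fin by (intro nn_integral_PInf_AE) auto
  then have "AE x in lebesgue_on \<Omega>. F x \<noteq> top" by eventually_elim auto
  then show ?thesis using negligible_of_AE_lebesgue_on[OF O, of "\<lambda>x. F x \<noteq> top"] by simp
qed

theorem gradients_ball_to_global:
  fixes \<Omega> :: "(real^'n) set"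
  assumes U: "uniform_domain \<Omega>" and p: "p > 0"
  shows "\<exists>C>0. \<forall>u. \<forall>g\<in>gradients (ball_pairs \<Omega>) p \<Omega> u.
    \<exists>g'\<in>gradients (\<lambda>_ _. True) p \<Omega> u. Lp_norm p \<Omega> g' \<le> ennreal C * Lp_norm p \<Omega> g"
proof -
  \<comment> \<open>The chain argument works for every positive exponent, so any \<open>q\<close>
    below \<open>p\<close> would serve; the Sobolev exponent is of no concern here.\<close>
  define q where "q = p / 2"
  have q: "0 < q" "q < p" using p by (auto simp: q_def)
  have O: "open \<Omega>" using U by (simp add: uniform_domain_def domain_def)
  obtain C1 where C1: "C1 > 0" and ext: "\<forall>u g E. g \<in> borel_measurable lebesgue \<longrightarrow> (\<forall>x. 0 \<le> g x) \<longrightarrow> negligible E \<longrightarrow>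
    (\<forall>y\<in>\<Omega> - E. \<forall>z\<in>\<Omega> - E. ball_pairs \<Omega> y z \<longrightarrow> \<bar>u y - u z\<bar> \<le> dist y z * (g y + g z)) \<longrightarrow>
    (\<forall>x\<in>\<Omega> - E. \<forall>y\<in>\<Omega> - E. \<forall>m m'. 0 \<le> m \<longrightarrow> 0 \<le> m' \<longrightarrow> maxf (\<lambda>x. ennreal (g x powr q)) x \<le> ennreal m \<longrightarrow>
       maxf (\<lambda>x. ennreal (g x powr q)) y \<le> ennreal m' \<longrightarrow>
       \<bar>u x - u y\<bar> \<le> dist x y * (C1 * (g x + m powr (1 / q)) + C1 * (g y + m' powr (1 / q))))"
    using uniform_domain_chain[OF U q(1)] by (elim exE conjE) (rule that)
  obtain C2 where C2: "C2 > 0" and mg: "\<And>\<Omega> g. open (\<Omega>::(real^'n) set) \<Longrightarrow> g \<in> borel_measurable (lebesgue_on \<Omega>) \<Longrightarrow>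
    (\<integral>\<^sup>+x. epowr (max_grad q \<Omega> g x) p \<partial>lebesgue_on \<Omega>) \<le> ennreal C2 * (\<integral>\<^sup>+x. epowr (ennreal \<bar>g x\<bar>) p \<partial>lebesgue_on \<Omega>)"
    using max_grad_modular[OF q] by blast
  define K where "K = C1 powr p * (2 powr p * (1 + C2))"
  have K: "K > 0" using C1 C2 by (simp add: K_def)
  show ?thesis
  proof (rule exI[of _ "K powr (1 / p)"], intro conjI allI ballI)
    fix u g assume gg: "g \<in> gradients (ball_pairs \<Omega>) p \<Omega> u"
    then obtain E where g: "g \<in> Lp p \<Omega>" and E: "negligible E" "E \<subseteq> \<Omega>"
      and ug: "\<And>x y. x \<in> \<Omega> - E \<Longrightarrow> y \<in> \<Omega> - E \<Longrightarrow> ball_pairs \<Omega> x y \<Longrightarrow> \<bar>u x - u y\<bar> \<le> dist x y * (g x + g y)"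
      unfolding gradients_def by blast
    have gm [measurable]: "g \<in> borel_measurable (lebesgue_on \<Omega>)" using g by (simp add: Lp_def)
    note [measurable] = max_grad_measurable[of q \<Omega> g \<Omega>]
    define G where "G = zero_ext \<Omega> g"
    have G: "G \<in> borel_measurable lebesgue" "\<forall>x. 0 \<le> G x"
      unfolding G_def using zero_ext_measurable[OF O gm] zero_ext_nonneg[of \<Omega> g] by auto
    \<comment> \<open>\<open>enn2real\<close> sends infinity to 0, which makes \<open>g'\<close>
      useless where the maximal function is infinite; those points are put into the exceptional set.
      The norm estimate survives, since \<open>enn2real\<close> never increases the value.\<close>
    define g' where "g' x = C1 * (\<bar>g x\<bar> + enn2real (max_grad q \<Omega> g x))" for x
    have g'm [measurable]: "g' \<in> borel_measurable (lebesgue_on \<Omega>)" unfolding g'_def by measurable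
    define E' where "E' = E \<union> {x \<in> \<Omega>. max_grad q \<Omega> g x = top}"
    have fin: "(\<integral>\<^sup>+x. epowr (max_grad q \<Omega> g x) p \<partial>lebesgue_on \<Omega>) \<noteq> top"
    proof -
      have "ennreal C2 * (\<integral>\<^sup>+x. epowr (ennreal \<bar>g x\<bar>) p \<partial>lebesgue_on \<Omega>) < top"
        using Lp_norm_modular_finite[OF p g] by (simp add: ennreal_mult_less_top)
      then show ?thesis using mg[OF O gm] by (metis less_irrefl order_le_less_trans)
    qed
    have E': "negligible E'" "E' \<subseteq> \<Omega>"
      unfolding E'_def using E negligible_infinite[OF O _ fin] by auto
    have ug': "\<bar>u x - u y\<bar> \<le> dist x y * (g' x + g' y)" if xy: "x \<in> \<Omega> - E'" "y \<in> \<Omega> - E'" for x y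
    proof -
      have *: "\<exists>m\<ge>0. maxf (\<lambda>y. ennreal (G y powr q)) x = ennreal m \<and> g' x = C1 * (G x + m powr (1 / q))" if x: "x \<in> \<Omega> - E'" for x
      proof -
        have "max_grad q \<Omega> g x \<noteq> top" using x by (auto simp: E'_def)
        then have "maxf (\<lambda>y. ennreal (G y powr q)) x \<noteq> top" unfolding max_grad_def G_def by auto
        then obtain m where m: "m \<ge> 0" "maxf (\<lambda>y. ennreal (G y powr q)) x = ennreal m" by (cases "maxf (\<lambda>y. ennreal (G y powr q)) x") auto
        then have "max_grad q \<Omega> g x = ennreal (m powr (1 / q))" by (simp add: max_grad_def G_def epowr_ennreal)
        then show ?thesis using m x by (intro exI[of _ m]) (auto simp: g'_def G_def zero_ext_eq)
      qed
      obtain m where m: "m \<ge> 0" "maxf (\<lambda>y. ennreal (G y powr q)) x = ennreal m" "g' x = C1 * (G x + m powr (1 / q))"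
        using *[OF xy(1)] by blast
      obtain m' where m': "m' \<ge> 0" "maxf (\<lambda>y. ennreal (G y powr q)) y = ennreal m'" "g' y = C1 * (G y + m' powr (1 / q))"
        using *[OF xy(2)] by blast
      have "\<forall>y\<in>\<Omega> - E. \<forall>z\<in>\<Omega> - E. ball_pairs \<Omega> y z \<longrightarrow> \<bar>u y - u z\<bar> \<le> dist y z * (G y + G z)"
      proof (intro ballI impI)
        fix y z assume yz: "y \<in> \<Omega> - E" "z \<in> \<Omega> - E" "ball_pairs \<Omega> y z"
        have "\<bar>u y - u z\<bar> \<le> dist y z * (g y + g z)" by (rule ug[OF yz])
        also have "\<dots> \<le> dist y z * (G y + G z)" using yz by (intro mult_left_mono add_mono) (auto simp: G_def zero_ext_eq)
        finally show "\<bar>u y - u z\<bar> \<le> dist y z * (G y + G z)" .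
      qed
      then show ?thesis unfolding m(3) m'(3)
        by (intro ext[rule_format, OF G(1) G(2)[rule_format] E(1)]) (use m m' xy in \<open>auto simp: E'_def\<close>)
    qed
    have mod: "(\<integral>\<^sup>+x. epowr (ennreal \<bar>g' x\<bar>) p \<partial>lebesgue_on \<Omega>) \<le> ennreal K * (\<integral>\<^sup>+x. epowr (ennreal \<bar>g x\<bar>) p \<partial>lebesgue_on \<Omega>)"
    proof -
      have "(\<integral>\<^sup>+x. epowr (ennreal \<bar>g' x\<bar>) p \<partial>lebesgue_on \<Omega>)
        \<le> (\<integral>\<^sup>+x. ennreal (C1 powr p * 2 powr p) * (epowr (ennreal \<bar>g x\<bar>) p + epowr (max_grad q \<Omega> g x) p) \<partial>lebesgue_on \<Omega>)"
      proof (rule nn_integral_mono)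
        fix x
        have "ennreal \<bar>g' x\<bar> = ennreal C1 * (ennreal \<bar>g x\<bar> + ennreal (enn2real (max_grad q \<Omega> g x)))"
          using C1 by (simp add: g'_def abs_mult ennreal_mult ennreal_plus)
        also have "\<dots> \<le> ennreal C1 * (ennreal \<bar>g x\<bar> + max_grad q \<Omega> g x)"
          by (intro mult_left_mono add_left_mono) (auto simp: ennreal_enn2real_if)
        finally have "epowr (ennreal \<bar>g' x\<bar>) p \<le> epowr (ennreal C1 * (ennreal \<bar>g x\<bar> + max_grad q \<Omega> g x)) p"
          using p by (intro epowr_mono) auto
        also have "\<dots> = ennreal (C1 powr p) * epowr (ennreal \<bar>g x\<bar> + max_grad q \<Omega> g x) p" by (rule epowr_cmult[OF C1])
        also have "\<dots> \<le> ennreal (C1 powr p) * (ennreal (2 powr p) * (epowr (ennreal \<bar>g x\<bar>) p + epowr (max_grad q \<Omega> g x) p))"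
          using p by (intro mult_left_mono epowr_add_le) auto
        finally show "epowr (ennreal \<bar>g' x\<bar>) p \<le> ennreal (C1 powr p * 2 powr p) * (epowr (ennreal \<bar>g x\<bar>) p + epowr (max_grad q \<Omega> g x) p)"
          by (simp add: ennreal_mult mult.assoc)
      qed
      also have "\<dots> = ennreal (C1 powr p * 2 powr p) * ((\<integral>\<^sup>+x. epowr (ennreal \<bar>g x\<bar>) p \<partial>lebesgue_on \<Omega>) + (\<integral>\<^sup>+x. epowr (max_grad q \<Omega> g x) p \<partial>lebesgue_on \<Omega>))"
        by (subst nn_integral_cmult, measurable, subst nn_integral_add, measurable)
      also have "\<dots> \<le> ennreal (C1 powr p * 2 powr p) * ((\<integral>\<^sup>+x. epowr (ennreal \<bar>g x\<bar>) p \<partial>lebesgue_on \<Omega>) + ennreal C2 * (\<integral>\<^sup>+x. epowr (ennreal \<bar>g x\<bar>) p \<partial>lebesgue_on \<Omega>))"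
        by (intro mult_left_mono add_left_mono mg[OF O gm]) auto
      also have "\<dots> = ennreal (C1 powr p * 2 powr p) * ((1 + ennreal C2) * (\<integral>\<^sup>+x. epowr (ennreal \<bar>g x\<bar>) p \<partial>lebesgue_on \<Omega>))"
        by (simp add: distrib_right)
      also have "1 + ennreal C2 = ennreal (1 + C2)" using C2 by (simp add: ennreal_plus)
      also have "ennreal (C1 powr p * 2 powr p) * (ennreal (1 + C2) * (\<integral>\<^sup>+x. epowr (ennreal \<bar>g x\<bar>) p \<partial>lebesgue_on \<Omega>))
         = ennreal K * (\<integral>\<^sup>+x. epowr (ennreal \<bar>g x\<bar>) p \<partial>lebesgue_on \<Omega>)"
        using C2 by (simp add: K_def ennreal_mult mult.assoc)
      finally show ?thesis .
    qed
    then have norm: "Lp_norm p \<Omega> g' \<le> ennreal (K powr (1 / p)) * Lp_norm p \<Omega> g"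
      unfolding Lp_norm_def by (rule eLp_norm_le[OF p K])
    moreover have "ennreal (K powr (1 / p)) * Lp_norm p \<Omega> g < top"
      using g by (simp add: Lp_def ennreal_mult_less_top)
    ultimately have "g' \<in> Lp p \<Omega>" using g'm by (simp add: Lp_def order_le_less_trans)
    then have "g' \<in> gradients (\<lambda>_ _. True) p \<Omega> u"
      using E' ug' unfolding gradients_def by blast
    then show "\<exists>g'\<in>gradients (\<lambda>_ _. True) p \<Omega> u. Lp_norm p \<Omega> g' \<le> ennreal (K powr (1 / p)) * Lp_norm p \<Omega> g"
      using norm by blast
  qed (use K in simp)
qed

text \<open>The Sobolev--Poincare inequality bounds the integral of |u - c| on balls inside
  \<Omega>, and finitely many such balls cover a compact set.\<close>

lemma locally_integrable_of_gradient:
  fixes \<Omega> :: "(real^'n) set"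
  assumes p: "real CARD('n) / (real CARD('n) + 1) < p" and O: "open \<Omega>"
    and u: "u \<in> borel_measurable (lebesgue_on \<Omega>)" and g: "g \<in> gradients (\<lambda>_ _. True) p \<Omega> u"
  shows "locally_integrable \<Omega> u"
proof -
  define n where "n = real DIM(real^'n)"
  define q where "q = n / (n + 1)"
  have n: "n \<ge> 1" by (simp add: n_def Suc_leI)
  have q: "0 < q" "q < p" using n p by (auto simp: q_def n_def)
  obtain C0 where C0: "C0 > 0" and poinc: "\<forall>(u :: real^'n \<Rightarrow> real) g a r E I. g \<in> borel_measurable lebesgue \<longrightarrow> (\<forall>x. 0 \<le> g x) \<longrightarrow> r > 0 \<longrightarrow> negligible E \<longrightarrow>
    (\<forall>x\<in>ball a r - E. \<forall>y\<in>ball a r - E. \<bar>u x - u y\<bar> \<le> dist x y * (g x + g y)) \<longrightarrow>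
    (\<integral>\<^sup>+y\<in>ball a r. ennreal (g y powr (n / (n + 1))) \<partial>lebesgue) \<le> ennreal I \<longrightarrow> I > 0 \<longrightarrow>
    (\<exists>c. (\<integral>\<^sup>+y\<in>ball a r. ennreal \<bar>u y - c\<bar> \<partial>lebesgue) \<le> ennreal (C0 * I powr ((n + 1) / n)))"
    using sobolev_poincare[OF n_def] by (elim exE conjE) (rule that)
  obtain E where gL: "g \<in> Lp p \<Omega>" and E: "negligible E" "E \<subseteq> \<Omega>"
    and ug: "\<And>x y. x \<in> \<Omega> - E \<Longrightarrow> y \<in> \<Omega> - E \<Longrightarrow> \<bar>u x - u y\<bar> \<le> dist x y * (g x + g y)"
    using g unfolding gradients_def by blast
  have gm: "g \<in> borel_measurable (lebesgue_on \<Omega>)" using gL by (simp add: Lp_def)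
  define G where "G = zero_ext \<Omega> g"
  have G [measurable]: "G \<in> borel_measurable lebesgue" unfolding G_def by (rule zero_ext_measurable[OF O gm])
  have Gnn: "\<And>x. 0 \<le> G x" by (simp add: G_def zero_ext_nonneg)
  have Gp: "(\<integral>\<^sup>+x. ennreal (G x powr p) \<partial>lebesgue) < top"
    unfolding G_def nn_integral_zero_ext[OF O] using q by (intro Lp_norm_modular_finite gL) auto
  have ball: "(\<integral>\<^sup>+y\<in>ball a r. ennreal \<bar>u y\<bar> \<partial>lebesgue) < top" if ab: "ball a r \<subseteq> \<Omega>" "r > 0" for a r
  proof -
    have [measurable]: "ball a r \<in> sets lebesgue" by simp
    have "(\<integral>\<^sup>+y\<in>ball a r. ennreal (G y powr q) \<partial>lebesgue)
      \<le> (\<integral>\<^sup>+y. 1 * indicator (ball a r) y + ennreal (G y powr p) \<partial>lebesgue)"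
    proof (rule nn_integral_mono)
      fix y
      \<comment> \<open>As q < p, this makes G^q integrable over balls.\<close>
      have "G y powr q \<le> 1 + G y powr p"
      proof (cases "G y \<le> 1")
        case True
        then have "G y powr q \<le> 1 powr q" using q Gnn by (intro powr_mono2) auto
        then show ?thesis using powr_ge_zero[of "G y" p] unfolding powr_one_eq_one by linarith
      next
        case False
        then have "G y powr q \<le> G y powr p" using q by (intro powr_mono) auto
        then show ?thesis by simp
      qed
      then have "ennreal (G y powr q) \<le> ennreal (1 + G y powr p)" by (rule ennreal_leI)
      then show "ennreal (G y powr q) * indicator (ball a r) y \<le> 1 * indicator (ball a r) y + ennreal (G y powr p)"
        by (auto split: split_indicator simp: ennreal_plus)
    qed
    also have "\<dots> = (\<integral>\<^sup>+y\<in>ball a r. 1 \<partial>lebesgue) + (\<integral>\<^sup>+y. ennreal (G y powr p) \<partial>lebesgue)"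
      by (rule nn_integral_add) measurable
    also have "\<dots> < top"
      using Gp nn_integral_ball_const[of r 1 a] ab(2) by (simp add: emeasure_lebesgue_ball)
    finally obtain I where I: "I \<ge> 0" "(\<integral>\<^sup>+y\<in>ball a r. ennreal (G y powr q) \<partial>lebesgue) = ennreal I"
      by (cases "\<integral>\<^sup>+y. ennreal (G y powr q) * indicator (ball a r) y \<partial>lebesgue") auto
    have "\<exists>c. (\<integral>\<^sup>+y\<in>ball a r. ennreal \<bar>u y - c\<bar> \<partial>lebesgue) \<le> ennreal (C0 * (I + 1) powr ((n + 1) / n))"
    proof (rule poinc[rule_format, OF G Gnn ab(2) E(1)])
      show "(\<integral>\<^sup>+y\<in>ball a r. ennreal (G y powr (n / (n + 1))) \<partial>lebesgue) \<le> ennreal (I + 1)"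
        using I by (simp add: q_def[symmetric] ennreal_leI del: ennreal_plus)
      fix x y assume "x \<in> ball a r - E" "y \<in> ball a r - E"
      then have xy: "x \<in> \<Omega> - E" "y \<in> \<Omega> - E" using ab by auto
      have "\<bar>u x - u y\<bar> \<le> dist x y * (g x + g y)" by (rule ug[OF xy])
      also have "\<dots> \<le> dist x y * (G x + G y)" using xy by (intro mult_left_mono add_mono) (auto simp: G_def zero_ext_eq)
      finally show "\<bar>u x - u y\<bar> \<le> dist x y * (G x + G y)" .
    qed (use I in auto)
    then obtain c where c: "(\<integral>\<^sup>+y\<in>ball a r. ennreal \<bar>u y - c\<bar> \<partial>lebesgue) < top"
      by (meson ennreal_less_top order_le_less_trans)
    have m: "(\<lambda>y. ennreal \<bar>u y - c\<bar> * indicator (ball a r) y) \<in> borel_measurable lebesgue"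
    proof -
      have "(\<lambda>y. ennreal \<bar>u y - c\<bar> * indicator (ball a r) y) \<in> borel_measurable (lebesgue_on \<Omega>)"
        using u by (intro borel_measurable_times_ennreal measurable_compose[OF _ measurable_ennreal] borel_measurable_indicator)
           (auto simp: sets_restrict_space_iff O ab(1))
      then have "(\<lambda>y. (ennreal \<bar>u y - c\<bar> * indicator (ball a r) y) * indicator \<Omega> y) \<in> borel_measurable lebesgue"
        using O by (subst borel_measurable_restrict_space_iff_ennreal[symmetric]) auto
      moreover have "(\<lambda>y. (ennreal \<bar>u y - c\<bar> * indicator (ball a r) y) * indicator \<Omega> y) = (\<lambda>y. ennreal \<bar>u y - c\<bar> * indicator (ball a r) y)"
        using ab(1) by (auto simp: fun_eq_iff split: split_indicator)
      ultimately show ?thesis by simp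
    qed
    have "(\<integral>\<^sup>+y\<in>ball a r. ennreal \<bar>u y\<bar> \<partial>lebesgue)
      \<le> (\<integral>\<^sup>+y. ennreal \<bar>u y - c\<bar> * indicator (ball a r) y + ennreal \<bar>c\<bar> * indicator (ball a r) y \<partial>lebesgue)"
    proof (rule nn_integral_mono)
      fix y
      have "ennreal \<bar>u y\<bar> \<le> ennreal (\<bar>u y - c\<bar> + \<bar>c\<bar>)" by (rule ennreal_leI) linarith
      then show "ennreal \<bar>u y\<bar> * indicator (ball a r) y \<le> ennreal \<bar>u y - c\<bar> * indicator (ball a r) y + ennreal \<bar>c\<bar> * indicator (ball a r) y"
        by (auto split: split_indicator simp: ennreal_plus)
    qed
    also have "\<dots> = (\<integral>\<^sup>+y\<in>ball a r. ennreal \<bar>u y - c\<bar> \<partial>lebesgue) + (\<integral>\<^sup>+y\<in>ball a r. ennreal \<bar>c\<bar> \<partial>lebesgue)"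
      by (rule nn_integral_add[OF m]) measurable
    also have "\<dots> < top" using c nn_integral_ball_const[of r "ennreal \<bar>c\<bar>" a] ab(2) by (simp add: ennreal_mult_less_top del: nn_integral_indicator nn_integral_cmult_indicator)
    finally show ?thesis .
  qed
  show ?thesis
    unfolding locally_integrable_def
  proof (intro allI impI)
    fix K assume K: "compact K" "K \<subseteq> \<Omega>"
    have "\<forall>x\<in>K. \<exists>r>0. ball x r \<subseteq> \<Omega>" using O K(2) open_contains_ball by blast
    then obtain r where r: "\<And>x. x \<in> K \<Longrightarrow> r x > 0" "\<And>x. x \<in> K \<Longrightarrow> ball x (r x) \<subseteq> \<Omega>" by metis
    obtain D where D: "D \<subseteq> K" "finite D" "K \<subseteq> (\<Union>x\<in>D. ball x (r x))"
    proof (rule compactE_image[OF K(1), of K "\<lambda>x. ball x (r x)"])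
      show "K \<subseteq> (\<Union>x\<in>K. ball x (r x))" using r(1) by force
    qed auto
    have Ks [measurable]: "K \<in> sets lebesgue" using K(1) by (simp add: compact_imp_closed)
    have um: "(\<lambda>y. indicator \<Omega> y *\<^sub>R u y) \<in> borel_measurable lebesgue"
      using u O by (subst borel_measurable_restrict_space_iff[symmetric]) auto
    have eq: "(\<lambda>y. indicator K y *\<^sub>R u y) = (\<lambda>y. indicator K y *\<^sub>R (indicator \<Omega> y *\<^sub>R u y))"
      using K(2) by (auto simp: fun_eq_iff split: split_indicator)
    have m: "(\<lambda>y. indicator K y *\<^sub>R u y) \<in> borel_measurable lebesgue"
      unfolding eq using um by measurable
    have "(\<integral>\<^sup>+y. ennreal (norm (indicator K y *\<^sub>R u y)) \<partial>lebesgue) \<le> (\<integral>\<^sup>+y. (\<Sum>x\<in>D. ennreal \<bar>indicator \<Omega> y *\<^sub>R u y\<bar> * indicator (ball x (r x)) y) \<partial>lebesgue)"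
    proof (rule nn_integral_mono)
      fix y
      show "ennreal (norm (indicator K y *\<^sub>R u y)) \<le> (\<Sum>x\<in>D. ennreal \<bar>indicator \<Omega> y *\<^sub>R u y\<bar> * indicator (ball x (r x)) y)"
      proof (cases "y \<in> K")
        case True
        then obtain x where x: "x \<in> D" "y \<in> ball x (r x)" using D(3) by blast
        have "ennreal (norm (indicator K y *\<^sub>R u y)) = ennreal \<bar>indicator \<Omega> y *\<^sub>R u y\<bar> * indicator (ball x (r x)) y"
          using True x K(2) by (auto simp: indicator_def)
        also have "\<dots> \<le> (\<Sum>x\<in>D. ennreal \<bar>indicator \<Omega> y *\<^sub>R u y\<bar> * indicator (ball x (r x)) y)"
          using D(2) x(1) by (intro member_le_sum) auto
        finally show ?thesis .
      qed simp
    qed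
    also have "\<dots> = (\<Sum>x\<in>D. \<integral>\<^sup>+y. ennreal \<bar>indicator \<Omega> y *\<^sub>R u y\<bar> * indicator (ball x (r x)) y \<partial>lebesgue)"
    proof (rule nn_integral_sum)
      fix x
      have [measurable]: "ball x (r x) \<in> sets lebesgue" by simp
      show "(\<lambda>y. ennreal \<bar>indicator \<Omega> y *\<^sub>R u y\<bar> * indicator (ball x (r x)) y) \<in> borel_measurable lebesgue"
        using um by measurable
    qed
    also have "\<dots> = (\<Sum>x\<in>D. \<integral>\<^sup>+y. ennreal \<bar>u y\<bar> * indicator (ball x (r x)) y \<partial>lebesgue)"
    proof (intro sum.cong nn_integral_cong refl)
      fix x y assume "x \<in> D"
      then have "ball x (r x) \<subseteq> \<Omega>" using r(2) D(1) by blast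
      then have "y \<in> ball x (r x) \<Longrightarrow> y \<in> \<Omega>" by blast
      then show "ennreal \<bar>indicator \<Omega> y *\<^sub>R u y\<bar> * indicator (ball x (r x)) y = ennreal \<bar>u y\<bar> * indicator (ball x (r x)) y"
        by (cases "y \<in> ball x (r x)") auto
    qed
    also have "\<dots> < top"
    proof -
      have "\<forall>x\<in>D. (\<integral>\<^sup>+y\<in>ball x (r x). ennreal \<bar>u y\<bar> \<partial>lebesgue) < top"
        using ball[OF r(2) r(1)] D(1) by blast
      then show ?thesis using D(2) by simp
    qed
    finally show "u absolutely_integrable_on K"
      unfolding set_integrable_def using m by (simp add: integrable_iff_bounded)
  qed
qed

text \<open>Removes the positivity demanded of \<open>I\<close> in the Sobolev--Poincare inequality:
  the maximal function may vanish at a point.\<close>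

lemma le_powr_of_le_add_eps:
  fixes a C m s :: real
  assumes "\<And>e. e > 0 \<Longrightarrow> a \<le> C * (m + e) powr s" and m: "m \<ge> 0" and s: "s > 0"
  shows "a \<le> C * m powr s"
proof (rule tendsto_lowerbound)
  have "((\<lambda>e. m + e) \<longlongrightarrow> m + 0) (at_right 0)" by (intro tendsto_intros)
  moreover have "eventually (\<lambda>e. 0 \<le> m + e) (at_right 0)"
    using m by (auto simp: eventually_at_filter)
  ultimately have "((\<lambda>e. (m + e) powr s) \<longlongrightarrow> (m + 0) powr s) (at_right 0)"
    using s by (intro tendsto_powr') auto
  then show "((\<lambda>e. C * (m + e) powr s) \<longlongrightarrow> C * m powr s) (at_right 0)"
    by (intro tendsto_mult_left) simp
  show "eventually (\<lambda>e. a \<le> C * (m + e) powr s) (at_right 0)"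
    using assms(1) by (auto simp: eventually_at_filter)
qed simp

text \<open>The pointwise bound of the grand maximal function by \<open>max_grad\<close> uses only
  that the ball carrying the test function lies in \<Omega>; the integral bound for
  \<open>max_grad\<close> then finishes the estimate.\<close>

theorem Hp_norm_deriv_le:
  fixes N :: nat and p :: real
  assumes p: "real CARD('n) / (real CARD('n) + 1) < p" and N: "N \<ge> 1"
  shows "\<exists>C>0. \<forall>(\<Omega>::(real^'n) set) u g j. open \<Omega> \<longrightarrow> u \<in> borel_measurable (lebesgue_on \<Omega>) \<longrightarrow> g \<in> gradients (\<lambda>_ _. True) p \<Omega> u \<longrightarrow>
    Hp_norm p N \<Omega> (weak_deriv \<Omega> u j) \<le> ennreal C * Lp_norm p \<Omega> g"
proof -
  define n where "n = real DIM(real^'n)"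
  define q where "q = n / (n + 1)"
  have n: "n \<ge> 1" by (simp add: n_def Suc_leI)
  have q: "0 < q" "q < p" using n p by (auto simp: q_def n_def)
  have p0: "p > 0" using q by simp
  have iq: "(n + 1) / n = 1 / q" by (simp add: q_def)
  obtain C0 where C0: "C0 > 0" and poinc: "\<forall>(u :: real^'n \<Rightarrow> real) g a r E I. g \<in> borel_measurable lebesgue \<longrightarrow> (\<forall>x. 0 \<le> g x) \<longrightarrow> r > 0 \<longrightarrow> negligible E \<longrightarrow>
    (\<forall>x\<in>ball a r - E. \<forall>y\<in>ball a r - E. \<bar>u x - u y\<bar> \<le> dist x y * (g x + g y)) \<longrightarrow>
    (\<integral>\<^sup>+y\<in>ball a r. ennreal (g y powr (n / (n + 1))) \<partial>lebesgue) \<le> ennreal I \<longrightarrow> I > 0 \<longrightarrow>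
    (\<exists>c. (\<integral>\<^sup>+y\<in>ball a r. ennreal \<bar>u y - c\<bar> \<partial>lebesgue) \<le> ennreal (C0 * I powr ((n + 1) / n)))"
    using sobolev_poincare[OF n_def] by (elim exE conjE) (rule that)
  obtain C2 where C2: "C2 > 0" and mg: "\<And>\<Omega> g. open (\<Omega>::(real^'n) set) \<Longrightarrow> g \<in> borel_measurable (lebesgue_on \<Omega>) \<Longrightarrow>
    (\<integral>\<^sup>+x. epowr (max_grad q \<Omega> g x) p \<partial>lebesgue_on \<Omega>) \<le> ennreal C2 * (\<integral>\<^sup>+x. epowr (ennreal \<bar>g x\<bar>) p \<partial>lebesgue_on \<Omega>)"
    using max_grad_modular[OF q] by blast
  define K where "K = C0 powr p * C2"
  have K: "K > 0" using C0 C2 by (simp add: K_def)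
  show ?thesis
  proof (rule exI[of _ "K powr (1 / p)"], intro conjI allI impI)
    fix \<Omega> :: "(real^'n) set" and u g j
    assume O: "open \<Omega>" and u: "u \<in> borel_measurable (lebesgue_on \<Omega>)" and g: "g \<in> gradients (\<lambda>_ _. True) p \<Omega> u"
    have li: "locally_integrable \<Omega> u" by (rule locally_integrable_of_gradient[OF p O u g])
    obtain E where gL: "g \<in> Lp p \<Omega>" and E: "negligible E" "E \<subseteq> \<Omega>"
      and ug: "\<And>x y. x \<in> \<Omega> - E \<Longrightarrow> y \<in> \<Omega> - E \<Longrightarrow> \<bar>u x - u y\<bar> \<le> dist x y * (g x + g y)"
      using g unfolding gradients_def by blast
    have gm [measurable]: "g \<in> borel_measurable (lebesgue_on \<Omega>)" using gL by (simp add: Lp_def)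
    note [measurable] = max_grad_measurable[of q \<Omega> g \<Omega>]
    define G where "G = zero_ext \<Omega> g"
    have G [measurable]: "G \<in> borel_measurable lebesgue" unfolding G_def by (rule zero_ext_measurable[OF O gm])
    have Gnn: "\<And>x. 0 \<le> G x" by (simp add: G_def zero_ext_nonneg)
    have le: "grand_max (bdist \<Omega> x / 2) N (weak_deriv \<Omega> u j) x \<le> ennreal C0 * max_grad q \<Omega> g x"
      if x: "x \<in> \<Omega>" for x
      unfolding grand_max_def
    proof (rule SUP_least)
      fix \<phi> assume "\<phi> \<in> {\<phi>. \<exists>s::real. 0 < s \<and> ennreal s \<le> bdist \<Omega> x / 2 \<and> \<phi> \<in> test_funs_N N x s}"
      then obtain s where s: "s > 0" "ennreal s \<le> bdist \<Omega> x / 2" and \<phi>: "\<phi> \<in> test_funs_N N x s" by auto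
      have "ennreal s \<le> ennreal (2 * s)" using s by (intro ennreal_leI) auto
      also have "\<dots> \<le> bdist \<Omega> x" using ennreal_le_divide_numeralD[OF s(2)] s(1) by simp
      finally have sub: "ball x s \<subseteq> \<Omega>" by (rule ball_subset_of_le_bdist[OF x])
      show "ennreal \<bar>weak_deriv \<Omega> u j \<phi>\<bar> \<le> ennreal C0 * max_grad q \<Omega> g x"
      proof (cases "maxf (\<lambda>y. ennreal (G y powr q)) x")
        case top
        then show ?thesis using C0 by (simp add: max_grad_def G_def ennreal_mult_top)
      next
        case (real m)
        have "\<bar>weak_deriv \<Omega> u j \<phi>\<bar> \<le> C0 * (m + e) powr (1 / q)" if e: "e > 0" for e
        proof -
          define I where "I = s powr n * (m + e)"
          have I: "I > 0" using s e real by (simp add: I_def)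
          have sn: "s powr n = s ^ CARD('n)" using s by (simp add: n_def powr_realpow)
          have "(\<integral>\<^sup>+y\<in>ball x s. ennreal (G y powr q) \<partial>lebesgue) \<le> ennreal (s ^ DIM(real^'n)) * maxf (\<lambda>y. ennreal (G y powr q)) x"
            using s by (intro nn_integral_ball_le_maxf) simp
          also have "\<dots> = ennreal (s powr n * m)" using s real by (simp add: sn ennreal_mult[symmetric])
          also have "\<dots> \<le> ennreal I" unfolding I_def using e s by (intro ennreal_leI mult_left_mono) auto
          finally have bI: "(\<integral>\<^sup>+y\<in>ball x s. ennreal (G y powr q) \<partial>lebesgue) \<le> ennreal I" .
          have "\<exists>c. (\<integral>\<^sup>+y\<in>ball x s. ennreal \<bar>u y - c\<bar> \<partial>lebesgue) \<le> ennreal (C0 * I powr ((n + 1) / n))"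
          proof (rule poinc[rule_format, OF G Gnn s(1) E(1)])
            show "(\<integral>\<^sup>+y\<in>ball x s. ennreal (G y powr (n / (n + 1))) \<partial>lebesgue) \<le> ennreal I"
              using bI by (simp only: q_def)
            fix y z assume "y \<in> ball x s - E" "z \<in> ball x s - E"
            then have yz: "y \<in> \<Omega> - E" "z \<in> \<Omega> - E" using sub by auto
            have "\<bar>u y - u z\<bar> \<le> dist y z * (g y + g z)" by (rule ug[OF yz])
            also have "\<dots> \<le> dist y z * (G y + G z)" using yz by (intro mult_left_mono add_mono) (auto simp: G_def zero_ext_eq)
            finally show "\<bar>u y - u z\<bar> \<le> dist y z * (G y + G z)" .
          qed (rule I)
          then obtain c where c: "(\<integral>\<^sup>+y\<in>ball x s. ennreal \<bar>u y - c\<bar> \<partial>lebesgue) \<le> ennreal (C0 * I powr ((n + 1) / n))" ..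
          have "\<bar>weak_deriv \<Omega> u j \<phi>\<bar> \<le> C0 * I powr ((n + 1) / n) / s ^ (CARD('n) + 1)"
            using C0 by (intro distr_deriv_le_oscillation[OF li sub s(1) N \<phi> c]) simp
          \<comment> \<open>Scale invariance: with I = s^n (m + e) the power (n+1)/n produces
            s^(n+1), which cancels the denominator of the oscillation estimate.\<close>
          also have "I powr ((n + 1) / n) = s ^ (CARD('n) + 1) * (m + e) powr (1 / q)"
          proof -
            have "(s powr n) powr ((n + 1) / n) = s powr (n + 1)" using n by (simp add: powr_powr)
            also have "\<dots> = s ^ (CARD('n) + 1)" using s powr_realpow[of s "CARD('n) + 1"] by (simp add: n_def add.commute)
            finally show ?thesis unfolding I_def powr_mult iq by simp
          qed
          finally show ?thesis using s by simp
        qed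
        then have "\<bar>weak_deriv \<Omega> u j \<phi>\<bar> \<le> C0 * m powr (1 / q)"
          by (rule le_powr_of_le_add_eps) (use q real in auto)
        then have "ennreal \<bar>weak_deriv \<Omega> u j \<phi>\<bar> \<le> ennreal (C0 * m powr (1 / q))" by (rule ennreal_leI)
        also have "\<dots> = ennreal C0 * max_grad q \<Omega> g x"
          using C0 real by (simp add: max_grad_def G_def epowr_ennreal ennreal_mult)
        finally show ?thesis .
      qed
    qed
    have "(\<integral>\<^sup>+x. epowr (ennreal C0 * max_grad q \<Omega> g x) p \<partial>lebesgue_on \<Omega>) = ennreal (C0 powr p) * (\<integral>\<^sup>+x. epowr (max_grad q \<Omega> g x) p \<partial>lebesgue_on \<Omega>)"
      unfolding epowr_cmult[OF C0] by (rule nn_integral_cmult) measurable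
    also have "\<dots> \<le> ennreal (C0 powr p) * (ennreal C2 * (\<integral>\<^sup>+x. epowr (ennreal \<bar>g x\<bar>) p \<partial>lebesgue_on \<Omega>))"
      by (intro mult_left_mono mg[OF O gm]) simp
    also have "\<dots> = ennreal K * (\<integral>\<^sup>+x. epowr (ennreal \<bar>g x\<bar>) p \<partial>lebesgue_on \<Omega>)"
      using C2 by (simp add: K_def ennreal_mult mult.assoc)
    finally have mod: "(\<integral>\<^sup>+x. epowr (ennreal C0 * max_grad q \<Omega> g x) p \<partial>lebesgue_on \<Omega>) \<le> ennreal K * (\<integral>\<^sup>+x. epowr (ennreal \<bar>g x\<bar>) p \<partial>lebesgue_on \<Omega>)" .
    have "Hp_norm p N \<Omega> (weak_deriv \<Omega> u j) \<le> eLp_norm p \<Omega> (\<lambda>x. ennreal C0 * max_grad q \<Omega> g x)"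
      unfolding Hp_norm_def by (rule eLp_norm_mono[OF p0 le])
    also have "\<dots> \<le> ennreal (K powr (1 / p)) * Lp_norm p \<Omega> g"
      unfolding Lp_norm_def by (rule eLp_norm_le[OF p0 K mod])
    finally show "Hp_norm p N \<Omega> (weak_deriv \<Omega> u j) \<le> ennreal (K powr (1 / p)) * Lp_norm p \<Omega> g" .
  qed (use K in simp)
qed

section \<open>Measurability of the grand maximal function\<close>

lemma test_funs_N_shift:
  fixes x x' :: "real^'n"
  assumes \<phi>: "\<phi> \<in> test_funs_N N x s" and S: "closure (support_on UNIV \<phi>) \<subseteq> ball x' s'" and s: "0 < s'" "s' \<le> s"
  shows "\<phi> \<in> test_funs_N N x' s'"
  unfolding test_funs_N_def
proof (intro CollectI conjI allI impI)
  show "\<phi> \<in> test_funs (ball x' s')" using \<phi> S by (simp add: test_funs_N_def test_funs_def)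
  fix js :: "'n list" and y assume "length js \<le> N"
  then have "\<bar>pderivs js \<phi> y\<bar> \<le> 1 / s ^ (CARD('n) + length js)" using \<phi> by (simp add: test_funs_N_def)
  also have "\<dots> \<le> 1 / s' ^ (CARD('n) + length js)"
    using s by (intro divide_left_mono power_mono mult_pos_pos zero_less_power) auto
  finally show "\<bar>pderivs js \<phi> y\<bar> \<le> 1 / s' ^ (CARD('n) + length js)" .
qed

text \<open>The compact support of a test function that is admissible at \<open>x\<close> leaves room to move the centre and
  to shrink the radius.\<close>

lemma open_grand_max:
  fixes \<Omega> :: "(real^'n) set"
  assumes O: "open \<Omega>"
  shows "open {x \<in> \<Omega>. a < grand_max (bdist \<Omega> x / 2) N f x}"
proof (rule openI)
  fix x assume "x \<in> {x \<in> \<Omega>. a < grand_max (bdist \<Omega> x / 2) N f x}"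
  then obtain \<phi> s where x: "x \<in> \<Omega>" and s: "0 < s" "ennreal s \<le> bdist \<Omega> x / 2" and \<phi>: "\<phi> \<in> test_funs_N N x s"
    and a: "a < ennreal \<bar>f \<phi>\<bar>"
    unfolding grand_max_def less_SUP_iff by auto
  let ?S = "closure (support_on UNIV \<phi>)"
  have S: "compact ?S" "?S \<subseteq> ball x s" using \<phi> by (auto simp: test_funs_N_def test_funs_def)
  have "\<exists>t. 0 < t \<and> t < s \<and> (\<forall>z\<in>?S. dist x z \<le> t)"
  proof (cases "?S = {}")
    case True
    then show ?thesis using s by (intro exI[of _ "s / 2"]) auto
  next
    case False
    have "continuous_on ?S (dist x)" by (intro continuous_intros)
    then obtain w where w: "w \<in> ?S" "\<forall>z\<in>?S. dist x z \<le> dist x w"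
      using continuous_attains_sup[OF S(1) False] by blast
    then have "dist x w < s" using S(2) by auto
    then show ?thesis using w s by (intro exI[of _ "max (dist x w) (s / 2)"]) (auto simp: le_max_iff_disj)
  qed
  then obtain t where t: "0 < t" "t < s" "\<And>z. z \<in> ?S \<Longrightarrow> dist x z \<le> t" by blast
  define d where "d = (s - t) / 3"
  have d: "d > 0" "t + d < s - d" using t by (auto simp: d_def field_simps)
  obtain d' where d': "d' > 0" "ball x d' \<subseteq> \<Omega>" using O x open_contains_ball by blast
  have "ball x (min d d') \<subseteq> {x \<in> \<Omega>. a < grand_max (bdist \<Omega> x / 2) N f x}"
  proof
    fix y assume y: "y \<in> ball x (min d d')"
    then have yO: "y \<in> \<Omega>" and yd: "dist x y < d" using d' by auto
    have "?S \<subseteq> ball y (s - d)"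
    proof
      fix z assume "z \<in> ?S"
      then show "z \<in> ball y (s - d)" using t(3)[of z] yd d dist_triangle[of y z x] by (simp add: dist_commute)
    qed
    moreover have sd: "0 < s - d" "s - d \<le> s" using t d by auto
    ultimately have \<phi>y: "\<phi> \<in> test_funs_N N y (s - d)" by (intro test_funs_N_shift[OF \<phi>])
    have "ennreal (2 * (s - d)) \<le> bdist \<Omega> y"
      unfolding bdist_def
    proof (rule INF_greatest)
      fix z assume z: "z \<in> frontier \<Omega>"
      have "ennreal (2 * s) \<le> bdist \<Omega> x" using ennreal_le_divide_numeralD[OF s(2)] s(1) by simp
      also have "\<dots> \<le> ennreal (dist x z)" unfolding bdist_def by (rule INF_lower[OF z])
      finally have "2 * s \<le> dist x z" by simp
      then have "2 * (s - d) \<le> dist y z" using yd d dist_triangle[of x z y] by simp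
      then show "ennreal (2 * (s - d)) \<le> ennreal (dist y z)" by (rule ennreal_leI)
    qed
    then have "ennreal (s - d) \<le> bdist \<Omega> y / 2" by (rule ennreal_le_divide_numeralI)
    then have "ennreal \<bar>f \<phi>\<bar> \<le> grand_max (bdist \<Omega> y / 2) N f y"
      unfolding grand_max_def using \<phi>y sd(1) by (intro SUP_upper CollectI exI[of _ "s - d"] conjI)
    then show "y \<in> {x \<in> \<Omega>. a < grand_max (bdist \<Omega> x / 2) N f x}" using a yO by auto
  qed
  then show "\<exists>e>0. ball x e \<subseteq> {x \<in> \<Omega>. a < grand_max (bdist \<Omega> x / 2) N f x}" using d d' by (intro exI[of _ "min d d'"]) auto
qed

text \<open>Needed twice below: to see that a function with finite p-th power integral is finite
  almost everywhere, and to exchange the integral with the sum over the coordinates.\<close>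

lemma grand_max_measurable:
  fixes \<Omega> :: "(real^'n) set"
  assumes O: "open \<Omega>"
  shows "(\<lambda>x. grand_max (bdist \<Omega> x / 2) N f x) \<in> borel_measurable (lebesgue_on \<Omega>)"
proof (rule borel_measurableI_greater)
  fix a
  have "{x \<in> space (lebesgue_on \<Omega>). a < grand_max (bdist \<Omega> x / 2) N f x} = {x \<in> \<Omega>. a < grand_max (bdist \<Omega> x / 2) N f x}" by simp
  moreover have "{x \<in> \<Omega>. a < grand_max (bdist \<Omega> x / 2) N f x} \<in> sets (lebesgue_on \<Omega>)"
    using open_grand_max[OF O, of a N f] O by (auto simp: sets_restrict_space_iff)
  ultimately show "{x \<in> space (lebesgue_on \<Omega>). a < grand_max (bdist \<Omega> x / 2) N f x} \<in> sets (lebesgue_on \<Omega>)" by simp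
qed

theorem H1p_ball_gradient:
  fixes N :: nat and p :: real
  assumes p: "p > 0" and N: "N \<ge> 1"
  shows "\<exists>C>0. \<forall>(\<Omega>::(real^'n) set). open \<Omega> \<longrightarrow> (\<forall>u\<in>H1p p N \<Omega>. \<exists>g\<in>gradients (ball_pairs \<Omega>) p \<Omega> u.
    Lp_norm p \<Omega> g \<le> ennreal C * (\<Sum>j\<in>UNIV. Hp_norm p N \<Omega> (weak_deriv \<Omega> u j)))"
proof -
  obtain C0 where C0: "C0 > 0" and pw: "\<forall>(\<Omega>::(real^'n) set) u x y \<gamma> \<gamma>'. locally_integrable \<Omega> u \<longrightarrow> x \<noteq> y \<longrightarrow>
    ball x (2 * dist x y) \<subseteq> \<Omega> \<longrightarrow> ball y (2 * dist x y) \<subseteq> \<Omega> \<longrightarrow> lebesgue_point u x \<longrightarrow> lebesgue_point u y \<longrightarrow>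
    (\<forall>j s \<phi>. 0 < s \<longrightarrow> s \<le> 2 * dist x y \<longrightarrow> \<phi> \<in> test_funs_N N x s \<longrightarrow> \<bar>weak_deriv \<Omega> u j \<phi>\<bar> \<le> \<gamma> j) \<longrightarrow>
    (\<forall>j s \<phi>. 0 < s \<longrightarrow> s \<le> 2 * dist x y \<longrightarrow> \<phi> \<in> test_funs_N N y s \<longrightarrow> \<bar>weak_deriv \<Omega> u j \<phi>\<bar> \<le> \<gamma>' j) \<longrightarrow>
    \<bar>u x - u y\<bar> \<le> dist x y * (C0 * (\<Sum>j\<in>UNIV. \<gamma> j) + C0 * (\<Sum>j\<in>UNIV. \<gamma>' j))"
    using H1p_pointwise[OF N] by (elim exE conjE) (rule that)
  define c where "c = real CARD('n)"
  have c: "c > 0" by (simp add: c_def)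
  \<comment> \<open>One factor c^p comes from the p-th power of a sum of \<open>c\<close> terms, the
    last \<open>c\<close> from bounding each of the \<open>c\<close> quasinorms by their
    sum.\<close>
  define K where "K = C0 powr p * (c powr p * c)"
  have K: "K > 0" using C0 c by (simp add: K_def)
  show ?thesis
  proof (rule exI[of _ "K powr (1 / p)"], intro conjI allI impI ballI)
    fix \<Omega> :: "(real^'n) set" and u
    assume O: "open \<Omega>" and u: "u \<in> H1p p N \<Omega>"
    define D where "D j = weak_deriv \<Omega> u j" for j
    define F where "F j x = grand_max (bdist \<Omega> x / 2) N (D j) x" for j x
    have li: "locally_integrable \<Omega> u" and Hp: "\<And>j. Hp_norm p N \<Omega> (D j) < \<infinity>"
      using u by (auto simp: H1p_def Hp_def D_def)
    have Fm [measurable]: "F j \<in> borel_measurable (lebesgue_on \<Omega>)" for j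
      unfolding F_def by (rule grand_max_measurable[OF O])
    have Fmod: "(\<integral>\<^sup>+x. epowr (F j x) p \<partial>lebesgue_on \<Omega>) = epowr (Hp_norm p N \<Omega> (D j)) p" for j
      unfolding Hp_norm_def F_def by (rule epowr_eLp_norm[OF p, symmetric])
    have Ffin: "(\<integral>\<^sup>+x. epowr (F j x) p \<partial>lebesgue_on \<Omega>) \<noteq> top" for j
      unfolding Fmod using Hp[of j] epowr_less_top[of "Hp_norm p N \<Omega> (D j)" p] by (simp add: less_top)
    \<comment> \<open>Besides the points that are not Lebesgue points, those with an infinite grand
      maximal function are removed, because \<open>enn2real\<close> in the definition of
      \<open>g\<close> would send that value to 0.\<close>
    define E where "E = {x \<in> \<Omega>. \<not> lebesgue_point u x} \<union> (\<Union>j\<in>UNIV. {x \<in> \<Omega>. F j x = top})"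
    have E: "negligible E" "E \<subseteq> \<Omega>"
    proof -
      have "negligible (\<Union>j\<in>UNIV. {x \<in> \<Omega>. F j x = top})"
        using negligible_infinite[OF O Fm Ffin] by (intro negligible_Union) auto
      moreover have "negligible {x \<in> \<Omega>. \<not> lebesgue_point u x}"
        using li by (intro negligible_not_lebesgue_point_on O) (auto simp: locally_integrable_def)
      ultimately show "negligible E" by (simp add: E_def)
    qed (auto simp: E_def)
    define g where "g x = C0 * (\<Sum>j\<in>UNIV. enn2real (F j x))" for x
    have gm [measurable]: "g \<in> borel_measurable (lebesgue_on \<Omega>)" unfolding g_def by measurable
    have ug: "\<bar>u x - u y\<bar> \<le> dist x y * (g x + g y)" if xy: "x \<in> \<Omega> - E" "y \<in> \<Omega> - E" and bp: "ball_pairs \<Omega> x y" for x y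
    proof (cases "x = y")
      case False
      have \<gamma>: "\<bar>D j \<phi>\<bar> \<le> enn2real (F j z)"
        if z: "z \<in> \<Omega> - E" "ennreal (4 * dist x y) \<le> bdist \<Omega> z" and s: "0 < s" "s \<le> 2 * dist x y" "\<phi> \<in> test_funs_N N z s" for j z s \<phi>
      proof -
        have "ennreal (2 * s) \<le> ennreal (4 * dist x y)" using s by (intro ennreal_leI) auto
        then have "ennreal (2 * s) \<le> bdist \<Omega> z" using z(2) by (rule order_trans)
        then have "ennreal s \<le> bdist \<Omega> z / 2" by (rule ennreal_le_divide_numeralI)
        then have "ennreal \<bar>D j \<phi>\<bar> \<le> F j z" unfolding F_def grand_max_def using s by (intro SUP_upper) auto
        moreover have "F j z \<noteq> top" using z by (auto simp: E_def)
        ultimately show ?thesis by (cases "F j z") auto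
      qed
      have sub: "ball z (2 * dist x y) \<subseteq> \<Omega>" if "z \<in> \<Omega> - E" "ennreal (4 * dist x y) \<le> bdist \<Omega> z" for z
      proof -
        have "ennreal (2 * dist x y) \<le> ennreal (4 * dist x y)" by (intro ennreal_leI) auto
        then have "ennreal (2 * dist x y) \<le> bdist \<Omega> z" using that(2) by (rule order_trans)
        then show ?thesis using that(1) by (intro ball_subset_of_le_bdist) auto
      qed
      show ?thesis unfolding g_def
      proof (rule pw[rule_format, OF li False])
        show "ball x (2 * dist x y) \<subseteq> \<Omega>" "ball y (2 * dist x y) \<subseteq> \<Omega>"
          using sub xy ball_pairsD[OF bp] by auto
        show "lebesgue_point u x" "lebesgue_point u y" using xy by (auto simp: E_def)
        show "\<bar>weak_deriv \<Omega> u j \<phi>\<bar> \<le> enn2real (F j x)" if "0 < s" "s \<le> 2 * dist x y" "\<phi> \<in> test_funs_N N x s" for j s \<phi>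
          using \<gamma>[OF xy(1) ball_pairsD(1)[OF bp] that] by (simp add: D_def)
        show "\<bar>weak_deriv \<Omega> u j \<phi>\<bar> \<le> enn2real (F j y)" if "0 < s" "s \<le> 2 * dist x y" "\<phi> \<in> test_funs_N N y s" for j s \<phi>
          using \<gamma>[OF xy(2) ball_pairsD(2)[OF bp] that] by (simp add: D_def)
      qed
    qed simp
    define H where "H = (\<Sum>j\<in>UNIV. Hp_norm p N \<Omega> (D j))"
    have Hfin: "H < top" unfolding H_def using Hp by simp
    have "(\<integral>\<^sup>+x. epowr (ennreal \<bar>g x\<bar>) p \<partial>lebesgue_on \<Omega>) \<le> (\<integral>\<^sup>+x. ennreal (C0 powr p * c powr p) * (\<Sum>j\<in>UNIV. epowr (F j x) p) \<partial>lebesgue_on \<Omega>)"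
    proof (rule nn_integral_mono)
      fix x
      have "\<bar>g x\<bar> = C0 * (\<Sum>j\<in>UNIV. enn2real (F j x))"
        unfolding g_def using C0 by (simp add: abs_mult sum_nonneg)
      then have "ennreal \<bar>g x\<bar> = ennreal C0 * (\<Sum>j\<in>UNIV. ennreal (enn2real (F j x)))"
        using C0 by (simp add: ennreal_mult sum_nonneg)
      also have "\<dots> \<le> ennreal C0 * (\<Sum>j\<in>UNIV. F j x)"
        by (intro mult_left_mono sum_mono) (auto simp: ennreal_enn2real_if)
      finally have "epowr (ennreal \<bar>g x\<bar>) p \<le> epowr (ennreal C0 * (\<Sum>j\<in>UNIV. F j x)) p" using p by (intro epowr_mono) auto
      also have "\<dots> = ennreal (C0 powr p) * epowr (\<Sum>j\<in>UNIV. F j x) p" by (rule epowr_cmult[OF C0])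
      also have "\<dots> \<le> ennreal (C0 powr p) * (ennreal (c powr p) * (\<Sum>j\<in>UNIV. epowr (F j x) p))"
        unfolding c_def using p by (intro mult_left_mono epowr_sum_le) auto
      finally show "epowr (ennreal \<bar>g x\<bar>) p \<le> ennreal (C0 powr p * c powr p) * (\<Sum>j\<in>UNIV. epowr (F j x) p)"
        by (simp add: ennreal_mult mult.assoc)
    qed
    also have "\<dots> = ennreal (C0 powr p * c powr p) * (\<integral>\<^sup>+x. (\<Sum>j\<in>UNIV. epowr (F j x) p) \<partial>lebesgue_on \<Omega>)"
      by (rule nn_integral_cmult) measurable
    also have "(\<integral>\<^sup>+x. (\<Sum>j\<in>UNIV. epowr (F j x) p) \<partial>lebesgue_on \<Omega>) = (\<Sum>j\<in>UNIV. \<integral>\<^sup>+x. epowr (F j x) p \<partial>lebesgue_on \<Omega>)"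
      by (rule nn_integral_sum) measurable
    also have "\<dots> = (\<Sum>j\<in>UNIV. epowr (Hp_norm p N \<Omega> (D j)) p)" by (simp add: Fmod)
    also have "\<dots> \<le> (\<Sum>j\<in>(UNIV::'n set). epowr H p)"
      unfolding H_def using p by (intro sum_mono epowr_mono member_le_sum) auto
    also have "\<dots> = ennreal c * epowr H p" by (simp add: c_def ennreal_of_nat_eq_real_of_nat)
    also have "ennreal (C0 powr p * c powr p) * (ennreal c * epowr H p) = ennreal K * epowr H p"
      using c by (simp add: K_def ennreal_mult mult.assoc)
    finally have "(\<integral>\<^sup>+x. epowr (ennreal \<bar>g x\<bar>) p \<partial>lebesgue_on \<Omega>) \<le> ennreal K * epowr H p"
      by (simp add: mult_left_mono)
    then have "Lp_norm p \<Omega> g \<le> epowr (ennreal K * epowr H p) (1 / p)"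
      unfolding Lp_norm_def eLp_norm_def using p by (intro epowr_mono) auto
    also have "\<dots> = ennreal (K powr (1 / p)) * H"
      using p by (simp add: epowr_cmult[OF K] epowr_epowr epowr_one)
    finally have norm: "Lp_norm p \<Omega> g \<le> ennreal (K powr (1 / p)) * H" .
    also have "\<dots> < top" using Hfin by (simp add: ennreal_mult_less_top)
    finally have "g \<in> Lp p \<Omega>" using gm by (simp add: Lp_def)
    then have "g \<in> gradients (ball_pairs \<Omega>) p \<Omega> u" using E ug unfolding gradients_def by blast
    then show "\<exists>g\<in>gradients (ball_pairs \<Omega>) p \<Omega> u.
        Lp_norm p \<Omega> g \<le> ennreal (K powr (1 / p)) * (\<Sum>j\<in>UNIV. Hp_norm p N \<Omega> (weak_deriv \<Omega> u j))"
      using norm unfolding H_def D_def by blast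
  qed (use K in simp)
qed

section \<open>Comparison of the norms\<close>

lemma le_mult_INF_ennreal:
  assumes C: "C > 0" and le: "\<And>g. g \<in> X \<Longrightarrow> a \<le> ennreal C * f g"
  shows "a \<le> ennreal C * (INF g\<in>X. f g)"
proof -
  have inv: "ennreal (1 / C) * ennreal C = 1" using C by (simp add: ennreal_mult[symmetric])
  have "ennreal (1 / C) * a \<le> (INF g\<in>X. f g)"
  proof (rule INF_greatest)
    fix g assume "g \<in> X"
    then have "ennreal (1 / C) * a \<le> ennreal (1 / C) * (ennreal C * f g)" by (intro mult_left_mono le) auto
    then show "ennreal (1 / C) * a \<le> f g" by (simp add: mult.assoc[symmetric] inv)
  qed
  then have "ennreal C * (ennreal (1 / C) * a) \<le> ennreal C * (INF g\<in>X. f g)" by (rule mult_left_mono) simp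
  then show ?thesis by (simp add: mult.assoc[symmetric] mult.commute[of "ennreal C"] inv)
qed

lemma ennreal_le_max_one_mult: "x \<le> ennreal (max 1 C) * x"
proof -
  have "1 * x \<le> ennreal (max 1 C) * x"
    by (rule mult_right_mono) (auto simp flip: ennreal_1 intro: ennreal_leI)
  then show ?thesis by simp
qed

lemma ennreal_mult_le_max_one: "ennreal C * x \<le> ennreal (max 1 C) * x"
  by (intro mult_right_mono ennreal_leI) auto

theorem theorem19:
  fixes \<Omega> :: "(real^'n) set" and p :: real and N :: nat
  assumes "real CARD('n) / (real CARD('n) + 1) < p" and "p \<le> 1"
    and "real N > max 0 (real CARD('n) * (1 / p - 1))"
    and "uniform_domain \<Omega>"
  shows "M1p_ball p \<Omega> = M1p p \<Omega> \<and>
         equivalent_norms (M1p p \<Omega>) (M1p_ball_norm p \<Omega>) (M1p_norm p \<Omega>) \<and>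
         H1p p N \<Omega> = M1p p \<Omega> \<and>
         equivalent_norms (M1p p \<Omega>) (H1p_norm p N \<Omega>) (M1p_norm p \<Omega>)"
proof -
  have "0 \<le> real CARD('n) / (real CARD('n) + 1)" by simp
  then have p: "p > 0" using assms(1) by linarith
  have N: "N \<ge> 1" using assms(3) by simp
  have O: "open \<Omega>" using assms(4) by (simp add: uniform_domain_def domain_def)
  let ?A = "gradients (\<lambda>_ _. True) p \<Omega>" and ?B = "gradients (ball_pairs \<Omega>) p \<Omega>"
  let ?D = "\<lambda>j u. weak_deriv \<Omega> u j"
  obtain CA where CA: "CA > 0" "\<And>u g. g \<in> ?B u \<Longrightarrow> \<exists>g'\<in>?A u. Lp_norm p \<Omega> g' \<le> ennreal CA * Lp_norm p \<Omega> g"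
    using gradients_ball_to_global[OF assms(4) p] by blast
  obtain CB where CB: "CB > 0" "\<And>u g j. u \<in> borel_measurable (lebesgue_on \<Omega>) \<Longrightarrow> g \<in> ?A u \<Longrightarrow>
      Hp_norm p N \<Omega> (?D j u) \<le> ennreal CB * Lp_norm p \<Omega> g"
    using Hp_norm_deriv_le[OF assms(1) N] O by blast
  obtain CC where CC: "CC > 0" "\<And>u. u \<in> H1p p N \<Omega> \<Longrightarrow> \<exists>g\<in>?B u. Lp_norm p \<Omega> g \<le> ennreal CC * (\<Sum>j\<in>UNIV. Hp_norm p N \<Omega> (?D j u))"
    using H1p_ball_gradient[OF p N] O by blast
  have sub: "?A u \<subseteq> ?B u" for u unfolding gradients_def by auto
  have MM: "M1p_ball p \<Omega> = M1p p \<Omega>"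
  proof
    show "M1p_ball p \<Omega> \<subseteq> M1p p \<Omega>" unfolding M1p_ball_def M1p_def using CA(2) by blast
    show "M1p p \<Omega> \<subseteq> M1p_ball p \<Omega>" unfolding M1p_ball_def M1p_def using sub by blast
  qed
  have HM: "H1p p N \<Omega> = M1p p \<Omega>"
  proof
    have "H1p p N \<Omega> \<subseteq> M1p_ball p \<Omega>"
    proof
      fix u assume u: "u \<in> H1p p N \<Omega>"
      then have "u \<in> Lp p \<Omega>" by (simp add: H1p_def)
      then show "u \<in> M1p_ball p \<Omega>" using CC(2)[OF u] unfolding M1p_ball_def by blast
    qed
    then show "H1p p N \<Omega> \<subseteq> M1p p \<Omega>" using MM by simp
    show "M1p p \<Omega> \<subseteq> H1p p N \<Omega>"
    proof
      fix u assume "u \<in> M1p p \<Omega>"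
      then obtain g where u: "u \<in> Lp p \<Omega>" and g: "g \<in> ?A u" by (auto simp: M1p_def)
      have um: "u \<in> borel_measurable (lebesgue_on \<Omega>)" using u by (simp add: Lp_def)
      have li: "locally_integrable \<Omega> u" by (rule locally_integrable_of_gradient[OF assms(1) O um g])
      have "Lp_norm p \<Omega> g < \<infinity>" using g by (simp add: gradients_def Lp_def)
      then have "ennreal CB * Lp_norm p \<Omega> g < \<infinity>" by (simp add: ennreal_mult_less_top)
      then have "Hp_norm p N \<Omega> (?D j u) < \<infinity>" for j using CB(2)[OF um g, of j] by (rule order_le_less_trans[rotated])
      then show "u \<in> H1p p N \<Omega>"
        using li u distribution_on_distr_deriv[OF li] by (simp add: H1p_def Hp_def)
    qed
  qed
  \<comment> \<open>The maxima with 1 absorb the L^p norm of \<open>u\<close>, which occurs with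
    factor 1 in all three norms.\<close>
  define C1 where "C1 = max 1 CA"
  define C2 where "C2 = max 1 (real CARD('n) * CB)"
  define C3 where "C3 = max 1 CC"
  have n1: "M1p_ball_norm p \<Omega> u \<le> M1p_norm p \<Omega> u" for u
    unfolding M1p_ball_norm_def M1p_norm_def by (intro add_left_mono INF_superset_mono sub) auto
  have n2: "M1p_norm p \<Omega> u \<le> ennreal C1 * M1p_ball_norm p \<Omega> u" for u
  proof -
    have "(INF g\<in>?A u. Lp_norm p \<Omega> g) \<le> ennreal C1 * (INF g\<in>?B u. Lp_norm p \<Omega> g)"
    proof (rule le_mult_INF_ennreal)
      fix g assume "g \<in> ?B u"
      then obtain g' where g': "g' \<in> ?A u" "Lp_norm p \<Omega> g' \<le> ennreal CA * Lp_norm p \<Omega> g" using CA(2) by blast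
      have "(INF g\<in>?A u. Lp_norm p \<Omega> g) \<le> Lp_norm p \<Omega> g'" by (rule INF_lower[OF g'(1)])
      also note g'(2)
      also have "ennreal CA * Lp_norm p \<Omega> g \<le> ennreal C1 * Lp_norm p \<Omega> g" unfolding C1_def by (rule ennreal_mult_le_max_one)
      finally show "(INF g\<in>?A u. Lp_norm p \<Omega> g) \<le> ennreal C1 * Lp_norm p \<Omega> g" .
    qed (simp add: C1_def)
    then show ?thesis
      unfolding M1p_ball_norm_def M1p_norm_def distrib_left C1_def by (intro add_mono ennreal_le_max_one_mult)
  qed
  have n3: "H1p_norm p N \<Omega> u \<le> ennreal C2 * M1p_norm p \<Omega> u" if u: "u \<in> M1p p \<Omega>" for u
  proof -
    have um: "u \<in> borel_measurable (lebesgue_on \<Omega>)" using u by (simp add: M1p_def Lp_def)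
    have "(\<Sum>j\<in>UNIV. Hp_norm p N \<Omega> (?D j u)) \<le> ennreal C2 * (INF g\<in>?A u. Lp_norm p \<Omega> g)"
    proof (rule le_mult_INF_ennreal)
      fix g assume g: "g \<in> ?A u"
      have "(\<Sum>j\<in>UNIV. Hp_norm p N \<Omega> (?D j u)) \<le> (\<Sum>j\<in>(UNIV::'n set). ennreal CB * Lp_norm p \<Omega> g)"
        by (intro sum_mono CB(2)[OF um g])
      also have "\<dots> = ennreal (real CARD('n) * CB) * Lp_norm p \<Omega> g"
        using CB(1) by (simp add: ennreal_mult ennreal_of_nat_eq_real_of_nat mult.assoc)
      also have "\<dots> \<le> ennreal C2 * Lp_norm p \<Omega> g" unfolding C2_def by (rule ennreal_mult_le_max_one)
      finally show "(\<Sum>j\<in>UNIV. Hp_norm p N \<Omega> (?D j u)) \<le> ennreal C2 * Lp_norm p \<Omega> g" .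
    qed (simp add: C2_def)
    then show ?thesis
      unfolding H1p_norm_def M1p_norm_def distrib_left C2_def
      by (subst add.commute) (intro add_mono ennreal_le_max_one_mult)
  qed
  \<comment> \<open>The Hardy-Sobolev norm directly controls only the local norm; the bound for the
    global norm follows by composing with \<open>n2\<close>, hence the product of constants
    below.\<close>
  have n4: "M1p_ball_norm p \<Omega> u \<le> ennreal C3 * H1p_norm p N \<Omega> u" if u: "u \<in> M1p p \<Omega>" for u
  proof -
    obtain g where g: "g \<in> ?B u" "Lp_norm p \<Omega> g \<le> ennreal CC * (\<Sum>j\<in>UNIV. Hp_norm p N \<Omega> (?D j u))"
      using CC(2) u HM by blast
    have "(INF g\<in>?B u. Lp_norm p \<Omega> g) \<le> Lp_norm p \<Omega> g" by (rule INF_lower[OF g(1)])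
    also note g(2)
    also have "ennreal CC * (\<Sum>j\<in>UNIV. Hp_norm p N \<Omega> (?D j u)) \<le> ennreal C3 * (\<Sum>j\<in>UNIV. Hp_norm p N \<Omega> (?D j u))"
      unfolding C3_def by (rule ennreal_mult_le_max_one)
    finally show ?thesis
      unfolding H1p_norm_def M1p_ball_norm_def distrib_left C3_def
      by (subst add.commute) (intro add_mono ennreal_le_max_one_mult)
  qed
  have E1: "equivalent_norms (M1p p \<Omega>) (M1p_ball_norm p \<Omega>) (M1p_norm p \<Omega>)"
    unfolding equivalent_norms_def
  proof (intro exI[of _ C1] conjI ballI n2)
    fix u
    show "M1p_ball_norm p \<Omega> u \<le> ennreal C1 * M1p_norm p \<Omega> u"
      using n1[of u] ennreal_le_max_one_mult[of "M1p_norm p \<Omega> u" CA] unfolding C1_def by (rule order_trans)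
  qed (simp add: C1_def)
  have E2: "equivalent_norms (M1p p \<Omega>) (H1p_norm p N \<Omega>) (M1p_norm p \<Omega>)"
    unfolding equivalent_norms_def
  proof (intro exI[of _ "max C2 (C1 * C3)"] conjI ballI)
    show "0 < max C2 (C1 * C3)" by (simp add: C2_def less_max_iff_disj)
    fix u assume u: "u \<in> M1p p \<Omega>"
    have "ennreal C2 * M1p_norm p \<Omega> u \<le> ennreal (max C2 (C1 * C3)) * M1p_norm p \<Omega> u"
      by (intro mult_right_mono ennreal_leI) auto
    with n3[OF u] show "H1p_norm p N \<Omega> u \<le> ennreal (max C2 (C1 * C3)) * M1p_norm p \<Omega> u" by (rule order_trans)
    have "M1p_norm p \<Omega> u \<le> ennreal C1 * M1p_ball_norm p \<Omega> u" by (rule n2)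
    also have "\<dots> \<le> ennreal C1 * (ennreal C3 * H1p_norm p N \<Omega> u)" by (intro mult_left_mono n4[OF u]) simp
    also have "\<dots> = ennreal (C1 * C3) * H1p_norm p N \<Omega> u"
      by (simp add: ennreal_mult C1_def C3_def mult.assoc)
    also have "\<dots> \<le> ennreal (max C2 (C1 * C3)) * H1p_norm p N \<Omega> u"
      by (intro mult_right_mono ennreal_leI) auto
    finally show "M1p_norm p \<Omega> u \<le> ennreal (max C2 (C1 * C3)) * H1p_norm p N \<Omega> u" .
  qed
  show ?thesis using MM E1 HM E2 by blast
qed

end
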